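(* Let $0<q<1$, let $\ell\ge 2$ be an integer and let $N\in\mathbb{Z}$. Let $H_N$ and $D_N$ be the Hilbert space and the Dolbeault--Dirac operator of the D'Andrea--D\k{a}browski spectral triple $(\mathcal{A}(\mathbb{C}\mathrm{P}^\ell_q),H_N,D_N)$ on the quantum projective space $\mathbb{C}\mathrm{P}^\ell_q$, and let $K_{2\rho}$ be the positive invertible (unbounded) operator on $H_N$ given by the closure of the left action of the element $K_{2\rho}\in \mathrm{U}_q(\mathfrak{su}(\ell+1))$. Then: (1) the operator $K_{2\rho}(D_N^2+1)^{-s/2}$ is trace-class for all $s>2\ell$; (2) the corresponding spectral dimension, in the sense of modular spectral triples, is $2\ell$, i.e. $$\inf\big\{s>0:\ \mathrm{Tr}\big(K_{2\rho}(D_N^2+1)^{-s/2}\big)<\infty\big\}=2\ell;$$ (3) the limit $$\lim_{s\to 2\ell^+}(s-2\ell)\,\mathrm{Tr}\big(K_{2\rho}(D_N^2+1)^{-s/2}\big)$$ exists and is non-zero.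
   Context: For $0<q<1$, $\mathrm{U}_q(\mathfrak{su}(\ell+1))$ is the $*$-algebra generated by $K_i=K_i^*$, $K_i^{-1}$, $E_i$, $F_i=E_i^*$ ($i=1,\dots,\ell$) with relations $[K_i,K_j]=0$; $K_iE_iK_i^{-1}=qE_i$; $K_iE_jK_i^{-1}=q^{-1/2}E_j$ if $|i-j|=1$; $K_iE_jK_i^{-1}=E_j$ if $|i-j|>1$; $[E_i,F_j]=\delta_{ij}\frac{K_i^2-K_i^{-2}}{q-q^{-1}}$; $E_i^2E_j-(q+q^{-1})E_iE_jE_i+E_jE_i^2=0$ if $|i-j|=1$; $[E_i,E_j]=0$ if $|i-j|>1$. Put $$K_{2\rho} = \big(K_1^{\ell}K_2^{2(\ell-1)}\cdots K_j^{j(\ell-j+1)}\cdots K_\ell^{\ell}\big)^2 .$$ For $n=(n_1,\dots,n_\ell)\in\mathbb{N}^\ell$, $V_n$ is the irreducible finite-dimensional $*$-representation $\rho_n$ in which the $K_j$ are positive, with highest weight vector $v$ annihilated by all $E_j$ and $\rho_n(K_i)v=q^{n_i/2}v$. The data $(H_N,D_N)$. For $0\le k\le\ell$, $\Omega^k_N$ is the $q$-analogue of the module of antiholomorphic $k$-forms on $\mathbb{C}\mathrm{P}^\ell$ twisted by a line bundle $\Gamma_N$. $H_N$ is the Hilbert space completion of $\bigoplus_{k=0}^\ell\Omega^k_N$. This space carries a left action of $\mathrm{U}_q(\mathfrak{su}(\ell+1))$ (a $*$-representation with respect to the inner product) and decomposes as an orthogonal direct sum of irreducible representations: $$\Omega^0_N\simeq\bigoplus_{m\in\mathbb{N}}V_{(m+c_1,0,\dots,0,m+c_2)},\qquad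 \Omega^\ell_N\simeq\bigoplus_{m\in\mathbb{N}}V_{(m+c_7,0,\dots,0,m+c_8)},$$ $$\Omega^k_N\simeq\bigoplus_{m\in\mathbb{N}}V_{(m+c_3,0,\dots,0,m+c_4)+e_k}\oplus V_{(m+c_5,0,\dots,0,m+c_6)+e_{k+1}}\qquad (1\le k\le\ell-1),$$ where $e_k$ is the $k$-th standard basis vector of $\mathbb{Z}^\ell$ and $c_1,\dots,c_8$ are non-negative integers depending on $k$ and $N$ but not on $m$. $D_N$ is the self-adjoint unbounded operator on $H_N$ obtained by suitable linear combinations, on each $\Omega^k_N$, of the $q$-Dolbeault operator $\bar\partial:\Omega^k_N\to\Omega^{k+1}_N$ ($\bar\partial^2=0$) and its adjoint $\bar\partial^\dagger$. The following properties of $D_N$, established by D'Andrea and D\k{a}browski, specify it to the extent needed here: $D_N^2$ preserves each $\Omega^k_N$; it acts as a multiple $\lambda^2$ of the identity ($\lambda\ge 0$) on each irreducible summand $V_n$ in the decomposition of $\Omega^k_N$ ($0\le k\le\ell$) into irreducible representations of $\mathrm{U}_q(\mathfrak{su}(\ell+1))$; and, along each of the families of summands indexed by $m\in\mathbb{N}$, namely $V_{(m+c_1,0,\dots,0,m+c_2)}$ in $\Omega^0_N$, $V_{(m+c_3,0,\dots,0,m+c_4)+e_k}$ and $V_{(m+c_5,0,\dots,0,m+c_6)+e_{k+1}}$ in $\Omega^k_N$ for each $1\le k\le\ell-1$, and $V_{(m+c_7,0,\dots,0,m+c_8)}$ in $\Omega^\ell_N$, the eigenvalue $\lambda=\lambda_m$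 of $|D_N|$ satisfies $\lambda_m\sim q^{-m}$, i.e. $\lim_{m\to\infty}\lambda_m q^{m}$ exists and is a non-zero constant. The operator $K_{2\rho}$ on $H_N$ is the closure of the operator acting as $\rho_n(K_{2\rho})$ on each irreducible summand $V_n$; it is positive and invertible and commutes with $D_N^2$. $\mathrm{Tr}$ is the operator trace on $H_N$. *)

theory Defs
  imports "HOL-Analysis.Analysis"
begin

text \<open>The inner product is conjugate-linear in the first and linear in the second argument. Its real
  part is the inner product of \<^class>\<open>real_inner\<close>, so norm, topology and closure are the library's.\<close>

class complex_hilbert = real_inner + complete_space +
  fixes scaleC :: "complex \<Rightarrow> 'a \<Rightarrow> 'a" (infixr "*\<^sub>C" 75)
    and cinner :: "'a \<Rightarrow> 'a \<Rightarrow> complex"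
  assumes scaleC_add_right: "a *\<^sub>C (x + y) = a *\<^sub>C x + a *\<^sub>C y"
    and scaleC_add_left: "(a + b) *\<^sub>C x = a *\<^sub>C x + b *\<^sub>C x"
    and scaleC_scaleC: "a *\<^sub>C (b *\<^sub>C x) = (a * b) *\<^sub>C x"
    and scaleC_of_real: "complex_of_real r *\<^sub>C x = r *\<^sub>R x"
    and cinner_commute: "cinner x y = cnj (cinner y x)"
    and cinner_add_right: "cinner x (y + z) = cinner x y + cinner x z"
    and cinner_scaleC_right: "cinner x (a *\<^sub>C y) = a * cinner x y"
    and inner_eq_Re_cinner: "inner x y = Re (cinner x y)"

definition csubspace :: "'h::complex_hilbert set \<Rightarrow> bool" where
  "csubspace V \<longleftrightarrow> subspace V \<and> (\<forall>a. \<forall>x\<in>V. a *\<^sub>C x \<in> V)"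

definition corthogonal :: "'h::complex_hilbert set \<Rightarrow> 'h set \<Rightarrow> bool" where
  "corthogonal V W \<longleftrightarrow> (\<forall>x\<in>V. \<forall>y\<in>W. cinner x y = 0)"

definition clinear_into :: "'h::complex_hilbert set \<Rightarrow> 'h set \<Rightarrow> ('h \<Rightarrow> 'h) \<Rightarrow> bool" where
  "clinear_into V W f \<longleftrightarrow>
     (\<forall>x\<in>V. f x \<in> W) \<and> (\<forall>x\<in>V. \<forall>y\<in>V. f (x + y) = f x + f y) \<and>
     (\<forall>a. \<forall>x\<in>V. f (a *\<^sub>C x) = a *\<^sub>C f x)"

definition onb :: "'h::complex_hilbert set \<Rightarrow> bool" where
  "onb B \<longleftrightarrow> (\<forall>e\<in>B. \<forall>f\<in>B. cinner e f = (if e = f then 1 else 0)) \<and>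
     closure (csubspace hull B) = UNIV"

definition bounded_clinear :: "('h::complex_hilbert \<Rightarrow> 'h) \<Rightarrow> bool" where
  "bounded_clinear T \<longleftrightarrow> bounded_linear T \<and> (\<forall>a x. T (a *\<^sub>C x) = a *\<^sub>C T x)"

text \<open>A not necessarily everywhere defined operator is represented by its graph. The closure of an
  operator is then the topological \<^const>\<open>closure\<close> of its graph in the product space.\<close>

type_synonym 'h operator = "('h \<times> 'h) set"

definition graph_on :: "'h set \<Rightarrow> ('h \<Rightarrow> 'h) \<Rightarrow> 'h operator" where
  "graph_on V f = {(x, f x) | x. x \<in> V}"

text \<open>The product \<open>S T\<close> (first \<open>T\<close>, then \<open>S\<close>) on its natural domain.\<close>

definition op_mult :: "'h operator \<Rightarrow> 'h operator \<Rightarrow> 'h operator" where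
  "op_mult S T = T O S"

definition op_plus_one :: "'h::complex_hilbert operator \<Rightarrow> 'h operator" where
  "op_plus_one T = {(x, y + x) | x y. (x, y) \<in> T}"

definition op_adjoint :: "'h::complex_hilbert operator \<Rightarrow> 'h operator" where
  "op_adjoint T = {(y, z). \<forall>(x, w)\<in>T. cinner y w = cinner z x}"

definition self_adjoint :: "'h::complex_hilbert operator \<Rightarrow> bool" where
  "self_adjoint T \<longleftrightarrow> closure (Domain T) = UNIV \<and> op_adjoint T = T"

definition eigenspace :: "'h::complex_hilbert operator \<Rightarrow> real \<Rightarrow> 'h set" where
  "eigenspace T \<mu> = {x. (x, \<mu> *\<^sub>R x) \<in> T}"

definition orth_proj :: "'h::complex_hilbert set \<Rightarrow> 'h \<Rightarrow> 'h" where
  "orth_proj M x = (THE p. p \<in> M \<and> (\<forall>z\<in>M. cinner z (x - p) = 0))"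

text \<open>Functional calculus of a self-adjoint operator with pure point spectrum (such as \<open>D\<^sup>2 + 1\<close> below,
  whose eigenspaces span a dense subspace): \<open>f(T) x = \<Sum>\<^sub>\<mu> f(\<mu>) P\<^sub>\<mu> x\<close> with \<open>P\<^sub>\<mu>\<close> the projection onto
  the \<open>\<mu>\<close>-eigenspace. As the terms are mutually orthogonal, convergence of the sum means
  \<open>\<Sum>\<^sub>\<mu> |f(\<mu>)|\<^sup>2 \<parallel>P\<^sub>\<mu> x\<parallel>\<^sup>2 < \<infinity>\<close>, i.e. the domain is the usual one.\<close>

definition fun_calc :: "(real \<Rightarrow> real) \<Rightarrow> 'h::complex_hilbert operator \<Rightarrow> 'h operator" where
  "fun_calc f T = {(x, y). ((\<lambda>\<mu>. f \<mu> *\<^sub>R orth_proj (eigenspace T \<mu>) x) has_sum y) UNIV}"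

definition op_powr :: "'h::complex_hilbert operator \<Rightarrow> real \<Rightarrow> 'h operator" where
  "op_powr T a = fun_calc (\<lambda>\<mu>. \<mu> powr a) T"

text \<open>\<open>P\<close> is the absolute value \<open>|T| = (T* T)\<^bsup>1/2\<^esup>\<close>: it is positive and \<open>P* P = T* T\<close>.\<close>

definition is_abs_op :: "('h::complex_hilbert \<Rightarrow> 'h) \<Rightarrow> ('h \<Rightarrow> 'h) \<Rightarrow> bool" where
  "is_abs_op T P \<longleftrightarrow> bounded_clinear P \<and>
     (\<forall>x y. cinner (P x) y = cinner x (P y)) \<and> (\<forall>x. 0 \<le> Re (cinner x (P x))) \<and>
     (\<forall>x y. cinner (P x) (P y) = cinner (T x) (T y))"

definition trace_class :: "'h::complex_hilbert operator \<Rightarrow> bool" where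
  "trace_class G \<longleftrightarrow> (\<exists>T P B. G = graph_on UNIV T \<and> bounded_clinear T \<and> is_abs_op T P \<and>
     onb B \<and> (\<lambda>e. Re (cinner e (P e))) summable_on B)"

text \<open>The operator trace of a positive self-adjoint operator, with values in \<open>[0, \<infinity>]\<close>. It does not depend
  on the orthonormal basis, and it is infinite for unbounded operators.\<close>

definition op_trace :: "'h::complex_hilbert operator \<Rightarrow> ennreal" where
  "op_trace G =
     (if \<exists>T. G = graph_on UNIV T \<and> bounded_clinear T
      then infsum (\<lambda>e. ennreal (Re (cinner e (THE y. (e, y) \<in> G)))) (SOME B. onb B)
      else \<infinity>)"

definition zeta_op :: "'h::complex_hilbert operator \<Rightarrow> 'h operator \<Rightarrow> real \<Rightarrow> 'h operator" where
  "zeta_op K D s = op_mult K (op_powr (op_plus_one (op_mult D D)) (- s / 2))"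

definition spectral_dimension :: "'h::complex_hilbert operator \<Rightarrow> 'h operator \<Rightarrow> real" where
  "spectral_dimension K D = Inf {s. 0 < s \<and> op_trace (zeta_op K D s) < \<infinity>}"

datatype uq_gen = Kg nat | Kinvg nat | Eg nat | Fg nat

definition uq_gens :: "nat \<Rightarrow> uq_gen set" where
  "uq_gens l = (\<Union>i\<in>{1..l}. {Kg i, Kinvg i, Eg i, Fg i})"

text \<open>A \<open>*\<close>-representation of \<open>U\<^sub>q(su(l+1))\<close> on the (pre-Hilbert) space \<open>W\<close>, i.e. an assignment of operators
  on \<open>W\<close> to the generators satisfying the defining relations and the \<open>*\<close>-relations
  \<open>K\<^sub>i = K\<^sub>i*\<close>, \<open>F\<^sub>i = E\<^sub>i*\<close>. The indices run through \<open>{1..l}\<close>.\<close>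

definition uq_star_rep ::
  "real \<Rightarrow> nat \<Rightarrow> 'h::complex_hilbert set \<Rightarrow> (uq_gen \<Rightarrow> 'h \<Rightarrow> 'h) \<Rightarrow> bool" where
  "uq_star_rep q l W a \<longleftrightarrow>
     csubspace W \<and> (\<forall>g\<in>uq_gens l. clinear_into W W (a g)) \<and>
     (\<forall>i\<in>{1..l}. \<forall>x\<in>W. a (Kg i) (a (Kinvg i) x) = x \<and> a (Kinvg i) (a (Kg i) x) = x) \<and>
     (\<forall>i\<in>{1..l}. \<forall>j\<in>{1..l}. \<forall>x\<in>W. a (Kg i) (a (Kg j) x) = a (Kg j) (a (Kg i) x)) \<and>
     (\<forall>i\<in>{1..l}. \<forall>j\<in>{1..l}. \<forall>x\<in>W.
        a (Kg i) (a (Eg j) (a (Kinvg i) x)) =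
          (if i = j then q else if \<bar>int i - int j\<bar> = 1 then q powr (- 1 / 2) else 1) *\<^sub>R a (Eg j) x) \<and>
     (\<forall>i\<in>{1..l}. \<forall>j\<in>{1..l}. \<forall>x\<in>W.
        a (Eg i) (a (Fg j) x) - a (Fg j) (a (Eg i) x) =
          (if i = j
           then (1 / (q - 1 / q)) *\<^sub>R (a (Kg i) (a (Kg i) x) - a (Kinvg i) (a (Kinvg i) x)) else 0)) \<and>
     (\<forall>i\<in>{1..l}. \<forall>j\<in>{1..l}. \<forall>x\<in>W. \<bar>int i - int j\<bar> = 1 \<longrightarrow>
        a (Eg i) (a (Eg i) (a (Eg j) x)) - (q + 1 / q) *\<^sub>R a (Eg i) (a (Eg j) (a (Eg i) x))
          + a (Eg j) (a (Eg i) (a (Eg i) x)) = 0) \<and>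
     (\<forall>i\<in>{1..l}. \<forall>j\<in>{1..l}. \<forall>x\<in>W. \<bar>int i - int j\<bar> > 1 \<longrightarrow>
        a (Eg i) (a (Eg j) x) = a (Eg j) (a (Eg i) x)) \<and>
     (\<forall>i\<in>{1..l}. \<forall>x\<in>W. \<forall>y\<in>W.
        cinner (a (Kg i) x) y = cinner x (a (Kg i) y) \<and>
        cinner (a (Eg i) x) y = cinner x (a (Fg i) y))"

text \<open>The action of \<open>K\<^sub>2\<^sub>\<rho> = (\<Prod>\<^sub>j K\<^sub>j\<^bsup>j(l-j+1)\<^esup>)\<^sup>2\<close>.\<close>

definition K2rho_act :: "nat \<Rightarrow> (uq_gen \<Rightarrow> 'h \<Rightarrow> 'h) \<Rightarrow> 'h \<Rightarrow> 'h" where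
  "K2rho_act l a = (foldr (\<lambda>j f. (a (Kg j) ^^ (j * (l - j + 1))) \<circ> f) [1..<Suc l] id) ^^ 2"

text \<open>\<open>V\<close> carries the irreducible \<open>*\<close>-representation \<open>V\<^sub>n\<close> of highest weight \<open>n = (n 1, \<dots>, n l)\<close>,
  which these conditions determine up to unitary equivalence.\<close>

definition uq_irrep ::
  "real \<Rightarrow> nat \<Rightarrow> (nat \<Rightarrow> nat) \<Rightarrow> 'h::complex_hilbert set \<Rightarrow> (uq_gen \<Rightarrow> 'h \<Rightarrow> 'h) \<Rightarrow> bool" where
  "uq_irrep q l n V a \<longleftrightarrow>
     uq_star_rep q l V a \<and>
     (\<exists>B. finite B \<and> V \<subseteq> span B) \<and>
     V \<noteq> {0} \<and>
     (\<forall>U. csubspace U \<and> U \<subseteq> V \<and> (\<forall>g\<in>uq_gens l. \<forall>x\<in>U. a g x \<in> U) \<longrightarrow> U = {0} \<or> U = V) \<and>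
     (\<forall>j\<in>{1..l}. \<forall>x\<in>V. 0 \<le> Re (cinner x (a (Kg j) x))) \<and>
     (\<exists>v\<in>V. v \<noteq> 0 \<and>
        (\<forall>j\<in>{1..l}. a (Eg j) v = 0 \<and> a (Kg j) v = (q powr (real (n j) / 2)) *\<^sub>R v))"

text \<open>The families of irreducible summands of \<open>\<Omega>\<^sup>k\<close>: one for \<open>k = 0\<close> and \<open>k = l\<close>, two otherwise.\<close>

definition families :: "nat \<Rightarrow> nat \<Rightarrow> nat set" where
  "families l k = (if k = 0 \<or> k = l then {0} else {0, 1})"

definition edge_weight :: "nat \<Rightarrow> nat \<Rightarrow> nat \<Rightarrow> nat \<Rightarrow> nat" where
  "edge_weight l r s i = (if i = 1 then r else if i = l then s else 0)"

definition unit_weight :: "nat \<Rightarrow> nat \<Rightarrow> nat" where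
  "unit_weight k i = (if i = k then 1 else 0)"

text \<open>\<open>c p\<close>, \<open>p \<in> {1..8}\<close>, are the constants \<open>c\<^sub>p\<close> at fixed \<open>k\<close> (and fixed twist).\<close>

definition summand_weight :: "nat \<Rightarrow> (nat \<Rightarrow> nat) \<Rightarrow> nat \<Rightarrow> nat \<Rightarrow> nat \<Rightarrow> nat \<Rightarrow> nat" where
  "summand_weight l c k j m =
     (if k = 0 then edge_weight l (m + c 1) (m + c 2)
      else if k = l then edge_weight l (m + c 7) (m + c 8)
      else if j = 0 then (\<lambda>i. edge_weight l (m + c 3) (m + c 4) i + unit_weight k i)
      else (\<lambda>i. edge_weight l (m + c 5) (m + c 6) i + unit_weight (k + 1) i))"

definition total_forms :: "nat \<Rightarrow> (nat \<Rightarrow> 'h::complex_hilbert set) \<Rightarrow> 'h set" where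
  "total_forms l \<Omega> = span (\<Union>k\<in>{0..l}. \<Omega> k)"

definition K2rho_op ::
  "nat \<Rightarrow> (nat \<Rightarrow> 'h::complex_hilbert set) \<Rightarrow> (uq_gen \<Rightarrow> 'h \<Rightarrow> 'h) \<Rightarrow> 'h operator" where
  "K2rho_op l \<Omega> a = closure (graph_on (total_forms l \<Omega>) (K2rho_act l a))"

text \<open>The data \<open>(H\<^sub>N, D\<^sub>N)\<close>, where \<open>H\<^sub>N\<close> is the type \<open>'h\<close>. \<open>\<Omega> k\<close> are the twisted \<open>k\<close>-forms, \<open>a\<close> is the action
  of the quantized enveloping algebra, \<open>c p N k\<close> are the constants \<open>c\<^sub>p\<close>, \<open>S k j m\<close> is the \<open>m\<close>-th
  irreducible summand in the \<open>j\<close>-th family in \<open>\<Omega> k\<close>, and \<open>ev k j m\<close> is the eigenvalue of \<open>|D|\<close> on it.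
  On \<open>\<Omega> k\<close>, \<open>D\<close> is \<open>\<alpha> k\<close> times \<open>dbar\<close> plus \<open>\<beta> k\<close> times its adjoint.\<close>

locale dolbeault_dirac =
  fixes q :: real and l :: nat and N :: int
    and \<Omega> :: "nat \<Rightarrow> 'h::complex_hilbert set"
    and a :: "uq_gen \<Rightarrow> 'h \<Rightarrow> 'h"
    and c :: "nat \<Rightarrow> int \<Rightarrow> nat \<Rightarrow> nat"
    and S :: "nat \<Rightarrow> nat \<Rightarrow> nat \<Rightarrow> 'h set"
    and dbar dbar_adj :: "'h \<Rightarrow> 'h"
    and \<alpha> \<beta> :: "nat \<Rightarrow> complex"
    and D :: "'h operator"
    and ev :: "nat \<Rightarrow> nat \<Rightarrow> nat \<Rightarrow> real"
  assumes forms_csubspace: "k \<le> l \<Longrightarrow> csubspace (\<Omega> k)"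
    and forms_orthogonal: "\<lbrakk>k \<le> l; k' \<le> l; k \<noteq> k'\<rbrakk> \<Longrightarrow> corthogonal (\<Omega> k) (\<Omega> k')"
    and forms_dense: "closure (total_forms l \<Omega>) = UNIV"
    and action: "uq_star_rep q l (total_forms l \<Omega>) a"
    and summand_irrep: "\<lbrakk>k \<le> l; j \<in> families l k\<rbrakk> \<Longrightarrow>
          uq_irrep q l (summand_weight l (\<lambda>p. c p N k) k j m) (S k j m) a"
    and summand_orthogonal: "\<lbrakk>k \<le> l; j \<in> families l k; j' \<in> families l k; (j, m) \<noteq> (j', m')\<rbrakk> \<Longrightarrow>
          corthogonal (S k j m) (S k j' m')"
    and forms_decomposition: "k \<le> l \<Longrightarrow> \<Omega> k = span (\<Union>j\<in>families l k. \<Union>m. S k j m)"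
    and dbar_degree: "k < l \<Longrightarrow> clinear_into (\<Omega> k) (\<Omega> (k + 1)) dbar"
    and dbar_top: "x \<in> \<Omega> l \<Longrightarrow> dbar x = 0"
    and dbar_linear: "clinear_into (total_forms l \<Omega>) (total_forms l \<Omega>) dbar"
    and dbar_dbar: "x \<in> total_forms l \<Omega> \<Longrightarrow> dbar (dbar x) = 0"
    and dbar_adj_linear: "clinear_into (total_forms l \<Omega>) (total_forms l \<Omega>) dbar_adj"
    and dbar_adjoint: "\<lbrakk>x \<in> total_forms l \<Omega>; y \<in> total_forms l \<Omega>\<rbrakk> \<Longrightarrow>
          cinner (dbar x) y = cinner x (dbar_adj y)"
    and D_self_adjoint: "self_adjoint D"
    and D_forms: "\<lbrakk>k \<le> l; x \<in> \<Omega> k\<rbrakk> \<Longrightarrow> (x, \<alpha> k *\<^sub>C dbar x + \<beta> k *\<^sub>C dbar_adj x) \<in> D"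
    and D_sq_forms: "\<lbrakk>k \<le> l; x \<in> \<Omega> k\<rbrakk> \<Longrightarrow> \<exists>y\<in>\<Omega> k. (x, y) \<in> op_mult D D"
    and ev_nonneg: "\<lbrakk>k \<le> l; j \<in> families l k\<rbrakk> \<Longrightarrow> 0 \<le> ev k j m"
    and D_sq_summand: "\<lbrakk>k \<le> l; j \<in> families l k; x \<in> S k j m\<rbrakk> \<Longrightarrow>
          (x, (ev k j m)\<^sup>2 *\<^sub>R x) \<in> op_mult D D"
    and ev_asymptotics: "\<lbrakk>k \<le> l; j \<in> families l k\<rbrakk> \<Longrightarrow>
          \<exists>L. L \<noteq> 0 \<and> (\<lambda>m. ev k j m * q ^ m) \<longlonglongrightarrow> L"

end

theory Submission
  imports Defs
begin

text \<open>
  Let \<open>d\<^sub>m\<close> be the trace of \<open>K\<^sub>2\<^sub>\<rho>\<close> on the \<open>m\<close>-th summand of a family. Everything reduces to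
  \<open>q\<^bsup>2lm\<^esup> d\<^sub>m \<rightarrow> C > 0\<close>: since the eigenvalues of \<open>|D|\<close> grow like \<open>q\<^bsup>-m\<^esup>\<close>, each family then contributes a
  perturbed geometric series with ratio \<open>q\<^bsup>s-2l\<^esup>\<close>, whose residue at \<open>s = 2l\<close> is positive.

  The asymptotics of \<open>d\<^sub>m\<close> are obtained without the Weyl character formula. Quantum \<open>sl\<^sub>2\<close> theory makes the
  weight multiplicities symmetric under the Weyl group, so that \<open>K\<^sub>2\<^sub>\<rho>\<close> and its inverse have the same trace and
  \<open>q\<^bsup>(2\<rho>,n)\<^esup> d\<^sub>m = \<Sum>\<^sub>p \<delta>\<^sub>m(p) q\<^bsup>2p\<^esup>\<close>, where \<open>\<delta>\<^sub>m(p)\<close> is the dimension of the span of all \<open>F\<close>-words of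
  length \<open>p\<close> applied to the highest weight vector. For fixed \<open>p\<close> the Gram matrix of these words has
  entries that are Laurent polynomials in \<open>q\<^sup>m\<close>, so \<open>\<delta>\<^sub>m(p)\<close> is eventually constant in \<open>m\<close>. A
  Poincare--Birkhoff--Witt spanning set bounds \<open>\<delta>\<^sub>m(p)\<close> by a polynomial in \<open>p\<close> uniformly in \<open>m\<close>, and
  Tannery's theorem applies; the limit is at least \<open>\<delta>\<^sub>m(0) = 1\<close>.
\<close>

section \<open>Orthonormal bases and traces\<close>

text \<open>Passing to the inverse makes the limit accessible. On V_n the eigenvalues of K_2rho are
  q^(h - 2p), where h is the pairing of n with 2 rho and p counts letters \<open>F i\<close>. As q <
  1, the trace is dominated by the bottom of the module, at a depth that grows with m. The inverse,
  rescaled, has the eigenvalues q^(2p), and its dominant terms sit near the highest weight vector,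
  where multiplicities stabilise.

  The number 2l is the slope of h in m: 2 rho has coefficient j (l + 1 - j) at the j-th simple root,
  and only the entries 1 and l of the weight grow, each contributing l.

  The analytic obstacle is that K_2rho is unbounded and known only as a closure. The product with a
  power of D^2 + 1 is therefore identified through its coefficients in a joint orthonormal
  eigenbasis. Showing that it is everywhere defined also uses summability of the powers of D^2 + 1
  alone. This comes from x + 1/x >= 2, which together with the inversion symmetry bounds the
  dimension of a summand by its trace.\<close>

instance complex_hilbert \<subseteq> banach ..

section \<open>Sesquilinear algebra in a complex Hilbert space\<close>

lemma cinner_add_left: "cinner (x + y) z = cinner x z + cinner y z"
  by (metis cinner_add_right cinner_commute complex_cnj_add)

lemma cinner_scaleC_left: "cinner (a *\<^sub>C x) y = cnj a * cinner x y"
  by (metis cinner_commute cinner_scaleC_right complex_cnj_mult)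

lemma cinner_scaleR_right: "cinner x (r *\<^sub>R y) = of_real r * cinner x y"
  by (metis cinner_scaleC_right scaleC_of_real)

lemma cinner_scaleR_left: "cinner (r *\<^sub>R x) y = of_real r * cinner x y"
  by (metis cinner_scaleC_left scaleC_of_real complex_cnj_complex_of_real)

lemma cinner_zero_right [simp]: "cinner x 0 = 0"
  using cinner_scaleR_right[of x 0 0] by simp

lemma cinner_zero_left [simp]: "cinner 0 x = 0"
  using cinner_scaleR_left[of 0 0 x] by simp

lemma cinner_minus_right: "cinner x (- y) = - cinner x y"
  using cinner_scaleR_right[of x "-1" y] by simp

lemma cinner_diff_right: "cinner x (y - z) = cinner x y - cinner x z"
  using cinner_add_right[of x y "- z"] by (simp add: cinner_minus_right)

lemma cinner_diff_left: "cinner (x - y) z = cinner x z - cinner y z"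
  by (metis cinner_commute cinner_diff_right complex_cnj_diff)

lemma cinner_sum_right: "cinner x (\<Sum>i\<in>A. f i) = (\<Sum>i\<in>A. cinner x (f i))"
  by (induction A rule: infinite_finite_induct) (auto simp: cinner_add_right)

lemma cinner_self: "cinner x x = of_real ((norm x)\<^sup>2)"
proof -
  have "Im (cinner x x) = 0" using arg_cong[OF cinner_commute[of x x], of Im] by simp
  moreover have "Re (cinner x x) = (norm x)\<^sup>2"
    by (simp add: inner_eq_Re_cinner[symmetric] power2_norm_eq_inner)
  ultimately show ?thesis by (simp add: complex_eq_iff)
qed

lemma scaleC_zero_right [simp]: "a *\<^sub>C 0 = 0"
  using scaleC_add_right[of a 0 0] by simp

lemma scaleC_zero_left [simp]: "0 *\<^sub>C x = 0"
  using scaleC_of_real[of 0 x] by simp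

lemma scaleC_one [simp]: "1 *\<^sub>C x = x"
  using scaleC_of_real[of 1 x] by simp

lemma scaleC_sum_right: "a *\<^sub>C (\<Sum>i\<in>A. f i) = (\<Sum>i\<in>A. a *\<^sub>C f i)"
  by (induction A rule: infinite_finite_induct) (auto simp: scaleC_add_right)

lemma scaleC_scaleR_commute: "a *\<^sub>C (r *\<^sub>R x) = r *\<^sub>R (a *\<^sub>C x)"
  by (simp add: scaleC_of_real[symmetric] scaleC_scaleC mult.commute)

lemma norm_scaleC: "norm (a *\<^sub>C x) = cmod a * norm x"
proof -
  have "complex_of_real ((norm (a *\<^sub>C x))\<^sup>2) = (a * cnj a) * cinner x x"
    unfolding cinner_self[symmetric] by (simp add: cinner_scaleC_left cinner_scaleC_right)
  also have "\<dots> = of_real ((cmod a * norm x)\<^sup>2)"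
    unfolding complex_norm_square[symmetric] cinner_self by (simp add: power_mult_distrib)
  finally have "complex_of_real ((norm (a *\<^sub>C x))\<^sup>2) = of_real ((cmod a * norm x)\<^sup>2)" .
  then have "(norm (a *\<^sub>C x))\<^sup>2 = (cmod a * norm x)\<^sup>2" by (simp only: of_real_eq_iff)
  then show ?thesis by (simp add: power2_eq_iff_nonneg)
qed

text \<open>Multiplying \<open>y\<close> by the conjugate phase of the inner product makes that
  product real and non-negative, so the real Cauchy-Schwarz inequality applies.\<close>

lemma cinner_Cauchy_Schwarz: "cmod (cinner x y) \<le> norm x * norm y"
proof -
  define a where "a = cnj (sgn (cinner x y))"
  have "a * cinner x y = of_real (cmod (cinner x y))"
    by (simp add: a_def sgn_div_norm complex_norm_square[symmetric] mult.commute[of "cnj _"]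
        scaleR_conv_of_real power2_eq_square field_simps del: of_real_mult)
       (simp add: power2_eq_square flip: complex_norm_square)
  then have "cmod (cinner x y) = inner x (a *\<^sub>C y)"
    by (simp add: inner_eq_Re_cinner cinner_scaleC_right)
  also have "\<dots> \<le> norm x * norm (a *\<^sub>C y)" by (rule norm_cauchy_schwarz)
  also have "\<dots> \<le> norm x * norm y"
    by (intro mult_left_mono) (auto simp: norm_scaleC a_def norm_sgn)
  finally show ?thesis .
qed

lemma bounded_linear_cinner_right: "bounded_linear (cinner x)"
  by (rule bounded_linear_intro[where K = "norm x"])
    (auto simp: cinner_add_right cinner_scaleR_right scaleR_conv_of_real mult.commute[of _ "norm x"]
      cinner_Cauchy_Schwarz)

lemma csubspace_hull_csubspace: "csubspace (csubspace hull B)"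
  unfolding hull_def csubspace_def by (auto intro!: subspace_Inter)

lemma csubspace_hull_minimal: "\<lbrakk>B \<subseteq> V; csubspace V\<rbrakk> \<Longrightarrow> csubspace hull B \<subseteq> V"
  by (rule hull_minimal)

lemma csubspace_scaleC: "\<lbrakk>csubspace V; x \<in> V\<rbrakk> \<Longrightarrow> a *\<^sub>C x \<in> V"
  by (simp add: csubspace_def)

lemma csubspace_subspace: "csubspace V \<Longrightarrow> subspace V"
  by (simp add: csubspace_def)

section \<open>Orthonormal expansions\<close>

definition orthonormal :: "'h::complex_hilbert set \<Rightarrow> bool" where
  "orthonormal B \<longleftrightarrow> (\<forall>e\<in>B. \<forall>f\<in>B. cinner e f = (if e = f then 1 else 0))"

lemma onb_orthonormal: "onb B \<Longrightarrow> orthonormal B"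
  by (simp add: onb_def orthonormal_def)

lemma orthonormal_subset: "\<lbrakk>orthonormal B; G \<subseteq> B\<rbrakk> \<Longrightarrow> orthonormal G"
  unfolding orthonormal_def by blast

definition proj_on :: "'h::complex_hilbert set \<Rightarrow> 'h \<Rightarrow> 'h" where
  "proj_on F x = (\<Sum>b\<in>F. cinner b x *\<^sub>C b)"

lemma proj_on_add: "proj_on F (x + y) = proj_on F x + proj_on F y"
  by (simp add: proj_on_def cinner_add_right scaleC_add_left sum.distrib)

lemma proj_on_scaleC: "proj_on F (a *\<^sub>C x) = a *\<^sub>C proj_on F x"
  by (simp add: proj_on_def cinner_scaleC_right scaleC_scaleC[symmetric] scaleC_sum_right)

lemma proj_on_scaleR: "proj_on F (r *\<^sub>R x) = r *\<^sub>R proj_on F x"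
  by (metis proj_on_scaleC scaleC_of_real)

lemma proj_on_diff: "proj_on F (x - y) = proj_on F x - proj_on F y"
  using proj_on_add[of F x "- y"] proj_on_scaleR[of F "-1" y] by simp

lemma cinner_proj_on:
  assumes "orthonormal B" "F \<subseteq> B" "finite F" "b \<in> B"
  shows "cinner b (proj_on F x) = (if b \<in> F then cinner b x else 0)"
proof -
  have "cinner b (proj_on F x) = (\<Sum>c\<in>F. cinner c x * cinner b c)"
    by (simp add: proj_on_def cinner_sum_right cinner_scaleC_right)
  also have "\<dots> = (\<Sum>c\<in>F. if c = b then cinner c x else 0)"
    using assms by (intro sum.cong) (auto simp: orthonormal_def)
  also have "\<dots> = (if b \<in> F then cinner b x else 0)"
    using assms(3) by simp
  finally show ?thesis .
qed

lemma proj_on_fixed_mono: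
  assumes "orthonormal B" "F \<subseteq> G" "G \<subseteq> B" "finite G" "proj_on F x = x"
  shows "proj_on G x = x"
proof -
  have "finite F" using assms finite_subset by blast
  have "proj_on G x = (\<Sum>b\<in>F. cinner b x *\<^sub>C b)"
    unfolding proj_on_def
  proof (rule sum.mono_neutral_right)
    show "\<forall>i\<in>G - F. cinner i x *\<^sub>C i = 0"
    proof
      fix b assume b: "b \<in> G - F"
      have "cinner b x = cinner b (proj_on F x)" using assms(5) by simp
      also have "\<dots> = 0" using b assms \<open>finite F\<close> by (subst cinner_proj_on[of B]) auto
      finally show "cinner b x *\<^sub>C b = 0" by simp
    qed
  qed (use assms in auto)
  then show ?thesis using assms(5) by (simp add: proj_on_def)
qed

text \<open>The vectors fixed by some finite projection form a complex subspace containing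
  \<open>B\<close>, so they exhaust the hull. This replaces a description of the complex span by
  linear combinations.\<close>

lemma csubspace_hull_proj_on:
  assumes "orthonormal B" "x \<in> csubspace hull B"
  shows "\<exists>F. finite F \<and> F \<subseteq> B \<and> proj_on F x = x"
proof -
  let ?V = "{x. \<exists>F. finite F \<and> F \<subseteq> B \<and> proj_on F x = x}"
  have "csubspace ?V" unfolding csubspace_def
  proof (intro conjI subspaceI allI ballI)
    show "0 \<in> ?V" by (auto simp: proj_on_def intro: exI[of _ "{}"])
  next
    fix x y assume "x \<in> ?V" "y \<in> ?V"
    then obtain F G where F: "finite F" "F \<subseteq> B" "proj_on F x = x"
      and G: "finite G" "G \<subseteq> B" "proj_on G y = y" by auto
    have "proj_on (F \<union> G) x = x" "proj_on (F \<union> G) y = y"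
      using F G assms(1) by (auto intro: proj_on_fixed_mono[of B F] proj_on_fixed_mono[of B G])
    then show "x + y \<in> ?V" using F G by (auto simp: proj_on_add intro!: exI[of _ "F \<union> G"])
  next
    fix c x assume "x \<in> ?V"
    then show "c *\<^sub>R x \<in> ?V" by (auto simp: proj_on_scaleR)
  next
    fix a x assume "x \<in> ?V"
    then show "a *\<^sub>C x \<in> ?V" by (auto simp: proj_on_scaleC)
  qed
  moreover have "B \<subseteq> ?V"
    using assms(1) by (auto simp: proj_on_def orthonormal_def intro!: exI[of _ "{_}"])
  ultimately show ?thesis using csubspace_hull_minimal[of B ?V] assms(2) by blast
qed

text \<open>Pythagoras: \<open>x - proj_on F x\<close> is orthogonal to
  \<open>proj_on F x - y\<close>.\<close>

lemma norm_diff_proj_on_le: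
  assumes "orthonormal F" "finite F" "proj_on F y = y"
  shows "norm (x - proj_on F x) \<le> norm (x - y)"
proof -
  have "inner (x - proj_on F x) (proj_on F (x - y)) = Re (\<Sum>b\<in>F. cinner b (x - y) * cinner (x - proj_on F x) b)"
    by (simp add: inner_eq_Re_cinner proj_on_def[of F "x - y"] cinner_sum_right cinner_scaleC_right)
  also have "\<dots> = 0"
  proof -
    have "cinner (x - proj_on F x) b = 0" if "b \<in> F" for b
      using cinner_proj_on[OF assms(1) subset_refl assms(2) that, of x] that
      by (simp add: cinner_commute[of _ b] cinner_diff_right)
    then show ?thesis by simp
  qed
  finally have o: "inner (x - proj_on F x) (proj_on F x - y) = 0" by (simp add: proj_on_diff assms(3))
  define u v where "u = x - proj_on F x" and "v = proj_on F x - y"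
  have "inner u v = 0" "inner v u = 0" using o by (simp_all add: u_def v_def inner_commute)
  then have "(norm (u + v))\<^sup>2 = (norm u)\<^sup>2 + (norm v)\<^sup>2"
    unfolding power2_norm_eq_inner inner_add_left inner_add_right by simp
  then have "(norm u)\<^sup>2 \<le> (norm (x - y))\<^sup>2" by (simp add: u_def v_def)
  then show ?thesis unfolding u_def by (rule power2_le_imp_le) simp
qed

text \<open>Density provides a nearby \<open>y\<close> in the hull, fixed by a finite projection.
  The projection of \<open>x\<close> onto any larger finite subset of \<open>B\<close> is at least
  as close to \<open>x\<close> as \<open>y\<close> is.\<close>

lemma onb_expansion:
  assumes "onb B"
  shows "((\<lambda>b. cinner b x *\<^sub>C b) has_sum x) B"
  unfolding has_sum_def tendsto_iff eventually_finite_subsets_at_top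
proof (intro allI impI)
  fix e :: real assume "0 < e"
  moreover have "x \<in> closure (csubspace hull B)" using assms by (simp add: onb_def)
  ultimately obtain y where y: "y \<in> csubspace hull B" "dist y x < e"
    using closure_approachable by blast
  obtain F where F: "finite F" "F \<subseteq> B" "proj_on F y = y"
    using csubspace_hull_proj_on[OF onb_orthonormal[OF assms] y(1)] by auto
  have "dist (proj_on G x) x < e" if G: "finite G" "F \<subseteq> G" "G \<subseteq> B" for G
  proof -
    have "proj_on G y = y"
      by (rule proj_on_fixed_mono[OF onb_orthonormal[OF assms] G(2,3,1) F(3)])
    moreover have "orthonormal G"
      using G by (intro orthonormal_subset[OF onb_orthonormal[OF assms]])
    ultimately have "norm (x - proj_on G x) \<le> norm (x - y)" using G by (intro norm_diff_proj_on_le)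
    then show ?thesis using y(2) by (simp add: dist_norm norm_minus_commute)
  qed
  then show "\<exists>X. finite X \<and> X \<subseteq> B \<and> (\<forall>Y. finite Y \<and> X \<subseteq> Y \<and> Y \<subseteq> B \<longrightarrow>
      dist (\<Sum>b\<in>Y. cinner b x *\<^sub>C b) x < e)"
    using F by (auto simp: proj_on_def)
qed

lemma onb_parseval:
  assumes "onb B"
  shows "((\<lambda>b. (cmod (cinner b x))\<^sup>2) has_sum (norm x)\<^sup>2) B"
proof -
  have "((\<lambda>b. inner x (cinner b x *\<^sub>C b)) has_sum inner x x) B"
    by (intro has_sum_bounded_linear[OF bounded_linear_inner_right] onb_expansion assms)
  moreover have "inner x (cinner b x *\<^sub>C b) = (cmod (cinner b x))\<^sup>2" for b
    by (simp add: inner_eq_Re_cinner cinner_scaleC_right cinner_commute[of x b]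
        flip: complex_norm_square)
  ultimately show ?thesis by (simp add: power2_norm_eq_inner)
qed

lemma onb_eq_0:
  assumes "onb B" "\<And>b. b \<in> B \<Longrightarrow> cinner b x = 0"
  shows "x = 0"
proof -
  have "((\<lambda>b. cinner b x *\<^sub>C b) has_sum 0) B"
    using assms(2) by (intro has_sum_0) simp
  then show ?thesis using onb_expansion[OF assms(1)] has_sum_unique by blast
qed

lemma onb_eqI:
  assumes "onb B" "\<And>b. b \<in> B \<Longrightarrow> cinner b x = cinner b y"
  shows "x = y"
  using onb_eq_0[OF assms(1), of "x - y"] assms(2) by (simp add: cinner_diff_right)

section \<open>Traces of diagonal operators\<close>

lemma has_sum_swap_nonneg:
  fixes f :: "'a \<Rightarrow> 'b \<Rightarrow> real"
  assumes "\<And>x y. 0 \<le> f x y"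
    and "\<And>x. x \<in> A \<Longrightarrow> (f x has_sum r x) B" and "\<And>y. y \<in> B \<Longrightarrow> ((\<lambda>x. f x y) has_sum s y) A"
    and "(r has_sum S) A"
  shows "(s has_sum S) B"
proof -
  have "(\<lambda>(x, y). f x y) summable_on A \<times> B"
    using assms by (intro summable_on_SigmaI[where g = r]) (auto simp: summable_on_def)
  then have "((\<lambda>(x, y). f x y) has_sum S) (A \<times> B)"
    using assms by (intro has_sum_SigmaI[where g = r]) auto
  then have "((\<lambda>(y, x). f x y) has_sum S) (B \<times> A)"
    by (subst (asm) has_sum_swap) (simp add: case_prod_unfold)
  then show ?thesis by (rule has_sum_SigmaD) (use assms in auto)
qed

lemma diagonal_form_has_sum:
  fixes T :: "'h::complex_hilbert \<Rightarrow> 'h"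
  assumes "bounded_clinear T" "onb C" and T: "\<And>c. c \<in> C \<Longrightarrow> T c = t c *\<^sub>R c"
  shows "((\<lambda>c. t c * (cmod (cinner c b))\<^sup>2) has_sum Re (cinner b (T b))) C"
proof -
  have bl: "bounded_linear (\<lambda>x. Re (cinner b (T x)))"
    using assms(1) unfolding bounded_clinear_def
    by (intro bounded_linear_compose[OF bounded_linear_Re]
        bounded_linear_compose[OF bounded_linear_cinner_right]) auto
  have "((\<lambda>c. Re (cinner b (T (cinner c b *\<^sub>C c)))) has_sum Re (cinner b (T b))) C"
    by (intro has_sum_bounded_linear[OF bl] onb_expansion assms)
  moreover have "Re (cinner b (T (cinner c b *\<^sub>C c))) = t c * (cmod (cinner c b))\<^sup>2" if "c \<in> C" for c
  proof -
    have "cinner b (T (cinner c b *\<^sub>C c)) = t c * (cinner c b * cinner b c)"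
      using assms(1) T[OF that]
      by (simp add: bounded_clinear_def cinner_scaleC_right cinner_scaleR_right)
    also have "cinner c b * cinner b c = of_real ((cmod (cinner c b))\<^sup>2)"
      by (simp add: cinner_commute[of b c] complex_norm_square del: of_real_power)
    finally show ?thesis by (simp flip: of_real_mult of_real_power)
  qed
  ultimately show ?thesis by (simp cong: has_sum_cong)
qed

lemma onb_norm:
  assumes "onb C" "c \<in> C" shows "norm c = 1"
proof -
  have "complex_of_real ((norm c)\<^sup>2) = 1"
    using assms by (simp only: cinner_self[symmetric]) (simp add: onb_def)
  then have "(norm c)\<^sup>2 = 1\<^sup>2" by (simp only: of_real_eq_1_iff) simp
  then show ?thesis by (rule power2_eq_imp_eq) auto
qed

text \<open>Both sides are iterated sums of t_c |<c, b>|^2: summing over c first gives the diagonal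
  entry at \<open>b\<close>, summing over b first gives t_c by Parseval. Hence the trace can be
  computed in the eigenbasis although \<open>op_trace\<close> sums over an arbitrarily chosen
  basis.\<close>

lemma diagonal_trace_has_sum:
  fixes T :: "'h::complex_hilbert \<Rightarrow> 'h"
  assumes "bounded_clinear T" "onb C" "onb B"
    and T: "\<And>c. c \<in> C \<Longrightarrow> T c = t c *\<^sub>R c" and t: "\<And>c. c \<in> C \<Longrightarrow> 0 \<le> t c"
  shows "((\<lambda>b. Re (cinner b (T b))) has_sum S) B \<longleftrightarrow> (t has_sum S) C"
proof -
  \<comment> \<open>The absolute value keeps \<open>f\<close> non-negative for \<open>c\<close>
    outside \<open>C\<close>, where \<open>t\<close> is unconstrained.\<close>
  define f where "f b c = \<bar>t c\<bar> * (cmod (cinner c b))\<^sup>2" for b c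
  have f_nonneg: "0 \<le> f b c" for b c by (simp add: f_def)
  have row: "(f b has_sum Re (cinner b (T b))) C" for b
    using diagonal_form_has_sum[OF assms(1,2) T, of b] t by (simp add: f_def cong: has_sum_cong)
  have col: "((\<lambda>b. f b c) has_sum t c) B" if "c \<in> C" for c
  proof -
    have "((\<lambda>b. \<bar>t c\<bar> * (cmod (cinner b c))\<^sup>2) has_sum \<bar>t c\<bar> * (norm c)\<^sup>2) B"
      by (intro has_sum_cmult_right onb_parseval assms)
    moreover have "norm c = 1" by (rule onb_norm[OF assms(2) that])
    moreover have "cmod (cinner b c) = cmod (cinner c b)" for b
      by (subst cinner_commute) simp
    ultimately show ?thesis using t[OF that] by (simp add: f_def)
  qed
  show ?thesis
  proof
    assume S: "((\<lambda>b. Re (cinner b (T b))) has_sum S) B"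
    show "(t has_sum S) C"
      by (rule has_sum_swap_nonneg[of f B C "\<lambda>b. Re (cinner b (T b))"])
        (rule f_nonneg row S | erule col)+
  next
    assume S: "(t has_sum S) C"
    show "((\<lambda>b. Re (cinner b (T b))) has_sum S) B"
      by (rule has_sum_swap_nonneg[of "\<lambda>c b. f b c" C B t])
        (rule f_nonneg row S | erule col)+
  qed
qed

text \<open>In the divergent case, a finite value of the left side would bound all finite partial
  sums and force summability.\<close>

lemma infsum_ennreal_eq:
  fixes f :: "'a \<Rightarrow> real"
  assumes "\<And>x. x \<in> A \<Longrightarrow> 0 \<le> f x"
  shows "infsum (\<lambda>x. ennreal (f x)) A = (if f summable_on A then ennreal (infsum f A) else \<infinity>)"
proof (cases "f summable_on A")
  case True
  have "infsum (\<lambda>x. ennreal (f x)) A = (SUP F\<in>{F. finite F \<and> F \<subseteq> A}. (\<Sum>x\<in>F. ennreal (f x)))"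
    by (rule nonneg_infsum_complete) simp
  also have "\<dots> = (SUP F\<in>{F. finite F \<and> F \<subseteq> A}. ennreal (sum f F))"
    using assms by (intro SUP_cong) (auto intro!: sum_ennreal)
  also have "\<dots> = ennreal (infsum f A)"
    using infsum_nonneg_is_SUPREMUM_ennreal[OF True assms] by simp
  finally show ?thesis using True by simp
next
  case False
  have "infsum (\<lambda>x. ennreal (f x)) A = \<infinity>"
  proof (rule ccontr)
    assume "infsum (\<lambda>x. ennreal (f x)) A \<noteq> \<infinity>"
    then obtain S where S: "infsum (\<lambda>x. ennreal (f x)) A = ennreal S" "0 \<le> S"
      by (metis ennreal_cases infinity_ennreal_def)
    have "f summable_on A"
    proof (rule nonneg_bdd_above_summable_on)
      show "bdd_above (sum f ` {F. F \<subseteq> A \<and> finite F})"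
      proof (rule bdd_aboveI2)
        fix F assume F: "F \<in> {F. F \<subseteq> A \<and> finite F}"
        have "ennreal (sum f F) = (\<Sum>x\<in>F. ennreal (f x))"
          using assms F by (subst sum_ennreal) auto
        also have "\<dots> \<le> (SUP F\<in>{F. finite F \<and> F \<subseteq> A}. (\<Sum>x\<in>F. ennreal (f x)))"
          using F by (intro SUP_upper) auto
        also have "\<dots> = ennreal S" unfolding S(1)[symmetric]
          by (rule nonneg_infsum_complete[symmetric]) simp
        finally show "sum f F \<le> S" using S(2) by simp
      qed
    qed (use assms in auto)
    then show False using False by simp
  qed
  then show ?thesis using False by simp
qed

lemma op_trace_diagonal:
  fixes T :: "'h::complex_hilbert \<Rightarrow> 'h"
  assumes "bounded_clinear T" "onb C"
    and "\<And>c. c \<in> C \<Longrightarrow> T c = t c *\<^sub>R c" and t: "\<And>c. c \<in> C \<Longrightarrow> 0 \<le> t c"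
  shows "op_trace (graph_on UNIV T) = infsum (\<lambda>c. ennreal (t c)) C"
proof -
  define B where "B = (SOME B :: 'h set. onb B)"
  have B: "onb B" unfolding B_def using assms(2) by (rule someI)
  note iff = diagonal_trace_has_sum[OF assms(1,2) B assms(3) t]
  have "0 \<le> Re (cinner b (T b))" for b
    by (rule has_sum_nonneg[OF diagonal_form_has_sum[OF assms(1-3)]]) (use t in auto)
  moreover have "(THE y. (e, y) \<in> graph_on UNIV T) = T e" for e
    by (auto simp: graph_on_def)
  moreover have "(\<lambda>b. Re (cinner b (T b))) summable_on B \<longleftrightarrow> t summable_on C"
    using iff by (simp add: summable_on_def)
  moreover have "infsum (\<lambda>b. Re (cinner b (T b))) B = infsum t C" if "t summable_on C"
    using iff that by (metis has_sum_infsum infsumI)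
  ultimately show ?thesis
    using assms(1) t unfolding op_trace_def B_def[symmetric]
    by (auto simp: infsum_ennreal_eq)
qed

section \<open>A spanning set for the algebra of quantum Serre relations\<close>

definition q_serre :: "real \<Rightarrow> 'r::{real_algebra, monoid_mult} \<Rightarrow> 'r \<Rightarrow> bool" where
  "q_serre q x y \<longleftrightarrow> x * x * y - (q + 1 / q) *\<^sub>R (x * y * x) + y * x * x = 0"

definition q_comm :: "real \<Rightarrow> 'r::{real_algebra, monoid_mult} \<Rightarrow> 'r \<Rightarrow> 'r" where
  "q_comm q x y = x * y - q *\<^sub>R (y * x)"

lemma commute_q_comm:
  fixes a x y :: "'r::{real_algebra, monoid_mult}"
  assumes "a * x = x * a" "a * y = y * a"
  shows "a * q_comm q x y = q_comm q x y * a"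
proof -
  have "a * (x * y) = x * (y * a)" using assms by (simp flip: mult.assoc) (simp add: mult.assoc)
  moreover have "a * (y * x) = y * (x * a)" using assms by (simp flip: mult.assoc) (simp add: mult.assoc)
  ultimately show ?thesis by (simp add: q_comm_def right_diff_distrib left_diff_distrib mult.assoc)
qed

text \<open>As \<open>x\<close> commutes with \<open>b\<close>, the Serre relation of
  \<open>b\<close> and \<open>y\<close> can be multiplied by \<open>x\<close> from either side and
  keeps its shape. This carries the relation over to longer root vectors.\<close>

lemma q_serre_q_comm:
  fixes b x y :: "'r::{real_algebra, monoid_mult}"
  assumes "q_serre q b y" "b * x = x * b"
  shows "q_serre q b (q_comm q y x)"
proof -
  have lc: "b * (x * t) = x * (b * t)" for t using assms(2) by (metis mult.assoc)
  have 1: "b * b * y = (q + 1 / q) *\<^sub>R (b * y * b) - y * b * b"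
    using assms(1) by (simp add: q_serre_def algebra_simps add_eq_0_iff)
  have "b * b * (y * x) = (b * b * y) * x" by (simp add: mult.assoc)
  also have "\<dots> = (q + 1 / q) *\<^sub>R (b * y * b * x) - y * b * b * x"
    unfolding 1 by (simp add: left_diff_distrib)
  also have "\<dots> = (q + 1 / q) *\<^sub>R (b * (y * x) * b) - y * x * b * b"
    by (simp add: mult.assoc assms(2) lc)
  finally have 2: "b * b * (y * x) = (q + 1 / q) *\<^sub>R (b * (y * x) * b) - y * x * b * b" .
  have "b * b * (x * y) = x * (b * b * y)" by (simp add: mult.assoc lc)
  also have "\<dots> = (q + 1 / q) *\<^sub>R (x * (b * y * b)) - x * y * b * b"
    unfolding 1 by (simp add: right_diff_distrib mult.assoc)
  also have "x * (b * y * b) = b * (x * y) * b" by (simp add: mult.assoc lc)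
  finally have 3: "b * b * (x * y) = (q + 1 / q) *\<^sub>R (b * (x * y) * b) - x * y * b * b" .
  have "b * b * q_comm q y x = b * b * (y * x) - q *\<^sub>R (b * b * (x * y))"
    by (simp add: q_comm_def right_diff_distrib)
  also have "\<dots> = (q + 1 / q) *\<^sub>R (b * q_comm q y x * b) - q_comm q y x * b * b"
    unfolding 2 3 by (simp add: q_comm_def left_diff_distrib right_diff_distrib
        scaleR_right_diff_distrib scaleR_left_distrib mult.assoc algebra_simps)
  finally show ?thesis by (simp add: q_serre_def)
qed

text \<open>The Serre polynomial factors as b [b,x] - (1/q) [b,x] b with [b,x] = bx - q xb, so it
  vanishes exactly when \<open>b\<close> and this q-commutator q-commute.\<close>

lemma q_serre_imp_q_comm:
  assumes "q_serre q b x" "q \<noteq> 0"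
  shows "b * q_comm q b x = (1 / q) *\<^sub>R (q_comm q b x * b)"
proof -
  have 1: "b * b * x = (q + 1 / q) *\<^sub>R (b * x * b) - x * b * b"
    using assms(1) by (simp add: q_serre_def algebra_simps add_eq_0_iff)
  have "b * q_comm q b x = b * b * x - q *\<^sub>R (b * x * b)"
    by (simp add: q_comm_def right_diff_distrib mult.assoc)
  also have "\<dots> = (1 / q) *\<^sub>R (b * x * b) - x * b * b"
    unfolding 1 by (simp add: algebra_simps)
  also have "\<dots> = (1 / q) *\<^sub>R (q_comm q b x * b)"
    using assms(2) by (simp add: q_comm_def left_diff_distrib scaleR_right_diff_distrib)
  finally show ?thesis .
qed

lemma q_serre_imp_q_comm':
  assumes "q_serre q x b" "q \<noteq> 0"
  shows "q_comm q b x * x = (1 / q) *\<^sub>R (x * q_comm q b x)"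
proof -
  have 1: "b * x * x = (q + 1 / q) *\<^sub>R (x * b * x) - x * x * b"
    using assms(1) by (simp add: q_serre_def algebra_simps add_eq_0_iff)
  have "q_comm q b x * x = b * x * x - q *\<^sub>R (x * b * x)"
    by (simp add: q_comm_def left_diff_distrib mult.assoc)
  also have "\<dots> = (1 / q) *\<^sub>R (x * b * x) - x * x * b"
    unfolding 1 by (simp add: algebra_simps)
  also have "\<dots> = (1 / q) *\<^sub>R (x * q_comm q b x)"
    using assms(2) by (simp add: q_comm_def right_diff_distrib scaleR_right_diff_distrib mult.assoc)
  finally show ?thesis .
qed

text \<open>The rank three relation: a simple root vector in the middle of a chain commutes with the
  root vector of the chain. The factor q + 1/q, cancelled at the end, lets the Serre relations be
  applied to the four words in which exactly one letter separates the two letters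
  \<open>b\<close>.\<close>

lemma commute_q_comm_q_comm:
  fixes a b x :: "'r::{real_algebra, monoid_mult}"
  assumes "q_serre q b a" "q_serre q b x" "a * x = x * a" "0 < q"
  shows "b * q_comm q a (q_comm q b x) = q_comm q a (q_comm q b x) * b"
proof -
  define h where "h = q + 1 / q"
  have h: "h \<noteq> 0" "q * h = 1 + q * q"
    using assms(4) by (auto simp: h_def field_simps add_pos_pos less_imp_neq[symmetric])
  have s1: "h *\<^sub>R (b * (a * b)) = b * (b * a) + a * (b * b)"
    and s2: "h *\<^sub>R (b * (x * b)) = b * (b * x) + x * (b * b)"
    using assms(1,2) by (auto simp: q_serre_def h_def algebra_simps add_eq_0_iff)
  have t1: "h *\<^sub>R (b * (a * (b * x))) = b * (b * (a * x)) + a * (b * (b * x))"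
    using arg_cong[OF s1, of "\<lambda>t. t * x"] by (simp add: algebra_simps)
  have t2: "h *\<^sub>R (b * (x * (b * a))) = b * (b * (a * x)) + x * (b * (b * a))"
    using arg_cong[OF s2, of "\<lambda>t. t * a"] assms(3) by (simp add: algebra_simps)
  have t3: "h *\<^sub>R (a * (b * (x * b))) = a * (b * (b * x)) + a * (x * (b * b))"
    using arg_cong[OF s2, of "\<lambda>t. a * t"] by (simp add: algebra_simps)
  have t4: "h *\<^sub>R (x * (b * (a * b))) = x * (b * (b * a)) + a * (x * (b * b))"
    using arg_cong[OF s1, of "\<lambda>t. x * t"] assms(3) by (simp add: algebra_simps flip: mult.assoc)
  have u: "b * (a * (x * b)) = b * (x * (a * b))" "b * (b * (x * a)) = b * (b * (a * x))"
     "x * (a * (b * b)) = a * (x * (b * b))"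
    using assms(3) by (metis mult.assoc)+
  have "h *\<^sub>R (b * q_comm q a (q_comm q b x) - q_comm q a (q_comm q b x) * b)
    = h *\<^sub>R (b * (a * (b * x))) - (q * h) *\<^sub>R (b * (a * (x * b))) - (q * h) *\<^sub>R (b * (b * (x * a)))
      + (q * q) *\<^sub>R (h *\<^sub>R (b * (x * (b * a)))) - h *\<^sub>R (a * (b * (x * b)))
      + (q * h) *\<^sub>R (a * (x * (b * b))) + (q * h) *\<^sub>R (b * (x * (a * b)))
      - (q * q) *\<^sub>R (h *\<^sub>R (x * (b * (a * b))))"
    by (simp add: q_comm_def algebra_simps)
  also have "\<dots> = 0"
    unfolding t1 t2 t3 t4 u h(2) by (simp add: algebra_simps)
  finally show ?thesis using h(1) by simp
qed

text \<open>The outer q-commutator commutes with \<open>y\<close>, and it q-commutes with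
  \<open>x\<close> because the inner one does; hence it q-commutes with the inner one, a combination
  of yx and xy. This is the induction step for neighbouring root vectors.\<close>

lemma q_comm_q_commute:
  fixes b x y :: "'r::{real_algebra, monoid_mult}"
  assumes "q_comm q y x * x = (1 / q) *\<^sub>R (x * q_comm q y x)"
    and "y * q_comm q b (q_comm q y x) = q_comm q b (q_comm q y x) * y"
    and "b * x = x * b"
  shows "q_comm q b (q_comm q y x) * q_comm q y x = (1 / q) *\<^sub>R (q_comm q y x * q_comm q b (q_comm q y x))"
proof -
  define X Z where "X = q_comm q y x" and "Z = q_comm q b X"
  have X: "X * x = (1 / q) *\<^sub>R (x * X)" and y: "y * Z = Z * y"
    using assms(1,2) by (auto simp: X_def Z_def)
  have "Z * x = b * (X * x) - q *\<^sub>R (X * x * b)"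
    unfolding Z_def q_comm_def[of q b] using assms(3) by (simp add: left_diff_distrib mult.assoc)
  also have "\<dots> = (1 / q) *\<^sub>R (x * Z)"
    unfolding X Z_def q_comm_def[of q b X] right_diff_distrib using assms(3)
    by (simp add: scaleR_right_diff_distrib mult.assoc[symmetric])
  finally have Zx: "Z * x = (1 / q) *\<^sub>R (x * Z)" .
  have "Z * X = Z * y * x - q *\<^sub>R (Z * x * y)"
    by (simp add: X_def q_comm_def right_diff_distrib mult.assoc)
  also have "\<dots> = y * (Z * x) - q *\<^sub>R (Z * x * y)" by (simp only: y[symmetric] mult.assoc)
  also have "\<dots> = (1 / q) *\<^sub>R (y * x * Z - q *\<^sub>R (x * (Z * y)))"
    unfolding Zx by (simp add: scaleR_right_diff_distrib mult.assoc)
  also have "\<dots> = (1 / q) *\<^sub>R (X * Z)"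
    unfolding y[symmetric] by (simp add: X_def q_comm_def left_diff_distrib mult.assoc)
  finally show ?thesis by (simp add: X_def Z_def)
qed

text \<open>\<open>root_vec q F r d\<close> is the quantum root vector of the root \<open>\<alpha>\<^sub>r\<^sub>-\<^sub>d + \<dots> + \<alpha>\<^sub>r\<close>.\<close>

primrec root_vec :: "real \<Rightarrow> (nat \<Rightarrow> 'r::{real_algebra, monoid_mult}) \<Rightarrow> nat \<Rightarrow> nat \<Rightarrow> 'r" where
  "root_vec q F r 0 = F r"
| "root_vec q F r (Suc d) = q_comm q (F (r - Suc d)) (root_vec q F r d)"

section \<open>Commutation rules of quantum root vectors\<close>

locale serre_generators =
  fixes q :: real and l :: nat and F :: "nat \<Rightarrow> 'r::{real_algebra, monoid_mult}"
  assumes q: "0 < q"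
    and far: "\<lbrakk>i \<in> {1..l}; j \<in> {1..l}; \<bar>int i - int j\<bar> > 1\<rbrakk> \<Longrightarrow> F i * F j = F j * F i"
    and serre: "\<lbrakk>i \<in> {1..l}; j \<in> {1..l}; \<bar>int i - int j\<bar> = 1\<rbrakk> \<Longrightarrow> q_serre q (F i) (F j)"
begin

lemma root_vec_commute_below:
  assumes "1 \<le> i" "i + 1 < r - d" "r \<le> l"
  shows "F i * root_vec q F r d = root_vec q F r d * F i"
  using assms
proof (induction d)
  case 0
  then show ?case by (auto intro!: far)
next
  case (Suc d)
  have 1: "F i * root_vec q F r d = root_vec q F r d * F i" using Suc by auto
  have 2: "F i * F (r - Suc d) = F (r - Suc d) * F i" using Suc.prems by (intro far) auto
  show ?case using 1 2 by (simp add: commute_q_comm)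
qed

text \<open>Only the outermost factor of the root vector is adjacent to the new generator. The
  generator commutes with the rest, which is the situation of \<open>q_serre_q_comm\<close>.\<close>

lemma root_vec_q_serre:
  assumes "Suc d < r" "r \<le> l"
  shows "q_serre q (F (r - Suc d)) (root_vec q F r d)"
proof (cases d)
  case 0
  then show ?thesis using assms by (auto intro!: serre)
next
  case (Suc e)
  have "F (r - Suc d) * root_vec q F r e = root_vec q F r e * F (r - Suc d)"
    using assms Suc by (intro root_vec_commute_below) auto
  moreover have "q_serre q (F (r - Suc d)) (F (r - d))"
    using assms Suc by (intro serre) auto
  ultimately show ?thesis by (simp add: Suc q_serre_q_comm)
qed

text \<open>These are the simple roots strictly inside the chain. When the chain is extended, the
  only new inner root is its former left end, and that case is the rank three relation.\<close>

lemma root_vec_commute_above: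
  assumes "d < r" "r - d < i" "i < r" "r \<le> l"
  shows "F i * root_vec q F r d = root_vec q F r d * F i"
  using assms
proof (induction d)
  case (Suc d)
  show ?case
  proof (cases "r - d < i")
    case True
    have 1: "F i * root_vec q F r d = root_vec q F r d * F i" using Suc True by auto
    have 2: "F i * F (r - Suc d) = F (r - Suc d) * F i" using Suc.prems True by (intro far) auto
    show ?thesis using 1 2 by (simp add: commute_q_comm)
  next
    case False
    then have i: "i = r - d" using Suc.prems by auto
    then obtain e where d: "d = Suc e" using Suc.prems by (cases d) auto
    show ?thesis unfolding i d root_vec.simps
    proof (rule commute_q_comm_q_comm)
      show "q_serre q (F (r - Suc e)) (F (r - Suc (Suc e)))"
        using Suc.prems d by (intro serre) auto
      show "q_serre q (F (r - Suc e)) (root_vec q F r e)"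
        using Suc.prems d by (intro root_vec_q_serre) auto
      show "F (r - Suc (Suc e)) * root_vec q F r e = root_vec q F r e * F (r - Suc (Suc e))"
        using Suc.prems d by (intro root_vec_commute_below) auto
    qed (rule q)
  qed
qed auto

lemma root_vec_q_commute_adjacent:
  assumes "Suc d < r" "r \<le> l"
  shows "root_vec q F r (Suc d) * root_vec q F r d
    = (1 / q) *\<^sub>R (root_vec q F r d * root_vec q F r (Suc d))"
  using assms
proof (induction d)
  case 0
  then show ?case using q by (auto intro!: q_serre_imp_q_comm' serre)
next
  case (Suc d)
  have "F (r - Suc d) * root_vec q F r (Suc (Suc d)) = root_vec q F r (Suc (Suc d)) * F (r - Suc d)"
    using Suc.prems by (intro root_vec_commute_above) auto
  moreover have "F (r - Suc (Suc d)) * root_vec q F r d = root_vec q F r d * F (r - Suc (Suc d))"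
    using Suc.prems by (intro root_vec_commute_below) auto
  ultimately show ?case
    using Suc by (auto intro!: q_comm_q_commute)
qed

lemma root_vec_q_commute_gen:
  assumes "Suc d < r" "r \<le> l"
  shows "F (r - Suc d) * root_vec q F r (Suc d) = (1 / q) *\<^sub>R (root_vec q F r (Suc d) * F (r - Suc d))"
  using assms q unfolding root_vec.simps by (intro q_serre_imp_q_comm root_vec_q_serre) auto

end

text \<open>An entry \<open>(x, h)\<close> is a factor together with its degree, and the order of
  the list is the order of the factors. The bound \<open>k \<le> p\<close> keeps the set finite also
  for \<open>h = 0\<close> and leaves at most p + 1 exponents per factor.\<close>

fun ordered_monomials :: "('r::{real_algebra, monoid_mult} \<times> nat) list \<Rightarrow> nat \<Rightarrow> 'r set" where
  "ordered_monomials [] p = (if p = 0 then {1} else {})"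
| "ordered_monomials ((x, h) # xs) p =
     (\<Union>k\<in>{k. k \<le> p \<and> k * h \<le> p}. (\<lambda>u. x ^ k * u) ` ordered_monomials xs (p - k * h))"

lemma finite_ordered_monomials: "finite (ordered_monomials xs p)"
  by (induction xs p rule: ordered_monomials.induct) auto

lemma card_ordered_monomials: "card (ordered_monomials xs p) \<le> (p + 1) ^ length xs"
proof (induction xs p rule: ordered_monomials.induct)
  case (2 x h xs p)
  let ?K = "{k. k \<le> p \<and> k * h \<le> p}"
  have "card (ordered_monomials ((x, h) # xs) p)
    \<le> (\<Sum>k\<in>?K. card ((\<lambda>u. x ^ k * u) ` ordered_monomials xs (p - k * h)))"
    by (simp add: card_UN_le)
  also have "\<dots> \<le> (\<Sum>k\<in>?K. (p + 1) ^ length xs)"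
  proof (rule sum_mono)
    fix k assume k: "k \<in> ?K"
    have "card ((\<lambda>u. x ^ k * u) ` ordered_monomials xs (p - k * h)) \<le> card (ordered_monomials xs (p - k * h))"
      by (simp add: card_image_le finite_ordered_monomials)
    also have "\<dots> \<le> (p - k * h + 1) ^ length xs" using 2 k by auto
    also have "\<dots> \<le> (p + 1) ^ length xs" by (intro power_mono) auto
    finally show "card ((\<lambda>u. x ^ k * u) ` ordered_monomials xs (p - k * h)) \<le> (p + 1) ^ length xs" .
  qed
  also have "\<dots> = card ?K * (p + 1) ^ length xs" by simp
  also have "card ?K \<le> card {..p}" by (intro card_mono) auto
  finally show ?case by simp
qed auto

lemma ordered_monomials_0: "1 \<in> ordered_monomials xs 0"
  by (induction xs) force+

lemma mult_span_subset:
  fixes x :: "'r::{real_algebra, monoid_mult}"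
  assumes "\<And>u. u \<in> A \<Longrightarrow> x * u \<in> span B" "u \<in> span A"
  shows "x * u \<in> span B"
  using assms(2)
proof (induction rule: span_induct_alt)
  case base
  then show ?case by (simp add: span_zero)
next
  case (step c u v)
  then show ?case by (simp add: distrib_left span_add span_scale assms(1))
qed

lemma power_mult_ordered_monomials:
  assumes "u \<in> ordered_monomials xs p'" "p = p' + k * h" "1 \<le> h"
  shows "x ^ k * u \<in> ordered_monomials ((x, h) # xs) p"
proof -
  have "k \<le> k * h" using assms(3) by simp
  then have "k \<le> p" "k * h \<le> p" "p - k * h = p'" using assms by linarith+
  then show ?thesis using assms(1) by force
qed

lemma power_mult_span_ordered_monomials:
  assumes "u \<in> span (ordered_monomials xs p')" "p = p' + k * h" "1 \<le> h"
  shows "x ^ k * u \<in> span (ordered_monomials ((x, h) # xs) p)"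
  using assms(1) by (rule mult_span_subset[rotated])
    (use assms in \<open>auto intro!: span_base power_mult_ordered_monomials simp del: ordered_monomials.simps\<close>)

lemma q_commute_power:
  fixes x y :: "'r::{real_algebra, monoid_mult}"
  assumes "y * x = t *\<^sub>R (x * y)"
  shows "y * x ^ k = t ^ k *\<^sub>R (x ^ k * y)"
proof (induction k)
  case (Suc k)
  have "y * x ^ Suc k = t *\<^sub>R (x * (y * x ^ k))" by (simp add: assms flip: mult.assoc)
  then show ?case by (simp add: Suc mult.assoc)
qed auto

text \<open>Because \<open>z\<close> q-commutes with \<open>x\<close>, the corrections from all k
  positions merge into one multiple of \<open>x ^ (k - 1) * z\<close>. Later only membership in a
  span is at stake, so the coefficient stays existential.\<close>

lemma q_commute_power_shift:
  fixes x y z :: "'r::{real_algebra, monoid_mult}"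
  assumes "y * x = t *\<^sub>R (x * y) + z" "z * x = s *\<^sub>R (x * z)"
  shows "\<exists>c. y * x ^ k = t ^ k *\<^sub>R (x ^ k * y) + c *\<^sub>R (x ^ (k - 1) * z)"
proof (induction k)
  case 0
  show ?case by (rule exI[of _ 0]) simp
next
  case (Suc k)
  then obtain c where c: "y * x ^ k = t ^ k *\<^sub>R (x ^ k * y) + c *\<^sub>R (x ^ (k - 1) * z)" by auto
  have *: "x * (c *\<^sub>R (x ^ (k - 1) * z)) = (if k = 0 then c *\<^sub>R (x * z) else c *\<^sub>R (x ^ k * z))"
    by (cases k) (auto simp: mult.assoc)
  \<comment> \<open>For k = 0 the exponent \<open>k - 1\<close> truncates to 0, and the induction
    hypothesis yields only that c z vanishes, not that c does.\<close>
  have c0: "k = 0 \<Longrightarrow> c *\<^sub>R z = 0" using c by simp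
  have "y * x ^ Suc k = t *\<^sub>R (x * (y * x ^ k)) + z * x ^ k"
    by (simp add: assms(1) distrib_right mult.assoc flip: mult.assoc)
  also have "\<dots> = t ^ Suc k *\<^sub>R (x ^ Suc k * y) + (t * (if k = 0 then 0 else c) + s ^ k) *\<^sub>R (x ^ k * z)"
    unfolding c q_commute_power[OF assms(2)] distrib_left scaleR_add_right *
    using c0 by (cases "k = 0") (auto simp: mult.assoc scaleR_left_distrib algebra_simps)
  finally show ?case by auto
qed

context serre_generators
begin

text \<open>The root vectors ending at \<open>r\<close> come before those ending at \<open>r - 1\<close>; among the former, shorter
  roots come first. \<open>root_block r j\<close> keeps only the roots that start at one of \<open>1, \<dots>, j\<close>.\<close>

primrec root_block :: "('r \<times> nat) list \<Rightarrow> nat \<Rightarrow> nat \<Rightarrow> ('r \<times> nat) list" where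
  "root_block L r 0 = L"
| "root_block L r (Suc j) = (root_vec q F r (r - Suc j), r - j) # root_block L r j"

primrec pbw_list :: "nat \<Rightarrow> ('r \<times> nat) list" where
  "pbw_list 0 = []"
| "pbw_list (Suc r) = root_block (pbw_list r) (Suc r) (Suc r)"

text \<open>Straightening. The head of the block is the root vector of the chain from
  \<open>Suc j\<close> to \<open>r\<close>. \<open>F i\<close> commutes with it unless i is the left
  end of the chain or lies just before it. At the left end it q-commutes. Just before it one extra
  term arises, the root vector of the chain from i to r, which is the next entry of the list: this
  is what the order of the list is made for.\<close>

lemma gen_mult_root_block:
  assumes "r \<le> l" "i < r" "1 \<le> i" "j \<le> r"
    and base: "\<And>u p. u \<in> ordered_monomials L p \<Longrightarrow> F i * u \<in> span (ordered_monomials L (Suc p))"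
    and u: "u \<in> ordered_monomials (root_block L r j) p"
  shows "F i * u \<in> span (ordered_monomials (root_block L r j) (Suc p))"
  using \<open>j \<le> r\<close> u
proof (induction j arbitrary: u p)
  case 0
  then show ?case using base by simp
next
  case (Suc j)
  define x where "x = root_vec q F r (r - Suc j)"
  define h where "h = r - j"
  have h: "1 \<le> h" using Suc.prems by (simp add: h_def)
  have blk: "root_block L r (Suc j) = (x, h) # root_block L r j" by (simp add: x_def h_def)
  obtain k w where k: "k * h \<le> p" and u: "u = x ^ k * w"
    and w: "w \<in> ordered_monomials (root_block L r j) (p - k * h)"
    using Suc.prems(2) unfolding blk by auto
  have Fw: "F i * w \<in> span (ordered_monomials (root_block L r j) (Suc (p - k * h)))"
    using Suc w by simp
  have main: "t *\<^sub>R (x ^ k * (F i * w)) \<in> span (ordered_monomials (root_block L r (Suc j)) (Suc p))" for t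
    unfolding blk using k h by (intro span_scale power_mult_span_ordered_monomials[OF Fw]) auto
  consider "Suc j < i \<or> i + 1 < Suc j" | "Suc j = i" | "Suc j = i + 1" by linarith
  then show ?case
  proof cases
    case 1
    have "F i * x = x * F i"
    proof (cases "i + 1 < Suc j")
      case True
      then show ?thesis unfolding x_def
        using assms Suc.prems by (intro root_vec_commute_below) auto
    next
      case False
      then show ?thesis unfolding x_def
        using assms Suc.prems 1 by (intro root_vec_commute_above) auto
    qed
    then have "F i * u = 1 *\<^sub>R (x ^ k * (F i * w))"
      using q_commute_power[of "F i" x 1 k] by (simp add: u flip: mult.assoc)
    then show ?thesis using main[of 1] by simp
  next
    case 2
    define d where "d = r - Suc i"
    have d: "r - Suc j = Suc d" "r - Suc d = i" using assms 2 by (auto simp: d_def)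
    have "F i * x = (1 / q) *\<^sub>R (x * F i)"
      using root_vec_q_commute_gen[of d r] assms d unfolding x_def by (auto simp: d_def)
    then have "F i * u = (1 / q) ^ k *\<^sub>R (x ^ k * (F i * w))"
      using q_commute_power[of "F i" x "1 / q" k] by (simp add: u flip: mult.assoc)
    then show ?thesis using main by simp
  next
    case 3
    define d where "d = r - Suc i"
    have d: "r - Suc j = d" "r - j = Suc d" "r - Suc d = i" "j = i" using assms 3 by (auto simp: d_def)
    define z where "z = root_vec q F r (Suc d)"
    have "F i * x = q *\<^sub>R (x * F i) + z"
      unfolding z_def x_def d(1) root_vec.simps(2) d(3) by (simp add: q_comm_def)
    moreover have "z * x = (1 / q) *\<^sub>R (x * z)"
      unfolding z_def x_def d(1) using assms by (intro root_vec_q_commute_adjacent) (auto simp: d_def)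
    ultimately obtain c where c: "F i * x ^ k = q ^ k *\<^sub>R (x ^ k * F i) + c *\<^sub>R (x ^ (k - 1) * z)"
      using q_commute_power_shift by blast
    \<comment> \<open>The extra root vector is absorbed by the power of \<open>z\<close> that heads
      \<open>w\<close>; its degree exceeds that of \<open>x\<close> by one.\<close>
    have zw: "z * w \<in> ordered_monomials (root_block L r j) (p - k * h + (h + 1))"
    proof -
      obtain j' where j': "j = Suc j'" using d assms by (cases j) auto
      have b: "root_block L r j = (z, Suc h) # root_block L r j'"
      proof -
        have "r - Suc j' = Suc d" "r - j' = Suc (r - Suc j')" using d assms j' by auto
        then show ?thesis by (simp add: j' z_def h_def del: root_vec.simps)
      qed
      obtain k' w' where k': "k' * Suc h \<le> p - k * h" and w': "w = z ^ k' * w'"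
          "w' \<in> ordered_monomials (root_block L r j') (p - k * h - k' * Suc h)"
        using w unfolding b by auto
      have "z ^ Suc k' * w' \<in> ordered_monomials ((z, Suc h) # root_block L r j') (p - k * h + (h + 1))"
        using k' by (intro power_mult_ordered_monomials[OF w'(2)]) auto
      then show ?thesis unfolding b w'(1) by (simp add: mult.assoc del: ordered_monomials.simps)
    qed
    have "c *\<^sub>R (x ^ (k - 1) * (z * w)) \<in> span (ordered_monomials (root_block L r (Suc j)) (Suc p))"
    proof (cases "k = 0")
      case True
      then have "c = 0 \<or> z = 0" using c by simp
      then show ?thesis by (auto simp: span_zero simp del: ordered_monomials.simps)
    next
      case False
      then obtain k' where k': "k = Suc k'" by (cases k) auto
      show ?thesis unfolding blk
        using k by (intro span_scale power_mult_span_ordered_monomials[OF span_base[OF zw]] h)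
          (auto simp: k')
    qed
    moreover have "F i * u = q ^ k *\<^sub>R (x ^ k * (F i * w)) + c *\<^sub>R (x ^ (k - 1) * (z * w))"
      unfolding u using arg_cong[OF c, of "\<lambda>t. t * w"] by (simp add: distrib_right mult.assoc)
    ultimately show ?thesis using main by (simp add: span_add)
  qed
qed

text \<open>For i < r the generator passes through the block of roots ending at r and continues in
  the shorter list by induction. For i = r it is itself the first entry and raises an
  exponent.\<close>

lemma gen_mult_pbw:
  assumes "r \<le> l" "1 \<le> i" "i \<le> r" "u \<in> ordered_monomials (pbw_list r) p"
  shows "F i * u \<in> span (ordered_monomials (pbw_list r) (Suc p))"
  using assms
proof (induction r arbitrary: i u p)
  case (Suc r)
  show ?case
  proof (cases "i < Suc r")
    case True
    then show ?thesis unfolding pbw_list.simps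
      using Suc by (intro gen_mult_root_block) auto
  next
    case False
    then have i: "i = Suc r" using Suc.prems by simp
    let ?B = "root_block (pbw_list r) (Suc r) r"
    have b: "pbw_list (Suc r) = (F i, 1) # ?B" by (simp add: i)
    obtain k w where "k \<le> p" "u = F i ^ k * w" "w \<in> ordered_monomials ?B (p - k)"
      using Suc.prems(4) unfolding b by auto
    then show ?thesis unfolding b
      using power_mult_ordered_monomials[of w ?B "p - k" "Suc p" "Suc k" 1 "F i"]
      by (auto intro!: span_base simp: mult.assoc simp del: ordered_monomials.simps)
  qed
qed auto

lemma word_in_span_pbw:
  assumes "set w \<subseteq> {1..l}"
  shows "prod_list (map F w) \<in> span (ordered_monomials (pbw_list l) (length w))"
  using assms
proof (induction w)
  case Nil
  then show ?case using ordered_monomials_0 by (auto intro: span_base)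
next
  case (Cons i w)
  have "F i * prod_list (map F w) \<in> span (ordered_monomials (pbw_list l) (Suc (length w)))"
    by (rule mult_span_subset[rotated]) (use Cons in \<open>auto intro: gen_mult_pbw\<close>)
  then show ?case by simp
qed

end

section \<open>Families of vectors with generically constant rank\<close>

text \<open>A Laurent polynomial in q^m, with the denominator multiplied out so that
  \<open>p\<close> is an ordinary polynomial with finitely many roots unless it is zero.\<close>

definition laurent_fun :: "real \<Rightarrow> (nat \<Rightarrow> real) \<Rightarrow> bool" where
  "laurent_fun q f \<longleftrightarrow> (\<exists>p k. \<forall>m. f m * (q ^ m) ^ k = poly p (q ^ m))"

lemma laurent_fun_const: "laurent_fun q (\<lambda>_. c)"
  unfolding laurent_fun_def by (intro exI[of _ "[:c:]"] exI[of _ 0]) simp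

lemma laurent_fun_mult:
  assumes "laurent_fun q f" "laurent_fun q g"
  shows "laurent_fun q (\<lambda>m. f m * g m)"
proof -
  obtain p k p' k' where p: "\<And>m. f m * (q ^ m) ^ k = poly p (q ^ m)"
    and p': "\<And>m. g m * (q ^ m) ^ k' = poly p' (q ^ m)"
    using assms unfolding laurent_fun_def by blast
  have "f m * g m * (q ^ m) ^ (k + k') = poly (p * p') (q ^ m)" for m
    by (simp add: p[symmetric] p'[symmetric] power_add)
  then show ?thesis unfolding laurent_fun_def by blast
qed

lemma laurent_fun_add:
  assumes "laurent_fun q f" "laurent_fun q g"
  shows "laurent_fun q (\<lambda>m. f m + g m)"
proof -
  obtain p k p' k' where p: "\<And>m. f m * (q ^ m) ^ k = poly p (q ^ m)"
    and p': "\<And>m. g m * (q ^ m) ^ k' = poly p' (q ^ m)"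
    using assms unfolding laurent_fun_def by blast
  have "(f m + g m) * (q ^ m) ^ (k + k') = poly (p * monom 1 k' + p' * monom 1 k) (q ^ m)" for m
    by (simp add: p[symmetric] p'[symmetric] power_add poly_monom algebra_simps)
  then show ?thesis unfolding laurent_fun_def by blast
qed

lemma laurent_fun_cmult: "laurent_fun q f \<Longrightarrow> laurent_fun q (\<lambda>m. c * f m)"
  by (intro laurent_fun_mult laurent_fun_const)

lemma laurent_fun_diff:
  assumes "laurent_fun q f" "laurent_fun q g"
  shows "laurent_fun q (\<lambda>m. f m - g m)"
  using laurent_fun_add[OF assms(1) laurent_fun_cmult[OF assms(2), of "-1"]] by simp

lemma laurent_fun_powr:
  assumes "0 < q"
  shows "laurent_fun q (\<lambda>m. q powr (c + real_of_int k * real m))"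
proof (cases "0 \<le> k")
  case True
  then have "q powr (c + real_of_int k * real m) = poly (monom (q powr c) (nat k)) (q ^ m)" for m
    using assms by (simp add: powr_add poly_monom powr_powr mult.commute flip: powr_realpow)
  then show ?thesis unfolding laurent_fun_def
    by (intro exI[of _ "monom (q powr c) (nat k)"] exI[of _ 0]) simp
next
  case False
  have "q powr (c + real_of_int k * real m) * (q ^ m) ^ nat (- k) = poly [:q powr c:] (q ^ m)" for m
  proof -
    have "(q ^ m) ^ nat (- k) = q powr (- real_of_int k * real m)"
      using False assms by (simp add: powr_powr mult.commute flip: powr_realpow)
    then show ?thesis by (simp flip: powr_add)
  qed
  then show ?thesis unfolding laurent_fun_def by blast
qed

text \<open>A non-zero polynomial has finitely many roots, and the points q^m are distinct.\<close>

lemma laurent_fun_eventually: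
  assumes "0 < q" "q < 1" "laurent_fun q f"
  shows "(\<forall>\<^sub>F m in sequentially. f m = 0) \<or> (\<forall>\<^sub>F m in sequentially. f m \<noteq> 0)"
proof -
  obtain p k where p: "\<And>m. f m * (q ^ m) ^ k = poly p (q ^ m)"
    using assms(3) unfolding laurent_fun_def by blast
  have nz: "(q ^ m) ^ k \<noteq> 0" for m using assms by simp
  show ?thesis
  proof (cases "p = 0")
    case True
    then have "f m = 0" for m using p[of m] nz[of m] assms(1) by simp
    then show ?thesis by simp
  next
    case False
    then have "finite {x. poly p x = 0}" by (rule poly_roots_finite)
    moreover have "inj (\<lambda>m::nat. q ^ m)"
      using assms by (intro injI) (metis power_inject_exp' less_irrefl less_imp_neq linorder_neqE_nat power_strict_decreasing_iff)
    ultimately have "finite ((\<lambda>m::nat. q ^ m) -` {x. poly p x = 0})" by (rule finite_vimageI)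
    then have "\<forall>\<^sub>F m in sequentially. m \<notin> (\<lambda>m::nat. q ^ m) -` {x. poly p x = 0}"
      unfolding cofinite_eq_sequentially[symmetric] eventually_cofinite by simp
    then have "\<forall>\<^sub>F m in sequentially. f m \<noteq> 0"
    proof eventually_elim
      case (elim m)
      then show ?case using p[of m] by auto
    qed
    then show ?thesis ..
  qed
qed

lemma dim_insert_orthogonal:
  fixes x :: "'a::real_inner"
  assumes "x \<noteq> 0" "finite S" "\<And>y. y \<in> S \<Longrightarrow> inner x y = 0"
  shows "dim (insert x S) = Suc (dim S)"
proof -
  obtain B where B: "B \<subseteq> S" "independent B" "S \<subseteq> span B" "card B = dim S"
    using basis_exists[of S] by metis
  have fB: "finite B" using B assms finite_subset by blast
  have "inner x y = 0" if "y \<in> span B" for y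
    using that by (induction rule: span_induct_alt) (use B assms in \<open>auto simp: inner_add_right\<close>)
  then have x: "x \<notin> span B" using assms(1) by force
  then have xB: "x \<notin> B" using span_base by blast
  have "span (insert x S) = span (insert x B)"
  proof
    show "span (insert x S) \<subseteq> span (insert x B)"
      using B(3) span_mono[of B "insert x B"] by (intro span_minimal) (auto intro: span_base)
    show "span (insert x B) \<subseteq> span (insert x S)" using B(1) by (intro span_mono) auto
  qed
  then have "dim (insert x S) = dim (insert x B)" by (rule span_eq_dim)
  also have "\<dots> = card (insert x B)"
    using B(2) x by (intro dim_eq_card_independent independent_insertI)
  finally show ?thesis using B(4) fB xB by simp
qed

text \<open>Gram--Schmidt without division keeps all inner products Laurent functions of \<open>q\<^sup>m\<close>, so that each
  vector it produces eventually vanishes or eventually does not.\<close>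

lemma dim_eventually_constant:
  fixes xs :: "(nat \<Rightarrow> 'a::real_inner) list"
  assumes "0 < q" "q < 1"
    and "\<And>x y. \<lbrakk>x \<in> set xs; y \<in> set xs\<rbrakk> \<Longrightarrow> laurent_fun q (\<lambda>m. inner (x m) (y m))"
  shows "\<exists>d. \<forall>\<^sub>F m in sequentially. dim ((\<lambda>x. x m) ` set xs) = d"
  using assms(3)
proof (induction "length xs" arbitrary: xs)
  case 0
  have "dim ({} :: 'a set) = card ({} :: 'a set)"
    by (rule dim_eq_card_independent) (rule independent_empty)
  then show ?case using 0 by auto
next
  case (Suc n)
  then obtain x ys where xs: "xs = x # ys" and n: "n = length ys" by (cases xs) auto
  have L: "laurent_fun q (\<lambda>m. inner (y m) (z m))" if "y = x \<or> y \<in> set ys" "z = x \<or> z \<in> set ys" for y z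
    using Suc.prems xs that by auto
  from laurent_fun_eventually[OF assms(1,2) L[of x x]]
  consider "\<forall>\<^sub>F m in sequentially. inner (x m) (x m) = 0" | "\<forall>\<^sub>F m in sequentially. inner (x m) (x m) \<noteq> 0"
    by auto
  then show ?case
  proof cases
    case 1
    obtain d where "\<forall>\<^sub>F m in sequentially. dim ((\<lambda>x. x m) ` set ys) = d"
      using Suc.hyps(1)[OF n] L by auto
    then have "\<forall>\<^sub>F m in sequentially. dim ((\<lambda>x. x m) ` set xs) = d"
      using 1
    proof eventually_elim
      case (elim m)
      have "span ((\<lambda>x. x m) ` set xs) = span ((\<lambda>x. x m) ` set ys)"
        using elim by (simp add: xs span_insert_0)
      then show ?case using elim span_eq_dim by metis
    qed
    then show ?thesis ..
  next
    case 2
    define t where "t y m = inner (x m) (x m) *\<^sub>R y m - inner (x m) (y m) *\<^sub>R x m" for y m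
    have "\<exists>d. \<forall>\<^sub>F m in sequentially. dim ((\<lambda>x. x m) ` set (map t ys)) = d"
    proof (rule Suc.hyps(1))
      fix y' z' assume "y' \<in> set (map t ys)" "z' \<in> set (map t ys)"
      then obtain y z where y: "y \<in> set ys" "y' = t y" and z: "z \<in> set ys" "z' = t z" by auto
      have "laurent_fun q (\<lambda>m. inner (x m) (x m) * (inner (x m) (x m) * inner (y m) (z m)
          - inner (x m) (y m) * inner (x m) (z m)))"
        using y z by (intro laurent_fun_mult laurent_fun_diff L) auto
      moreover have "inner (y' m) (z' m) = inner (x m) (x m) * (inner (x m) (x m) * inner (y m) (z m)
          - inner (x m) (y m) * inner (x m) (z m))" for m
        by (simp add: y z t_def inner_diff_left inner_diff_right algebra_simps inner_commute)
      ultimately show "laurent_fun q (\<lambda>m. inner (y' m) (z' m))" by simp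
    qed (simp add: n)
    then obtain d where "\<forall>\<^sub>F m in sequentially. dim ((\<lambda>x. x m) ` set (map t ys)) = d" ..
    then have "\<forall>\<^sub>F m in sequentially. dim ((\<lambda>x. x m) ` set xs) = Suc d"
      using 2
    proof eventually_elim
      case (elim m)
      let ?c = "inner (x m) (x m)" and ?S = "(\<lambda>y. t y m) ` set ys"
      have S: "(\<lambda>x. x m) ` set (map t ys) = ?S" by auto
      have "y m \<in> span (insert (x m) ?S)" if "y \<in> set ys" for y
      proof -
        have "y m = (1 / ?c) *\<^sub>R t y m + (inner (x m) (y m) / ?c) *\<^sub>R x m"
          using elim(2) by (simp add: t_def scaleR_right_diff_distrib)
        moreover have "(1 / ?c) *\<^sub>R t y m + (inner (x m) (y m) / ?c) *\<^sub>R x m \<in> span (insert (x m) ?S)"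
          using that by (intro span_add span_scale span_base) auto
        ultimately show ?thesis by simp
      qed
      moreover have "t y m \<in> span (insert (x m) ((\<lambda>x. x m) ` set ys))" if "y \<in> set ys" for y
        unfolding t_def using that by (intro span_diff span_scale span_base) auto
      ultimately have "span ((\<lambda>x. x m) ` set xs) = span (insert (x m) ?S)"
        unfolding span_eq by (auto simp: xs span_base)
      then have "dim ((\<lambda>x. x m) ` set xs) = dim (insert (x m) ?S)" by (rule span_eq_dim)
      also have "\<dots> = Suc (dim ?S)"
        using elim(2) by (intro dim_insert_orthogonal) (auto simp: t_def inner_diff_right)
      finally show ?case using elim(1) S by simp
    qed
    then show ?thesis ..
  qed
qed

section \<open>Highest weight modules\<close>

text \<open>This is no \<^class>\<open>real_algebra_1\<close>, since \<open>0 = 1\<close> when the space is trivial.\<close>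

typedef (overloaded) 'a lin_end = "{f :: 'a::real_vector \<Rightarrow> 'a. linear f}"
  morphisms end_app Lin_End
  using linear_id by auto

setup_lifting type_definition_lin_end

instantiation lin_end :: (real_vector) "{real_algebra, monoid_mult}"
begin

lift_definition zero_lin_end :: "'a lin_end" is "\<lambda>_. 0" by (simp add: linear_zero)
lift_definition one_lin_end :: "'a lin_end" is "\<lambda>x. x" by (simp add: linear_ident)
lift_definition plus_lin_end :: "'a lin_end \<Rightarrow> 'a lin_end \<Rightarrow> 'a lin_end" is "\<lambda>f g x. f x + g x"
  by (simp add: linear_compose_add)
lift_definition minus_lin_end :: "'a lin_end \<Rightarrow> 'a lin_end \<Rightarrow> 'a lin_end" is "\<lambda>f g x. f x - g x"
  by (simp add: linear_compose_sub)
lift_definition uminus_lin_end :: "'a lin_end \<Rightarrow> 'a lin_end" is "\<lambda>f x. - f x"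
  by (simp add: linear_compose_neg)
lift_definition times_lin_end :: "'a lin_end \<Rightarrow> 'a lin_end \<Rightarrow> 'a lin_end" is "\<lambda>f g x. f (g x)"
  using linear_compose unfolding o_def by blast
lift_definition scaleR_lin_end :: "real \<Rightarrow> 'a lin_end \<Rightarrow> 'a lin_end" is "\<lambda>r f x. r *\<^sub>R f x"
  by (simp add: linear_compose_scale_right)

instance
  by standard (transfer; auto simp: algebra_simps linear_add linear_diff linear_scale linear_cmul)+

end

section \<open>Quantum integers and quantum sl(2)\<close>

definition qint :: "real \<Rightarrow> real \<Rightarrow> real" where
  "qint q h = (q powr h - q powr (- h)) / (q - 1 / q)"

lemma qint_pos:
  assumes "0 < q" "q < 1" "0 < h"
  shows "0 < qint q h"
proof -
  have "q powr h < 1" using powr_less_mono'[of q 0 h] assms by simp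
  moreover have "1 < q powr (- h)" using powr_less_mono'[of q "- h" 0] assms by simp
  moreover have "q < 1 / q" using assms by (simp add: field_simps power2_eq_square[symmetric] power_less_one_iff)
  ultimately show ?thesis unfolding qint_def by (intro divide_neg_neg) auto
qed

lemma qint_minus: "qint q (- h) = - qint q h"
  by (simp add: qint_def minus_divide_left)

lemma qint_0: "qint q 0 = 0"
  by (simp add: qint_def)

text \<open>The partial sums of \<open>[k - 2], [k - 4], \<dots>, [2 - k]\<close> are non-negative: the entry \<open>[k - 2 i]\<close>
  cancels \<open>[2 i - k]\<close>.\<close>

lemma qint_partial_sum_nonneg:
  assumes "0 < q" "q < 1" "j < k"
  shows "0 \<le> (\<Sum>i=1..j. qint q (real k - 2 * real i))"
proof (cases "2 * j \<le> k")
  case True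
  have "0 \<le> qint q (real k - 2 * real i)" if "i \<in> {1..j}" for i
  proof (cases "2 * i = k")
    case False
    then have "0 < real k - 2 * real i" using that True by auto
    then show ?thesis using qint_pos assms by (simp add: less_imp_le)
  qed (auto simp: qint_0)
  then show ?thesis by (rule sum_nonneg)
next
  case False
  let ?g = "\<lambda>i. qint q (real k - 2 * real i)"
  have "(\<Sum>i=k-j..j. ?g i) = (\<Sum>i=k-j..j. ?g (k - i))"
    using assms False by (intro sum.reindex_bij_witness[of _ "\<lambda>i. k - i" "\<lambda>i. k - i"]) auto
  also have "\<dots> = (\<Sum>i=k-j..j. - ?g i)"
  proof (rule sum.cong)
    fix i assume "i \<in> {k - j..j}"
    then have "real k - 2 * real (k - i) = - (real k - 2 * real i)" using assms by (auto simp: of_nat_diff)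
    then show "?g (k - i) = - ?g i" by (simp only: qint_minus)
  qed simp
  finally have z: "(\<Sum>i=k-j..j. ?g i) = 0" by (simp add: sum_negf)
  \<comment> \<open>Only the indices below k - j survive the cancellation, and there k - 2i is
    positive because 2j > k.\<close>
  have "{1..j} = {1..k-j-1} \<union> {k-j..j}" using assms False by auto
  then have "(\<Sum>i=1..j. ?g i) = (\<Sum>i=1..k-j-1. ?g i) + (\<Sum>i=k-j..j. ?g i)"
    by (simp add: sum.union_disjoint)
  moreover have "0 \<le> (\<Sum>i=1..k-j-1. ?g i)"
  proof (rule sum_nonneg)
    fix i assume "i \<in> {1..k-j-1}"
    then have "0 < real k - 2 * real i" using False by auto
    then show "0 \<le> ?g i" using qint_pos assms by (simp add: less_imp_le)
  qed
  ultimately show ?thesis using z by simp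
qed

text \<open>On the weight space of weight \<open>- k\<close> the operator \<open>F\<^sup>k E\<^sup>k\<close> is a product of factors \<open>F E + S\<close> with
  \<open>S \<ge> 0\<close>, each of which is positive definite.\<close>

lemma sl2_raising_injective:
  fixes E F :: "'a::real_inner \<Rightarrow> 'a" and W :: "real \<Rightarrow> 'a set"
  assumes q: "0 < q" "q < 1"
    and lin: "linear E" "linear F"
    and sub: "\<And>h. subspace (W h)"
    and E: "\<And>h x. x \<in> W h \<Longrightarrow> E x \<in> W (h + 2)" and F: "\<And>h x. x \<in> W h \<Longrightarrow> F x \<in> W (h - 2)"
    and EF: "\<And>h x. x \<in> W h \<Longrightarrow> E (F x) - F (E x) = qint q h *\<^sub>R x"
    and adj: "\<And>h h' x y. \<lbrakk>x \<in> W h; y \<in> W h'\<rbrakk> \<Longrightarrow> inner (E x) y = inner x (F y)"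
    and k: "0 < k" and x: "x \<in> W (- real k)" and j: "j \<le> k" and 0: "(E ^^ j) x = 0"
  shows "x = 0"
proof -
  define A where "A x = F (E x)" for x
  define S where "S j = (\<Sum>i=1..j. qint q (real k - 2 * real i))" for j
  have Ej: "(E ^^ j) x \<in> W (2 * real j - real k)" if "x \<in> W (- real k)" for x j
    using that by (induction j) (use E in \<open>fastforce simp: algebra_simps\<close>)+
  have linA: "linear A" unfolding A_def using lin linear_compose unfolding o_def by blast
  have linEj: "linear (E ^^ j)" for j
  proof (induction j)
    case (Suc j)
    then show ?case using linear_compose[OF Suc lin(1)] by (simp add: o_def)
  qed (simp add: linear_ident id_def)
  have AW: "A x \<in> W (- real k)" if "x \<in> W (- real k)" for x
    using F[OF E[OF that]] by (simp add: A_def)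
  \<comment> \<open>Each exchange of \<open>F E\<close> with a further \<open>E\<close> contributes
    the quantum integer of the weight reached, and these contributions add up to
    \<open>S j\<close>.\<close>
  have shift: "A ((E ^^ j) x) = (E ^^ j) (A x) + S j *\<^sub>R (E ^^ j) x" if "x \<in> W (- real k)" for x j
  proof (induction j)
    case (Suc j)
    have "A ((E ^^ Suc j) x) = E (F (E ((E ^^ j) x))) - qint q (2 * real (Suc j) - real k) *\<^sub>R (E ^^ Suc j) x"
      using EF[OF Ej[OF that, of "Suc j"]] by (simp add: A_def algebra_simps)
    also have "\<dots> = E (A ((E ^^ j) x)) + qint q (real k - 2 * real (Suc j)) *\<^sub>R (E ^^ Suc j) x"
      using qint_minus[of q "real k - 2 * real (Suc j)"] by (simp add: A_def)
    also have "\<dots> = (E ^^ Suc j) (A x) + S (Suc j) *\<^sub>R (E ^^ Suc j) x"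
      unfolding Suc using lin(1) by (simp add: S_def linear_add linear_scale scaleR_left_distrib)
    finally show ?case .
  qed (simp add: S_def A_def)
  show ?thesis using j x 0
  proof (induction j arbitrary: x)
    case (Suc j)
    \<comment> \<open>\<open>E ^^ j\<close> maps \<open>?y\<close> to the image under
      \<open>F\<close> of \<open>(E ^^ Suc j) x\<close>, which is 0, so the induction hypothesis
      gives \<open>?y = 0\<close>. Pairing this with \<open>x\<close> leaves a sum of non-negative
      terms, one of which is a positive multiple of \<open>inner x x\<close>.\<close>
    let ?y = "A x + S j *\<^sub>R x"
    have W: "?y \<in> W (- real k)"
      using AW[OF Suc.prems(2)] Suc.prems(2) sub by (simp add: subspace_add subspace_scale)
    have "(E ^^ j) ?y = (E ^^ j) (A x) + S j *\<^sub>R (E ^^ j) x"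
      using linEj by (simp add: linear_add linear_scale)
    also have "\<dots> = F (E ((E ^^ j) x))" using shift[OF Suc.prems(2)] by (simp add: A_def)
    also have "\<dots> = 0" using Suc.prems(3) linear_0[OF lin(2)] by simp
    finally have "?y = 0" using Suc.IH[OF _ W] Suc.prems(1) by simp
    then have "0 = inner x (A x) + S j * inner x x"
      by (metis inner_add_right inner_scaleR_right inner_zero_right)
    moreover have "inner x (A x) = inner (F x) (F x) + qint q (real k) * inner x x"
    proof -
      have "A x = E (F x) + qint q (real k) *\<^sub>R x"
        using EF[OF Suc.prems(2)] by (simp add: A_def qint_minus algebra_simps)
      moreover have "inner x (E (F x)) = inner (F x) (F x)"
        using adj[OF F[OF Suc.prems(2)] Suc.prems(2)] by (simp add: inner_commute)
      ultimately show ?thesis by (simp add: inner_add_right)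
    qed
    moreover have "0 \<le> S j" unfolding S_def using q Suc.prems(1) by (intro qint_partial_sum_nonneg) auto
    moreover have "0 < qint q (real k)" using q k by (intro qint_pos) auto
    ultimately have "qint q (real k) * inner x x \<le> 0"
      by (smt (verit) inner_ge_zero mult_nonneg_nonneg)
    then show ?case using \<open>0 < qint q (real k)\<close>
      by (simp add: mult_le_0_iff not_less) (metis inner_ge_zero inner_eq_zero_iff order_antisym)
  qed simp
qed

lemma orthonormal_basis_exists:
  fixes S :: "'a::real_inner set"
  assumes "finite S"
  shows "\<exists>B. finite B \<and> (\<forall>b\<in>B. \<forall>c\<in>B. inner b c = (if b = c then 1 else 0)) \<and> span B = span S"
  using assms
proof (induction S rule: finite_induct)
  case (insert x S)
  then obtain B where B: "finite B" "\<And>b c. \<lbrakk>b \<in> B; c \<in> B\<rbrakk> \<Longrightarrow> inner b c = (if b = c then 1 else 0)"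
    "span B = span S" by blast
  define y where "y = x - (\<Sum>b\<in>B. inner b x *\<^sub>R b)"
  have yo: "inner c y = 0" if "c \<in> B" for c
  proof -
    have "inner c (\<Sum>b\<in>B. inner b x *\<^sub>R b) = (\<Sum>b\<in>B. if b = c then inner b x else 0)"
      unfolding inner_sum_right using that B(2) by (intro sum.cong) auto
    then show ?thesis using that B(1) by (simp add: y_def inner_diff_right)
  qed
  have sp: "(\<Sum>b\<in>B. inner b x *\<^sub>R b) \<in> span B" by (intro span_sum span_scale span_base)
  have span_y: "span (insert x S) = span (insert y B)"
  proof -
    have "span (insert x S) = span (insert x B)"
      by (simp only: span_insert B(3))
    also have "\<dots> = span (insert y B)"
    proof -
      have "x = y + (\<Sum>b\<in>B. inner b x *\<^sub>R b)" by (simp add: y_def)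
      moreover have "y + (\<Sum>b\<in>B. inner b x *\<^sub>R b) \<in> span (insert y B)"
        by (rule span_add[OF span_base subsetD[OF span_mono sp]]) auto
      moreover have "y \<in> span (insert x B)"
        unfolding y_def using sp span_mono[of B "insert x B"] by (intro span_diff) (auto intro: span_base)
      ultimately show ?thesis unfolding span_eq by (auto intro: span_base)
    qed
    finally show ?thesis .
  qed
  show ?case
  proof (cases "y = 0")
    case True
    then show ?thesis using B span_y by (intro exI[of _ B]) (auto simp: span_insert_0)
  next
    case False
    define z where "z = (1 / norm y) *\<^sub>R y"
    have zz: "inner z z = 1" using False by (simp add: z_def dot_square_norm power2_eq_square)
    have zo: "inner c z = 0" if "c \<in> B" for c using yo[OF that] by (simp add: z_def)
    have zo': "inner z c = 0" if "c \<in> B" for c using zo[OF that] by (simp add: inner_commute)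
    have "z \<notin> B" using zz zo[of z] by auto
    have zB: "span (insert z B) = span (insert y B)"
    proof -
      have "y = norm y *\<^sub>R z" using False by (simp add: z_def)
      moreover have "norm y *\<^sub>R z \<in> span (insert z B)" by (intro span_scale span_base) simp
      moreover have "z \<in> span (insert y B)" unfolding z_def by (intro span_scale span_base) simp
      ultimately show ?thesis unfolding span_eq by (auto intro: span_base)
    qed
    show ?thesis
    proof (intro exI[of _ "insert z B"] conjI ballI)
      fix b c assume "b \<in> insert z B" "c \<in> insert z B"
      then show "inner b c = (if b = c then 1 else 0)"
        using zz zo zo' B(2) \<open>z \<notin> B\<close> by (elim insertE) auto
    qed (use B(1) zB span_y in simp_all)
  qed
next
  case empty
  show ?case by (rule exI[of _ "{}"]) simp
qed

lemma orthonormal_independent: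
  fixes B :: "'a::real_inner set"
  assumes "\<And>b c. \<lbrakk>b \<in> B; c \<in> B\<rbrakk> \<Longrightarrow> inner b c = (if b = c then 1 else 0)"
  shows "independent B"
proof (rule pairwise_orthogonal_independent)
  show "pairwise orthogonal B" using assms by (simp add: pairwise_def orthogonal_def)
  show "0 \<notin> B" using assms[of 0 0] by auto
qed

text \<open>The finite set \<open>C\<close> guards against the convention that an
  infinite-dimensional space has \<open>dim\<close> 0.\<close>

lemma dim_le_injective:
  fixes f :: "'a::real_vector \<Rightarrow> 'a"
  assumes "linear f" "subspace A" "f ` A \<subseteq> A'" "\<And>x. x \<in> A \<Longrightarrow> f x = 0 \<Longrightarrow> x = 0"
    and "finite C" "A' \<subseteq> span C"
  shows "dim A \<le> dim A'"
proof -
  obtain B where B: "B \<subseteq> A" "independent B" "A \<subseteq> span B" "card B = dim A"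
    using basis_exists[of A] by metis
  obtain B' where B': "B' \<subseteq> A'" "independent B'" "A' \<subseteq> span B'" "card B' = dim A'"
    using basis_exists[of A'] by metis
  have fB': "finite B'"
    using independent_span_bound[OF assms(5) B'(2)] B'(1) assms(6) by auto
  have sB: "span B = A" using B assms(2) by (simp add: span_minimal subset_antisym)
  have inj: "inj_on f A"
  proof (rule inj_onI)
    fix x y assume "x \<in> A" "y \<in> A" "f x = f y"
    then have "x - y \<in> A" "f (x - y) = 0"
      using assms(1,2) by (auto simp: subspace_diff linear_diff)
    then show "x = y" using assms(4) by force
  qed
  then have "independent (f ` B)"
    using linear_independent_injective_image[OF assms(1) B(2)] sB by simp
  moreover have "f ` B \<subseteq> span B'" using assms(3) B(1) B'(3) by auto
  ultimately have "card (f ` B) \<le> card B'" using independent_span_bound[OF fB'] by blast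
  moreover have "card (f ` B) = card B" using inj B(1) by (intro card_image) (rule inj_on_subset)
  ultimately show ?thesis using B(4) B'(4) by simp
qed

text \<open>Reversal is a composition of adjacent transpositions: the tail is reversed recursively
  and then the head is moved past it. The prefix \<open>us\<close> carries the entries that stay in
  place.\<close>

lemma swap_invariant_imp_rev_invariant:
  assumes "\<And>us x y ys. Suc (Suc (length us + length ys)) = N \<Longrightarrow> f (us @ x # y # ys) = f (us @ y # x # ys)"
    and "length xs = N"
  shows "f xs = f (rev xs)"
proof -
  have move: "f (us @ x # xs @ ys) = f (us @ xs @ x # ys)" if "Suc (length us + length xs + length ys) = N"
    for us x xs ys
    using that
  proof (induction xs arbitrary: us)
    case (Cons a xs)
    have "f (us @ x # a # xs @ ys) = f (us @ a # x # xs @ ys)"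
      using Cons.prems by (intro assms(1)) simp
    also have "\<dots> = f ((us @ [a]) @ xs @ x # ys)"
      using Cons.IH[of "us @ [a]"] Cons.prems by simp
    finally show ?case by simp
  qed simp
  have "f (us @ xs) = f (us @ rev xs)" if "length us + length xs = N" for us
    using that
  proof (induction xs arbitrary: us)
    case (Cons x xs)
    have "f (us @ x # xs) = f ((us @ [x]) @ rev xs)" using Cons.IH[of "us @ [x]"] Cons.prems by simp
    also have "\<dots> = f (us @ rev xs @ [x])" using move[of us "rev xs" "[]" x] Cons.prems by simp
    finally show ?case by simp
  qed simp
  from this[of "[]"] show ?thesis using assms(2) by simp
qed

lemma powr_half_diff:
  "(q::real) powr (- real_of_int c / 2) * q powr ((real_of_int a - real_of_int b) / 2)
    = q powr ((real_of_int a - real_of_int b - real_of_int c) / 2)"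
proof -
  have "- real_of_int c / 2 + (real_of_int a - real_of_int b) / 2 = (real_of_int a - real_of_int b - real_of_int c) / 2"
    by (simp add: field_simps)
  then show ?thesis by (simp only: powr_add[symmetric])
qed

section \<open>Words and weight spaces of a highest weight module\<close>

definition cartan :: "nat \<Rightarrow> nat \<Rightarrow> int" where
  "cartan i j = (if i = j then 2 else if \<bar>int i - int j\<bar> = 1 then - 1 else 0)"

text \<open>The module is taken over the reals. The relations among the \<open>F i\<close> hold on
  the whole space, because they are later read as identities between endomorphisms; the others are
  local to \<open>V\<close>. The commutator of \<open>E i\<close> and \<open>F i\<close> is stated
  on eigenvectors of \<open>K i\<close> only, where it becomes a quantum integer and no inverse of
  \<open>K i\<close> occurs.\<close>

locale hw_module =
  fixes q :: real and l :: nat and V :: "'a::real_inner set"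
    and K E F :: "nat \<Rightarrow> 'a \<Rightarrow> 'a" and n :: "nat \<Rightarrow> nat" and v :: 'a
  assumes q: "0 < q" "q < 1"
    and V_subspace: "subspace V"
    and V_finite: "\<exists>C. finite C \<and> V \<subseteq> span C"
    and linear_K: "i \<in> {1..l} \<Longrightarrow> linear (K i)"
    and linear_E: "i \<in> {1..l} \<Longrightarrow> linear (E i)"
    and linear_F: "i \<in> {1..l} \<Longrightarrow> linear (F i)"
    and K_V: "\<lbrakk>i \<in> {1..l}; x \<in> V\<rbrakk> \<Longrightarrow> K i x \<in> V"
    and E_V: "\<lbrakk>i \<in> {1..l}; x \<in> V\<rbrakk> \<Longrightarrow> E i x \<in> V"
    and F_V: "\<lbrakk>i \<in> {1..l}; x \<in> V\<rbrakk> \<Longrightarrow> F i x \<in> V"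
    and K_E: "\<lbrakk>i \<in> {1..l}; j \<in> {1..l}; x \<in> V\<rbrakk> \<Longrightarrow> K i (E j x) = q powr (cartan i j / 2) *\<^sub>R E j (K i x)"
    and K_F: "\<lbrakk>i \<in> {1..l}; j \<in> {1..l}; x \<in> V\<rbrakk> \<Longrightarrow> K i (F j x) = q powr (- cartan i j / 2) *\<^sub>R F j (K i x)"
    and E_F: "\<lbrakk>i \<in> {1..l}; j \<in> {1..l}; i \<noteq> j; x \<in> V\<rbrakk> \<Longrightarrow> E i (F j x) = F j (E i x)"
    and E_F_same: "\<lbrakk>i \<in> {1..l}; x \<in> V; K i x = q powr (h / 2) *\<^sub>R x\<rbrakk> \<Longrightarrow>
      E i (F i x) - F i (E i x) = qint q h *\<^sub>R x"
    and F_far: "\<lbrakk>i \<in> {1..l}; j \<in> {1..l}; \<bar>int i - int j\<bar> > 1\<rbrakk> \<Longrightarrow> F i (F j x) = F j (F i x)"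
    and F_serre: "\<lbrakk>i \<in> {1..l}; j \<in> {1..l}; \<bar>int i - int j\<bar> = 1\<rbrakk> \<Longrightarrow>
      F i (F i (F j x)) - (q + 1 / q) *\<^sub>R F i (F j (F i x)) + F j (F i (F i x)) = 0"
    and E_adj: "\<lbrakk>i \<in> {1..l}; x \<in> V; y \<in> V\<rbrakk> \<Longrightarrow> inner (E i x) y = inner x (F i y)"
    and K_adj: "\<lbrakk>i \<in> {1..l}; x \<in> V; y \<in> V\<rbrakk> \<Longrightarrow> inner (K i x) y = inner x (K i y)"
    and v_V: "v \<in> V" and v_norm: "norm v = 1"
    and E_v: "i \<in> {1..l} \<Longrightarrow> E i v = 0"
    and K_v: "i \<in> {1..l} \<Longrightarrow> K i v = q powr (n i / 2) *\<^sub>R v"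
begin

abbreviation words :: "nat list set" where "words \<equiv> lists {1..l}"

definition word :: "nat list \<Rightarrow> 'a" where "word w = foldr F w v"

lemma word_simps [simp]: "word [] = v" "word (i # w) = F i (word w)"
  by (simp_all add: word_def)

definition U :: "'a set" where "U = span (word ` words)"

lemma subspace_U: "subspace U" by (simp add: U_def)

lemma word_V: "w \<in> words \<Longrightarrow> word w \<in> V"
  by (induction w) (auto intro: v_V F_V)

lemma U_V: "U \<subseteq> V"
  unfolding U_def using word_V by (intro span_minimal V_subspace) auto

lemma linear_span_image_subset:
  assumes "linear f" "\<And>x. x \<in> S \<Longrightarrow> f x \<in> span T" "x \<in> span S"
  shows "f x \<in> span T"
proof -
  have "f x \<in> f ` span S" using assms(3) by simp
  also have "\<dots> = span (f ` S)" using linear_span_image[OF assms(1)] by simp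
  also have "\<dots> \<subseteq> span T" using assms(2) by (intro span_minimal) auto
  finally show ?thesis .
qed

lemma F_U: "\<lbrakk>i \<in> {1..l}; x \<in> U\<rbrakk> \<Longrightarrow> F i x \<in> U"
  unfolding U_def
  by (rule linear_span_image_subset[OF linear_F]) (auto intro!: span_base image_eqI[of _ _ "_ # _"])

text \<open>Weights are written in coordinates \<open>\<eta>\<close> with \<open>\<mu>\<^sub>i = \<eta>\<^sub>i - \<eta>\<^sub>i\<^sub>+\<^sub>1\<close>, in which the \<open>i\<close>-th simple reflection
  exchanges \<open>\<eta>\<^sub>i\<close> and \<open>\<eta>\<^sub>i\<^sub>+\<^sub>1\<close> and \<open>F\<^sub>i\<close> lowers \<open>\<eta>\<^sub>i\<close> and raises \<open>\<eta>\<^sub>i\<^sub>+\<^sub>1\<close> by one.\<close>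

definition hw_weight :: "nat \<Rightarrow> int" where
  "hw_weight i = (\<Sum>k=i..l. int (n k))"

definition word_weight :: "nat list \<Rightarrow> nat \<Rightarrow> int" where
  "word_weight w i = hw_weight i - int (count_list w i) + int (count_list w (i - 1))"

definition wspace :: "(nat \<Rightarrow> int) \<Rightarrow> 'a set" where
  "wspace \<eta> = {x \<in> U. \<forall>i\<in>{1..l}. K i x = q powr ((\<eta> i - \<eta> (i + 1)) / 2) *\<^sub>R x}"

lemma wspace_cong:
  assumes "\<And>i. i \<in> {1..Suc l} \<Longrightarrow> \<eta> i = \<eta>' i"
  shows "wspace \<eta> = wspace \<eta>'"
  using assms unfolding wspace_def by (intro Collect_cong) auto

lemma subspace_wspace: "subspace (wspace \<eta>)"
  unfolding wspace_def using subspace_U linear_K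
  by (intro subspaceI) (auto simp: subspace_0 subspace_add subspace_scale linear_0 linear_add linear_scale
      scaleR_right_distrib)

lemma word_weight_Nil: "i \<in> {1..l} \<Longrightarrow> word_weight [] i - word_weight [] (i + 1) = int (n i)"
  by (simp add: word_weight_def hw_weight_def sum.atLeast_Suc_atMost)

lemma word_weight_Cons:
  assumes "i \<in> {1..l}" "j \<in> {1..l}"
  shows "word_weight (j # w) i - word_weight (j # w) (i + 1)
    = word_weight w i - word_weight w (i + 1) - cartan i j"
  using assms by (auto simp: word_weight_def cartan_def)

lemma word_wspace: "w \<in> words \<Longrightarrow> word w \<in> wspace (word_weight w)"
proof (induction w)
  case Nil
  then show ?case using K_v word_weight_Nil
    by (auto simp: wspace_def U_def simp flip: of_int_diff intro!: span_base image_eqI[of _ _ "[]"])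
next
  case (Cons j w)
  then have j: "j \<in> {1..l}" and w: "w \<in> words" "word w \<in> wspace (word_weight w)" by auto
  have "K i (F j (word w)) = q powr ((word_weight (j # w) i - word_weight (j # w) (i + 1)) / 2) *\<^sub>R F j (word w)"
    if i: "i \<in> {1..l}" for i
  proof -
    have "K i (F j (word w)) = q powr (- cartan i j / 2) *\<^sub>R F j (q powr ((word_weight w i - word_weight w (i + 1)) / 2) *\<^sub>R word w)"
      using w i j K_F[OF i j word_V[OF w(1)]] by (simp add: wspace_def)
    also have "\<dots> = q powr ((word_weight w i - word_weight w (i + 1) - cartan i j) / 2) *\<^sub>R F j (word w)"
      by (simp only: linear_scale[OF linear_F[OF j]] scaleR_scaleR of_int_diff of_int_minus powr_half_diff)
    finally show ?thesis unfolding word_weight_Cons[OF i j, symmetric] by simp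
  qed
  moreover have "F j (word w) \<in> U" using j w by (intro F_U) (auto simp: wspace_def)
  ultimately show ?case by (simp add: wspace_def)
qed

lemma word_U: "w \<in> words \<Longrightarrow> word w \<in> U"
  unfolding U_def by (auto intro: span_base)

text \<open>Iterated down to \<open>v\<close>, which \<open>E i\<close> kills, this expresses
  \<open>E i\<close> on a word as a combination of words whose coefficients are quantum integers of
  weights.\<close>

lemma E_word_Cons:
  assumes "i \<in> {1..l}" "j \<in> {1..l}" "w \<in> words"
  shows "E i (word (j # w)) = F j (E i (word w))
    + (if i = j then qint q (word_weight w i - word_weight w (i + 1)) *\<^sub>R word w else 0)"
  using assms E_F[OF assms(1,2) _ word_V[OF assms(3)]]
    E_F_same[OF assms(1) word_V[OF assms(3)], of "word_weight w i - word_weight w (i + 1)"]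
    word_wspace[OF assms(3)]
  by (auto simp: wspace_def algebra_simps)

lemma E_word_U: "\<lbrakk>i \<in> {1..l}; w \<in> words\<rbrakk> \<Longrightarrow> E i (word w) \<in> U"
proof (induction w)
  case Nil
  then show ?case by (simp add: E_v subspace_0 subspace_U)
next
  case (Cons j w)
  then show ?case using F_U word_U
    by (simp only: E_word_Cons Cons_in_lists_iff)
      (auto intro!: subspace_add subspace_U subspace_scale simp: subspace_0[OF subspace_U])
qed

lemma E_U: "\<lbrakk>i \<in> {1..l}; x \<in> U\<rbrakk> \<Longrightarrow> E i x \<in> U"
proof -
  assume i: "i \<in> {1..l}" and x: "x \<in> U"
  have "E i y \<in> span (word ` words)" if "y \<in> word ` words" for y
    using E_word_U[OF i] that unfolding U_def by blast
  then show "E i x \<in> U" using x unfolding U_def by (rule linear_span_image_subset[OF linear_E[OF i]])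
qed

lemma E_wspace:
  assumes "j \<in> {1..l}" "x \<in> wspace \<eta>"
  shows "E j x \<in> wspace (\<eta>(j := \<eta> j + 1, Suc j := \<eta> (Suc j) - 1))" (is "_ \<in> wspace ?\<eta>")
proof -
  have x: "x \<in> U" "x \<in> V" using assms(2) U_V by (auto simp: wspace_def)
  have "K i (E j x) = q powr ((?\<eta> i - ?\<eta> (i + 1)) / 2) *\<^sub>R E j x" if i: "i \<in> {1..l}" for i
  proof -
    have "K i (E j x) = q powr (cartan i j / 2) *\<^sub>R E j (q powr ((\<eta> i - \<eta> (i + 1)) / 2) *\<^sub>R x)"
      using K_E[OF i assms(1) x(2)] assms(2) i by (simp add: wspace_def)
    also have "\<dots> = q powr ((cartan i j + (\<eta> i - \<eta> (i + 1))) / 2) *\<^sub>R E j x"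
      using linear_E[OF assms(1)] by (simp add: linear_scale add_divide_distrib flip: powr_add)
    also have "cartan i j + (\<eta> i - \<eta> (i + 1)) = ?\<eta> i - ?\<eta> (i + 1)"
      using i assms(1) by (auto simp: cartan_def)
    finally show ?thesis by (simp only: of_int_diff)
  qed
  then show ?thesis using E_U[OF assms(1) x(1)] by (simp add: wspace_def)
qed

lemma F_wspace:
  assumes "j \<in> {1..l}" "x \<in> wspace \<eta>"
  shows "F j x \<in> wspace (\<eta>(j := \<eta> j - 1, Suc j := \<eta> (Suc j) + 1))" (is "_ \<in> wspace ?\<eta>")
proof -
  have x: "x \<in> U" "x \<in> V" using assms(2) U_V by (auto simp: wspace_def)
  have "K i (F j x) = q powr ((?\<eta> i - ?\<eta> (i + 1)) / 2) *\<^sub>R F j x" if i: "i \<in> {1..l}" for i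
  proof -
    have "K i (F j x) = q powr (- cartan i j / 2) *\<^sub>R F j (q powr ((\<eta> i - \<eta> (i + 1)) / 2) *\<^sub>R x)"
      using K_F[OF i assms(1) x(2)] assms(2) i by (simp add: wspace_def)
    also have "\<dots> = q powr ((\<eta> i - \<eta> (i + 1) - cartan i j) / 2) *\<^sub>R F j x"
      by (simp only: linear_scale[OF linear_F[OF assms(1)]] scaleR_scaleR of_int_diff of_int_minus powr_half_diff)
    also have "\<eta> i - \<eta> (i + 1) - cartan i j = ?\<eta> i - ?\<eta> (i + 1)"
      using i assms(1) by (auto simp: cartan_def)
    finally show ?thesis by (simp only: of_int_diff)
  qed
  then show ?thesis using F_U[OF assms(1) x(1)] by (simp add: wspace_def)
qed

lemma E_power_wspace:
  assumes "j \<in> {1..l}" "x \<in> wspace \<eta>"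
  shows "(E j ^^ t) x \<in> wspace (\<eta>(j := \<eta> j + int t, Suc j := \<eta> (Suc j) - int t))"
proof (induction t)
  case (Suc t)
  define \<eta>' where "\<eta>' = \<eta>(j := \<eta> j + int t, Suc j := \<eta> (Suc j) - int t)"
  have "\<eta>'(j := \<eta>' j + 1, Suc j := \<eta>' (Suc j) - 1)
    = \<eta>(j := \<eta> j + int (Suc t), Suc j := \<eta> (Suc j) - int (Suc t))"
    by (auto simp: fun_eq_iff \<eta>'_def)
  then show ?case
    using E_wspace[OF assms(1) Suc[folded \<eta>'_def]] by (simp only: funpow.simps o_apply)
qed (simp add: assms)

lemma F_power_wspace:
  assumes "j \<in> {1..l}" "x \<in> wspace \<eta>"
  shows "(F j ^^ t) x \<in> wspace (\<eta>(j := \<eta> j - int t, Suc j := \<eta> (Suc j) + int t))"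
proof (induction t)
  case (Suc t)
  define \<eta>' where "\<eta>' = \<eta>(j := \<eta> j - int t, Suc j := \<eta> (Suc j) + int t)"
  have "\<eta>'(j := \<eta>' j - 1, Suc j := \<eta>' (Suc j) + 1)
    = \<eta>(j := \<eta> j - int (Suc t), Suc j := \<eta> (Suc j) + int (Suc t))"
    by (auto simp: fun_eq_iff \<eta>'_def)
  then show ?case
    using F_wspace[OF assms(1) Suc[folded \<eta>'_def]] by (simp only: funpow.simps o_apply)
qed (simp add: assms)

section \<open>Weyl group symmetry of weight multiplicities\<close>

definition sl2_space :: "nat \<Rightarrow> real \<Rightarrow> 'a set" where
  "sl2_space i h = {x \<in> U. K i x = q powr (h / 2) *\<^sub>R x}"

lemma subspace_sl2_space: "i \<in> {1..l} \<Longrightarrow> subspace (sl2_space i h)"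
  unfolding sl2_space_def using subspace_U linear_K
  by (intro subspaceI) (auto simp: subspace_0 subspace_add subspace_scale linear_0 linear_add linear_scale
      scaleR_right_distrib)

lemma E_sl2_space: "\<lbrakk>i \<in> {1..l}; x \<in> sl2_space i h\<rbrakk> \<Longrightarrow> E i x \<in> sl2_space i (h + 2)"
  using E_U[of i x] K_E[of i i x] U_V linear_E[of i]
  by (auto simp: sl2_space_def linear_scale cartan_def add_divide_distrib powr_add subset_iff)

lemma F_sl2_space: "\<lbrakk>i \<in> {1..l}; x \<in> sl2_space i h\<rbrakk> \<Longrightarrow> F i x \<in> sl2_space i (h - 2)"
  using F_U[of i x] K_F[of i i x] U_V linear_F[of i]
  by (auto simp: sl2_space_def linear_scale cartan_def diff_divide_distrib powr_diff powr_minus_divide subset_iff)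

lemma E_power_injective:
  assumes "i \<in> {1..l}" "x \<in> sl2_space i (- real k)" "(E i ^^ k) x = 0"
  shows "x = 0"
proof (cases "k = 0")
  case False
  show ?thesis
  proof (rule sl2_raising_injective[where E = "E i" and F = "F i" and W = "sl2_space i" and k = k and j = k])
    show "inner (E i x) y = inner x (F i y)" if "x \<in> sl2_space i h" "y \<in> sl2_space i h'" for x y h h'
      using E_adj[OF assms(1)] that U_V by (auto simp: sl2_space_def)
    show "E i (F i x) - F i (E i x) = qint q h *\<^sub>R x" if "x \<in> sl2_space i h" for x h
      using E_F_same[OF assms(1)] that U_V by (auto simp: sl2_space_def)
  qed (use assms False q linear_E linear_F subspace_sl2_space E_sl2_space F_sl2_space in auto)
qed (use assms in simp)

text \<open>The sl(2) argument is symmetric: exchanging \<open>E i\<close> and \<open>F i\<close>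
  changes the sign of the commutator, and reversing the grading compensates for it.\<close>

lemma F_power_injective:
  assumes "i \<in> {1..l}" "x \<in> sl2_space i (real k)" "(F i ^^ k) x = 0"
  shows "x = 0"
proof (cases "k = 0")
  case False
  show ?thesis
  proof (rule sl2_raising_injective[where E = "F i" and F = "E i" and W = "\<lambda>h. sl2_space i (- h)" and k = k and j = k])
    show "inner (F i x) y = inner x (E i y)" if "x \<in> sl2_space i (- h)" "y \<in> sl2_space i (- h')" for x y h h'
    proof -
      have "inner (E i y) x = inner y (F i x)"
        using E_adj[OF assms(1), of y x] that U_V by (auto simp: sl2_space_def)
      then show ?thesis by (metis inner_commute)
    qed
    show "F i (E i x) - E i (F i x) = qint q h *\<^sub>R x" if "x \<in> sl2_space i (- h)" for x h
    proof -
      have "E i (F i x) - F i (E i x) = qint q (- h) *\<^sub>R x"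
        using E_F_same[OF assms(1)] that U_V by (auto simp: sl2_space_def)
      then show ?thesis by (simp add: qint_minus algebra_simps)
    qed
    show "F i x \<in> sl2_space i (- (h + 2))" if "x \<in> sl2_space i (- h)" for x h
      using F_sl2_space[OF assms(1) that] by simp
    show "E i x \<in> sl2_space i (- (h - 2))" if "x \<in> sl2_space i (- h)" for x h
      using E_sl2_space[OF assms(1) that] by (simp add: algebra_simps)
  qed (use assms False q linear_E linear_F subspace_sl2_space in auto)
qed (use assms in simp)

lemma wspace_sl2_space:
  "\<lbrakk>i \<in> {1..l}; x \<in> wspace \<eta>; real_of_int (\<eta> i - \<eta> (Suc i)) = h\<rbrakk> \<Longrightarrow> x \<in> sl2_space i h"
  by (auto simp: wspace_def sl2_space_def)

lemma linear_funpow: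
  fixes f :: "'a \<Rightarrow> 'a"
  assumes "linear f" shows "linear (f ^^ k)"
proof (induction k)
  case (Suc k)
  then show ?case using linear_compose[OF Suc assms] by (simp add: o_def)
qed (simp add: linear_ident id_def)

text \<open>A weight and its reflection differ by k times the i-th simple root, where k is the
  distance of the two coordinates. The k-th power of \<open>E i\<close> or of \<open>F i\<close>
  maps one weight space injectively into the other. Since the reflection is an involution, the
  inequality already implies equality.\<close>

lemma dim_wspace_swap_le:
  assumes "i \<in> {1..l}"
  shows "dim (wspace \<eta>) \<le> dim (wspace (\<eta>(i := \<eta> (Suc i), Suc i := \<eta> i)))"
proof -
  obtain C where C: "finite C" "V \<subseteq> span C" using V_finite by auto
  have sub: "wspace \<eta>' \<subseteq> span C" for \<eta>' using C U_V by (auto simp: wspace_def)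
  show ?thesis
  proof (cases "\<eta> i \<le> \<eta> (Suc i)")
    case True
    define k where "k = nat (\<eta> (Suc i) - \<eta> i)"
    have k: "real_of_int (\<eta> i - \<eta> (Suc i)) = - real k" "\<eta> i + int k = \<eta> (Suc i)" "\<eta> (Suc i) - int k = \<eta> i"
      using True by (simp_all add: k_def)
    show ?thesis
    proof (rule dim_le_injective[OF linear_funpow[OF linear_E[OF assms]] subspace_wspace _ _ C(1) sub])
      show "(E i ^^ k) ` wspace \<eta> \<subseteq> wspace (\<eta>(i := \<eta> (Suc i), Suc i := \<eta> i))"
        using E_power_wspace[OF assms, of _ \<eta> k] k by auto
      show "\<And>x. \<lbrakk>x \<in> wspace \<eta>; (E i ^^ k) x = 0\<rbrakk> \<Longrightarrow> x = 0"
        using E_power_injective[OF assms wspace_sl2_space[OF assms _ k(1)]] by blast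
    qed
  next
    case False
    define k where "k = nat (\<eta> i - \<eta> (Suc i))"
    have k: "real_of_int (\<eta> i - \<eta> (Suc i)) = real k" "\<eta> i - int k = \<eta> (Suc i)" "\<eta> (Suc i) + int k = \<eta> i"
      using False by (simp_all add: k_def)
    show ?thesis
    proof (rule dim_le_injective[OF linear_funpow[OF linear_F[OF assms]] subspace_wspace _ _ C(1) sub])
      show "(F i ^^ k) ` wspace \<eta> \<subseteq> wspace (\<eta>(i := \<eta> (Suc i), Suc i := \<eta> i))"
        using F_power_wspace[OF assms, of _ \<eta> k] k by auto
      show "\<And>x. \<lbrakk>x \<in> wspace \<eta>; (F i ^^ k) x = 0\<rbrakk> \<Longrightarrow> x = 0"
        using F_power_injective[OF assms wspace_sl2_space[OF assms _ k(1)]] by blast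
    qed
  qed
qed

lemma dim_wspace_swap:
  assumes "i \<in> {1..l}"
  shows "dim (wspace (\<eta>(i := \<eta> (Suc i), Suc i := \<eta> i))) = dim (wspace \<eta>)"
proof (rule antisym)
  show "dim (wspace (\<eta>(i := \<eta> (Suc i), Suc i := \<eta> i))) \<le> dim (wspace \<eta>)"
    using dim_wspace_swap_le[OF assms, of "\<eta>(i := \<eta> (Suc i), Suc i := \<eta> i)"] by (simp add: fun_upd_twist)
qed (rule dim_wspace_swap_le[OF assms])

abbreviation lspace :: "int list \<Rightarrow> 'a set" where
  "lspace xs \<equiv> wspace (\<lambda>i. xs ! (i - 1))"

text \<open>Reversing the coordinates is the longest element of the Weyl group, which sends 2 rho to
  its negative. Coordinate i sits at list position i - 1.\<close>

lemma dim_lspace_rev: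
  assumes "length xs = Suc l"
  shows "dim (lspace xs) = dim (lspace (rev xs))"
proof (rule swap_invariant_imp_rev_invariant[where f = "\<lambda>xs. dim (lspace xs)", OF _ assms])
  fix us ys :: "int list" and x y assume len: "Suc (Suc (length us + length ys)) = Suc l"
  define i where "i = Suc (length us)"
  define \<eta> where "\<eta> = (\<lambda>i. (us @ x # y # ys) ! (i - 1))"
  have i: "i \<in> {1..l}" using len by (simp add: i_def)
  have "lspace (us @ y # x # ys) = wspace (\<eta>(i := \<eta> (Suc i), Suc i := \<eta> i))"
    by (rule wspace_cong) (auto simp: \<eta>_def i_def nth_append nth_Cons' split: if_splits)
  then show "dim (lspace (us @ x # y # ys)) = dim (lspace (us @ y # x # ys))"
    using dim_wspace_swap[OF i, of \<eta>] by (simp add: \<eta>_def)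
qed

end

section \<open>The trace of K_2rho on a single module\<close>

context hw_module
begin

definition rho_coeff :: "nat \<Rightarrow> int" where "rho_coeff j = int j * (int l + 1 - int j)"

text \<open>The pairing of 2 rho with a weight given in fundamental weights;
  \<open>rho_coeff j\<close> is the coefficient of the j-th simple root in 2 rho.\<close>

definition rho_pair :: "(nat \<Rightarrow> int) \<Rightarrow> int" where
  "rho_pair \<mu> = (\<Sum>j=1..l. rho_coeff j * \<mu> j)"

text \<open>The quadratic j (l + 1 - j) has second difference -2. It vanishes at 0 and at l + 1, so
  the two ends of the diagram follow the same formula.\<close>

lemma rho_pair_cartan:
  assumes "i \<in> {1..l}"
  shows "rho_pair (\<lambda>j. cartan j i) = 2"
proof -
  have "rho_coeff j * cartan j i = (if j = i then 2 * rho_coeff j else 0)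
      - (if j = Suc i then rho_coeff j else 0) - (if j = i - 1 then rho_coeff j else 0)"
    if "j \<in> {1..l}" for j
    using assms that by (auto simp: cartan_def)
  then have "rho_pair (\<lambda>j. cartan j i) = (\<Sum>j=1..l. if j = i then 2 * rho_coeff j else 0)
      - (\<Sum>j=1..l. if j = Suc i then rho_coeff j else 0) - (\<Sum>j=1..l. if j = i - 1 then rho_coeff j else 0)"
    by (simp add: rho_pair_def sum_subtractf)
  also have "(\<Sum>j=1..l. if j = i then 2 * rho_coeff j else 0) = 2 * rho_coeff i" using assms by simp
  also have "(\<Sum>j=1..l. if j = Suc i then rho_coeff j else 0) = rho_coeff (Suc i)"
    using assms by (cases "i = l") (simp_all add: rho_coeff_def)
  also have "(\<Sum>j=1..l. if j = i - 1 then rho_coeff j else 0) = rho_coeff (i - 1)"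
    using assms by (cases "i = 1") (auto simp: rho_coeff_def)
  also have "2 * rho_coeff i - rho_coeff (Suc i) - rho_coeff (i - 1) = 2"
  proof -
    obtain k where "i = Suc k" using assms by (cases i) auto
    then show ?thesis by (simp add: rho_coeff_def algebra_simps)
  qed
  finally show ?thesis .
qed

definition wlist :: "nat list \<Rightarrow> int list" where
  "wlist w = map (word_weight w) [1..<Suc (Suc l)]"

text \<open>Weight spaces see only differences of coordinates. Fixing the sum, which all words share
  and reversal preserves, makes the list of a weight unique.\<close>

definition weight_lists :: "int list set" where
  "weight_lists = {xs. length xs = Suc l \<and> sum_list xs = (\<Sum>i=1..Suc l. hw_weight i)}"

abbreviation ldiff :: "int list \<Rightarrow> nat \<Rightarrow> int" where
  "ldiff xs i \<equiv> xs ! (i - 1) - xs ! i"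

lemma nth_wlist: "i \<in> {1..Suc l} \<Longrightarrow> wlist w ! (i - 1) = word_weight w i"
  by (auto simp: wlist_def simp del: upt_Suc)

lemma ldiff_wlist: "i \<in> {1..l} \<Longrightarrow> ldiff (wlist w) i = word_weight w i - word_weight w (i + 1)"
  using nth_wlist[of i w] nth_wlist[of "Suc i" w] by simp

lemma lspace_wlist: "lspace (wlist w) = wspace (word_weight w)"
  by (rule wspace_cong) (rule nth_wlist)

lemma sum_word_weight: "w \<in> words \<Longrightarrow> (\<Sum>i=1..Suc l. word_weight w i) = (\<Sum>i=1..Suc l. hw_weight i)"
proof (induction w)
  case (Cons j w)
  then have j: "j \<in> {1..l}" by simp
  have "(\<Sum>i=1..Suc l. word_weight (j # w) i)
    = (\<Sum>i=1..Suc l. word_weight w i - (if i = j then 1 else 0) + (if i = Suc j then 1 else 0))"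
    using j by (intro sum.cong) (auto simp: word_weight_def)
  also have "\<dots> = (\<Sum>i=1..Suc l. word_weight w i) - (\<Sum>i=1..Suc l. if i = j then 1 else 0)
      + (\<Sum>i=1..Suc l. if i = Suc j then 1 else 0)"
    by (simp only: sum.distrib sum_subtractf)
  also have "\<dots> = (\<Sum>i=1..Suc l. word_weight w i)" using j by simp
  finally show ?case using Cons by simp
qed (simp add: word_weight_def)

lemma wlist_weight_lists: "w \<in> words \<Longrightarrow> wlist w \<in> weight_lists"
  using sum_word_weight
  by (simp add: weight_lists_def wlist_def sum_list_distinct_conv_sum_set atLeastLessThanSuc_atLeastAtMost
      del: upt_Suc)

lemma word_lspace: "w \<in> words \<Longrightarrow> word w \<in> lspace (wlist w)"
  by (subst lspace_wlist) (rule word_wspace)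

text \<open>Every letter subtracts a simple root, whose pairing with 2 rho is 2.\<close>

lemma rho_pair_wlist:
  "w \<in> words \<Longrightarrow> rho_pair (ldiff (wlist w)) = rho_pair (\<lambda>j. int (n j)) - 2 * int (length w)"
proof (induction w)
  case Nil
  then show ?case unfolding rho_pair_def using ldiff_wlist[of _ "[]"] word_weight_Nil
    by (auto intro!: sum.cong)
next
  case (Cons i w)
  then have i: "i \<in> {1..l}" by simp
  have "rho_pair (ldiff (wlist (i # w))) = rho_pair (\<lambda>j. ldiff (wlist w) j - cartan j i)"
    unfolding rho_pair_def using ldiff_wlist word_weight_Cons[OF _ i] by (intro sum.cong) auto
  also have "\<dots> = rho_pair (ldiff (wlist w)) - rho_pair (\<lambda>j. cartan j i)"
    by (simp add: rho_pair_def right_diff_distrib sum_subtractf)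
  finally show ?case using Cons rho_pair_cartan[OF i] by simp
qed

text \<open>Reversal negates the differences and reflects their positions, under which
  \<open>rho_coeff\<close> is symmetric.\<close>

lemma rho_pair_rev:
  assumes "length xs = Suc l"
  shows "rho_pair (ldiff (rev xs)) = - rho_pair (ldiff xs)"
proof -
  have "rho_pair (ldiff (rev xs)) = (\<Sum>j=1..l. rho_coeff (Suc l - j) * - ldiff xs (Suc l - j))"
    unfolding rho_pair_def
    using assms by (intro sum.cong) (auto simp: rev_nth rho_coeff_def of_nat_diff Suc_diff_le algebra_simps)
  also have "\<dots> = (\<Sum>j=1..l. rho_coeff j * - ldiff xs j)"
    by (rule sum.reindex_bij_witness[of _ "\<lambda>j. Suc l - j" "\<lambda>j. Suc l - j"]) auto
  also have "\<dots> = - rho_pair (ldiff xs)"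
    unfolding rho_pair_def by (simp only: mult_minus_right sum_negf)
  finally show ?thesis .
qed

lemma wspace_orthogonal:
  assumes "x \<in> wspace \<eta>" "y \<in> wspace \<eta>'" "i \<in> {1..l}" "\<eta> i - \<eta> (i + 1) \<noteq> \<eta>' i - \<eta>' (i + 1)"
  shows "inner x y = 0"
proof -
  let ?a = "q powr (real_of_int (\<eta> i - \<eta> (i + 1)) / 2)" and ?b = "q powr (real_of_int (\<eta>' i - \<eta>' (i + 1)) / 2)"
  have "inner (K i x) y = inner x (K i y)"
    using assms U_V by (intro K_adj) (auto simp: wspace_def)
  then have "?a * inner x y = ?b * inner x y" using assms by (simp add: wspace_def)
  moreover have "?a \<noteq> ?b" using assms(4) q by (simp add: powr_inj)
  ultimately show ?thesis by simp
qed

text \<open>Equal differences make the entrywise difference of the two lists constant, and equal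
  sums make this constant 0.\<close>

lemma weight_lists_eqI:
  assumes "xs \<in> weight_lists" "ys \<in> weight_lists" "\<And>i. i \<in> {1..l} \<Longrightarrow> ldiff xs i = ldiff ys i"
  shows "xs = ys"
proof -
  have c: "xs ! i - ys ! i = xs ! 0 - ys ! 0" if "i \<le> l" for i
    using that
  proof (induction i)
    case (Suc i)
    then show ?case using assms(3)[of "Suc i"] by auto
  qed simp
  have "0 = sum_list xs - sum_list ys" using assms by (simp add: weight_lists_def)
  also have "\<dots> = (\<Sum>i<Suc l. xs ! i - ys ! i)"
    using assms by (simp add: weight_lists_def sum_list_sum_nth sum_subtractf atLeast0LessThan)
  also have "\<dots> = (\<Sum>i<Suc l. xs ! 0 - ys ! 0)"
    by (rule sum.cong) (auto intro: c)
  also have "\<dots> = int (Suc l) * (xs ! 0 - ys ! 0)" by (simp only: sum_constant card_lessThan)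
  finally have 0: "xs ! 0 - ys ! 0 = 0" by simp
  show ?thesis
  proof (rule nth_equalityI)
    show "length xs = length ys" using assms by (simp add: weight_lists_def)
    show "xs ! i = ys ! i" if "i < length xs" for i
      using c[of i] 0 that assms(1) by (simp add: weight_lists_def)
  qed
qed

lemma lspace_orthogonal:
  assumes "xs \<in> weight_lists" "ys \<in> weight_lists" "xs \<noteq> ys" "x \<in> lspace xs" "y \<in> lspace ys"
  shows "inner x y = 0"
proof -
  obtain i where "i \<in> {1..l}" "ldiff xs i \<noteq> ldiff ys i" using weight_lists_eqI assms by blast
  then show ?thesis using wspace_orthogonal[OF assms(4,5)] by simp
qed

lemma lspace_rev_weight_lists: "xs \<in> weight_lists \<Longrightarrow> rev xs \<in> weight_lists"
  by (simp add: weight_lists_def)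

text \<open>The part of a vector that comes from words of other weights lies again in
  \<open>lspace xs\<close>, to which all such words are orthogonal; so it is orthogonal to
  itself.\<close>

lemma lspace_eq_span:
  assumes "xs \<in> weight_lists"
  shows "lspace xs = span (word ` {w \<in> words. wlist w = xs})" (is "_ = span ?S")
proof
  show "span ?S \<subseteq> lspace xs"
    using word_lspace by (intro span_minimal subspace_wspace) auto
  show "lspace xs \<subseteq> span ?S"
  proof
    fix b assume b: "b \<in> lspace xs"
    let ?T = "word ` {w \<in> words. wlist w \<noteq> xs}"
    have "word ` words = ?S \<union> ?T" by auto
    then have "b \<in> span (?S \<union> ?T)" using b by (simp add: wspace_def U_def)
    then obtain s t where st: "b = s + t" "s \<in> span ?S" "t \<in> span ?T"
      unfolding span_Un by auto
    have "t = b - s" using st by simp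
    then have t: "t \<in> lspace xs"
      using b st(2) \<open>span ?S \<subseteq> lspace xs\<close> by (auto intro: subspace_diff subspace_wspace)
    have "inner t y = 0" if "y \<in> span ?T" for y
      using that
    proof (induction rule: span_induct_alt)
      case (step c y z)
      then show ?case using lspace_orthogonal[OF assms wlist_weight_lists _ t word_lspace]
        by (auto simp: inner_add_right)
    qed simp
    then have "t = 0" using st(3) by (metis inner_eq_zero_iff)
    then show "b \<in> span ?S" using st by simp
  qed
qed

definition wbasis :: "int list \<Rightarrow> 'a set" where
  "wbasis xs = (SOME B. finite B \<and> (\<forall>b\<in>B. \<forall>c\<in>B. inner b c = (if b = c then 1 else 0)) \<and> span B = lspace xs)"

lemma wbasis:
  "finite (wbasis xs)" "span (wbasis xs) = lspace xs"
  "\<lbrakk>b \<in> wbasis xs; c \<in> wbasis xs\<rbrakk> \<Longrightarrow> inner b c = (if b = c then 1 else 0)"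
proof -
  obtain C where C: "finite C" "V \<subseteq> span C" using V_finite by auto
  obtain S where S: "S \<subseteq> lspace xs" "independent S" "lspace xs \<subseteq> span S" using basis_exists[of "lspace xs"] by metis
  have "S \<subseteq> span C" using S C U_V by (auto simp: wspace_def)
  then have "finite S" using independent_span_bound[OF C(1) S(2)] by simp
  moreover have "span S = lspace xs" using S by (simp add: span_minimal subspace_wspace subset_antisym)
  ultimately have "\<exists>B. finite B \<and> (\<forall>b\<in>B. \<forall>c\<in>B. inner b c = (if b = c then 1 else 0)) \<and> span B = lspace xs"
    using orthonormal_basis_exists[of S] by simp
  from someI_ex[OF this] show "finite (wbasis xs)" "span (wbasis xs) = lspace xs"
    "\<lbrakk>b \<in> wbasis xs; c \<in> wbasis xs\<rbrakk> \<Longrightarrow> inner b c = (if b = c then 1 else 0)"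
    unfolding wbasis_def[symmetric] by blast+
qed

lemma wbasis_lspace: "b \<in> wbasis xs \<Longrightarrow> b \<in> lspace xs"
  using wbasis(2) span_base by blast

lemma card_wbasis: "card (wbasis xs) = dim (lspace xs)"
proof -
  have "independent (wbasis xs)" by (rule orthonormal_independent) (rule wbasis(3))
  then have "dim (span (wbasis xs)) = card (wbasis xs)" by (rule dim_span_eq_card_independent)
  then show ?thesis by (simp add: wbasis(2))
qed

definition WB :: "'a set" where "WB = (\<Union>xs\<in>weight_lists. wbasis xs)"

lemma wbasis_disjoint:
  assumes "xs \<in> weight_lists" "ys \<in> weight_lists" "b \<in> wbasis xs" "b \<in> wbasis ys"
  shows "xs = ys"
proof (rule ccontr)
  assume "xs \<noteq> ys"
  then have "inner b b = 0" using assms by (intro lspace_orthogonal[of xs ys] wbasis_lspace)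
  then show False using wbasis(3)[OF assms(3,3)] by simp
qed

lemma WB_orthonormal: "\<lbrakk>b \<in> WB; c \<in> WB\<rbrakk> \<Longrightarrow> inner b c = (if b = c then 1 else 0)"
proof -
  assume "b \<in> WB" "c \<in> WB"
  then obtain xs ys where *: "xs \<in> weight_lists" "b \<in> wbasis xs" "ys \<in> weight_lists" "c \<in> wbasis ys"
    by (auto simp: WB_def)
  show ?thesis
  proof (cases "xs = ys")
    case True
    then show ?thesis using * wbasis(3) by auto
  next
    case False
    then have "inner b c = 0" using * by (intro lspace_orthogonal[of xs ys] wbasis_lspace)
    then show ?thesis using wbasis_disjoint[of xs ys b] * False by auto
  qed
qed

lemma WB_U: "WB \<subseteq> U"
  using wbasis_lspace by (auto simp: WB_def wspace_def)

lemma finite_WB: "finite WB"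
proof -
  obtain C where C: "finite C" "V \<subseteq> span C" using V_finite by auto
  have "independent WB" by (rule orthonormal_independent) (rule WB_orthonormal)
  moreover have "WB \<subseteq> span C" using WB_U U_V C by auto
  ultimately show ?thesis using independent_span_bound[OF C(1)] by blast
qed

lemma span_WB: "span WB = U"
proof
  show "span WB \<subseteq> U" using WB_U subspace_U by (rule span_minimal)
  have "word w \<in> span WB" if "w \<in> words" for w
  proof -
    have "word w \<in> span (wbasis (wlist w))" using word_lspace[OF that] by (simp add: wbasis(2))
    moreover have "wbasis (wlist w) \<subseteq> WB" using wlist_weight_lists[OF that] by (auto simp: WB_def)
    ultimately show ?thesis using span_mono by blast
  qed
  then show "U \<subseteq> span WB" unfolding U_def by (intro span_minimal) auto
qed

definition wt :: "'a \<Rightarrow> int list" where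
  "wt b = (THE xs. xs \<in> weight_lists \<and> b \<in> wbasis xs)"

lemma wt_eq: "\<lbrakk>xs \<in> weight_lists; b \<in> wbasis xs\<rbrakk> \<Longrightarrow> wt b = xs"
  unfolding wt_def using wbasis_disjoint by blast

lemma WB_wt: "b \<in> WB \<Longrightarrow> wt b \<in> weight_lists \<and> b \<in> wbasis (wt b)"
  using wt_eq by (auto simp: WB_def)

lemma K_WB:
  assumes "b \<in> WB" "i \<in> {1..l}"
  shows "K i b = q powr (real_of_int (ldiff (wt b) i) / 2) *\<^sub>R b"
  using wbasis_lspace[of b "wt b"] WB_wt[OF assms(1)] assms(2) by (auto simp: wspace_def)

definition kappa :: "'a \<Rightarrow> real" where
  "kappa b = q powr (real_of_int (rho_pair (ldiff (wt b))))"

lemma sum_over_WB: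
  "(\<Sum>b\<in>WB. f (wt b)) = (\<Sum>xs\<in>wt ` WB. real (dim (lspace xs)) * f xs)"
proof -
  have "(\<Sum>b\<in>{b \<in> WB. wt b = xs}. f (wt b)) = real (dim (lspace xs)) * f xs" if "xs \<in> wt ` WB" for xs
  proof -
    have "{b \<in> WB. wt b = xs} = wbasis xs" using that WB_wt wt_eq by (auto simp: WB_def)
    then have "card {b \<in> WB. wt b = xs} = dim (lspace xs)" by (simp only: card_wbasis)
    moreover have "(\<Sum>b\<in>{b \<in> WB. wt b = xs}. f (wt b)) = (\<Sum>b\<in>{b \<in> WB. wt b = xs}. f xs)"
      by (rule sum.cong) auto
    ultimately show ?thesis by simp
  qed
  note level = this
  have "(\<Sum>xs\<in>wt ` WB. real (dim (lspace xs)) * f xs) = (\<Sum>xs\<in>wt ` WB. \<Sum>b\<in>{b \<in> WB. wt b = xs}. f (wt b))"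
    by (intro sum.cong refl level[symmetric])
  also have "\<dots> = (\<Sum>b\<in>WB. f (wt b))" by (rule sum.image_gen[OF finite_WB, symmetric])
  finally show ?thesis ..
qed

lemma rev_wt_WB:
  assumes "xs \<in> wt ` WB" shows "rev xs \<in> wt ` WB"
proof -
  obtain b where b: "b \<in> WB" "xs = wt b" using assms by auto
  have xs: "xs \<in> weight_lists" "b \<in> wbasis xs" using WB_wt b by auto
  have "card (wbasis xs) \<noteq> 0" using xs wbasis(1) by auto
  then have "card (wbasis (rev xs)) \<noteq> 0"
    using dim_lspace_rev[of xs] xs by (simp add: card_wbasis weight_lists_def)
  then obtain c where c: "c \<in> wbasis (rev xs)" by fastforce
  have r: "rev xs \<in> weight_lists" using xs lspace_rev_weight_lists by blast
  then have "c \<in> WB" "wt c = rev xs" using c wt_eq by (auto simp: WB_def)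
  then show ?thesis by force
qed

text \<open>Reversal permutes the occurring weights, preserves their multiplicities and inverts
  \<open>kappa\<close>.\<close>

lemma sum_kappa_inverse: "(\<Sum>b\<in>WB. kappa b) = (\<Sum>b\<in>WB. 1 / kappa b)"
proof -
  let ?f = "\<lambda>xs. q powr (real_of_int (rho_pair (ldiff xs)))"
  have len: "length xs = Suc l" if "xs \<in> wt ` WB" for xs
    using that WB_wt by (auto simp: weight_lists_def)
  have "(\<Sum>b\<in>WB. kappa b) = (\<Sum>xs\<in>wt ` WB. real (dim (lspace xs)) * ?f xs)"
    unfolding kappa_def by (rule sum_over_WB)
  also have "\<dots> = (\<Sum>xs\<in>wt ` WB. real (dim (lspace xs)) * ?f (rev xs))"
  proof (rule sum.reindex_bij_witness[of _ rev rev])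
    show "real (dim (lspace (rev xs))) * ?f (rev (rev xs)) = real (dim (lspace xs)) * ?f xs"
      if "xs \<in> wt ` WB" for xs
      using dim_lspace_rev[OF len[OF that]] by (simp only: rev_rev_ident)
  qed (simp_all only: rev_rev_ident rev_wt_WB)
  also have "\<dots> = (\<Sum>xs\<in>wt ` WB. real (dim (lspace xs)) * (1 / ?f xs))"
    using rho_pair_rev len q by (intro sum.cong) (auto simp: powr_minus_divide)
  also have "\<dots> = (\<Sum>b\<in>WB. 1 / kappa b)"
    unfolding kappa_def by (rule sum_over_WB[symmetric])
  finally show ?thesis .
qed

lemma kappa_pos: "0 < kappa b" using q by (simp add: kappa_def)

text \<open>The mean of \<open>kappa\<close> and its inverse is at least 1, and both have the same
  sum. The bound makes the powers of D^2 + 1 summable wherever the zeta terms are.\<close>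

lemma card_WB_le: "real (card WB) \<le> (\<Sum>b\<in>WB. kappa b)"
proof -
  have "2 \<le> kappa b + 1 / kappa b" for b
  proof -
    have "0 \<le> (kappa b - 1)\<^sup>2 / kappa b" using kappa_pos[of b] by simp
    also have "(k - 1)\<^sup>2 / k = k + 1 / k - 2" if "0 < k" for k :: real
      using that by (simp add: power2_eq_square divide_simps) (simp add: algebra_simps)
    note this[OF kappa_pos]
    finally show ?thesis by simp
  qed
  then have "(\<Sum>b\<in>WB. 2) \<le> (\<Sum>b\<in>WB. kappa b + 1 / kappa b)" by (intro sum_mono)
  also have "\<dots> = 2 * (\<Sum>b\<in>WB. kappa b)" using sum_kappa_inverse by (simp add: sum.distrib)
  finally show ?thesis by simp
qed

definition level_words :: "nat \<Rightarrow> nat list set" where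
  "level_words p = {w. set w \<subseteq> {1..l} \<and> length w = p}"

definition level_dim :: "nat \<Rightarrow> nat" where
  "level_dim p = dim (word ` level_words p)"

definition hw_rho :: int where "hw_rho = rho_pair (\<lambda>j. int (n j))"

text \<open>The number of letters of any word of this weight; the halving is exact for weights of
  \<open>WB\<close>.\<close>

definition height :: "'a \<Rightarrow> nat" where
  "height b = nat ((hw_rho - rho_pair (ldiff (wt b))) div 2)"

text \<open>All words of one weight have the same length, because the weight fixes the pairing with
  2 rho and each letter costs 2.\<close>

lemma rho_pair_wt:
  assumes "b \<in> WB"
  shows "rho_pair (ldiff (wt b)) = hw_rho - 2 * int (height b)"
    and "b \<in> span (word ` level_words (height b))"
proof -
  have b: "wt b \<in> weight_lists" "b \<in> wbasis (wt b)" using WB_wt[OF assms] by auto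
  then have sp: "b \<in> span (word ` {w \<in> words. wlist w = wt b})"
    using wbasis_lspace lspace_eq_span by blast
  have "b \<noteq> 0" using wbasis(3)[OF b(2,2)] by auto
  have "{w \<in> words. wlist w = wt b} \<noteq> {}"
  proof
    assume "{w \<in> words. wlist w = wt b} = {}"
    then have "b \<in> span {}" using sp by (simp only: image_empty)
    then show False using \<open>b \<noteq> 0\<close> by simp
  qed
  then obtain w where w: "w \<in> words" "wlist w = wt b" by blast
  have *: "int (length u) * 2 = hw_rho - rho_pair (ldiff (wt b))" if "u \<in> words" "wlist u = wt b" for u
    using rho_pair_wlist[OF that(1)] that(2) by (simp add: hw_rho_def)
  have h: "height b = length u" if "u \<in> words" "wlist u = wt b" for u
    unfolding height_def using *[OF that] by (simp flip: *[OF that])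
  show "rho_pair (ldiff (wt b)) = hw_rho - 2 * int (height b)"
    using h[OF w] *[OF w] by simp
  have "{w \<in> words. wlist w = wt b} \<subseteq> level_words (height b)"
    using h[symmetric] unfolding level_words_def lists_eq_set by blast
  then show "b \<in> span (word ` level_words (height b))"
    by (rule subsetD[OF span_mono[OF image_mono] sp])
qed

text \<open>The weight spaces of height p are spanned by words of length p and contain all of them,
  so both sets span the same space.\<close>

lemma card_height: "card {b \<in> WB. height b = p} = level_dim p"
proof -
  let ?B = "{b \<in> WB. height b = p}"
  have "span ?B = span (word ` level_words p)" unfolding span_eq
  proof
    show "?B \<subseteq> span (word ` level_words p)" using rho_pair_wt(2) by auto
    show "word ` level_words p \<subseteq> span ?B"
    proof
      fix x assume "x \<in> word ` level_words p"
      then obtain w where w: "w \<in> words" "length w = p" "x = word w" by (auto simp: level_words_def)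
      have wl: "wlist w \<in> weight_lists" using wlist_weight_lists w by simp
      have "wbasis (wlist w) \<subseteq> ?B"
      proof
        fix b assume b: "b \<in> wbasis (wlist w)"
        then have "b \<in> WB" "wt b = wlist w" using wl wt_eq by (auto simp: WB_def)
        then show "b \<in> ?B" using rho_pair_wlist[OF w(1)] rho_pair_wt(1)[of b] w(2) by (simp add: hw_rho_def)
      qed
      moreover have "x \<in> span (wbasis (wlist w))" using word_lspace[OF w(1)] w(3) by (simp add: wbasis(2))
      ultimately show "x \<in> span ?B" using span_mono by blast
    qed
  qed
  then have "level_dim p = dim ?B" unfolding level_dim_def by (rule span_eq_dim[symmetric])
  also have "\<dots> = card ?B"
    by (intro dim_eq_card_independent orthonormal_independent) (auto simp: WB_orthonormal)
  finally show ?thesis ..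
qed

text \<open>By \<open>sum_kappa_inverse\<close> the prefactor acts on \<open>1 / kappa b\<close> and
  turns it into q^(2 height). The finite sum is written as a series over all p so that modules of
  different dimension become comparable.\<close>

lemma trace_sums: "(\<lambda>p. real (level_dim p) * q ^ (2 * p)) sums (q powr (real_of_int hw_rho) * (\<Sum>b\<in>WB. kappa b))"
proof -
  have "(\<lambda>p. \<Sum>b\<in>WB. if p = height b then q ^ (2 * p) else 0) sums (\<Sum>b\<in>WB. q ^ (2 * height b))"
    by (intro sums_sum) (rule sums_single)
  moreover have "(\<Sum>b\<in>WB. if p = height b then q ^ (2 * p) else 0) = real (level_dim p) * q ^ (2 * p)" for p
  proof -
    have "(\<Sum>b\<in>WB. if p = height b then q ^ (2 * p) else 0) = (\<Sum>b\<in>{b\<in>WB. height b = p}. q ^ (2 * p))"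
      unfolding sum.inter_filter[OF finite_WB] by (intro sum.cong) auto
    then show ?thesis by (simp add: card_height)
  qed
  moreover have "(\<Sum>b\<in>WB. q ^ (2 * height b)) = q powr (real_of_int hw_rho) * (\<Sum>b\<in>WB. kappa b)"
  proof -
    have "q ^ (2 * height b) = q powr (real_of_int hw_rho) * (1 / kappa b)" if "b \<in> WB" for b
    proof -
      have "q powr (real_of_int hw_rho) * (1 / kappa b) = q powr (real_of_int hw_rho - (real_of_int hw_rho - 2 * real (height b)))"
        using q rho_pair_wt(1)[OF that] by (simp add: kappa_def powr_diff)
      also have "\<dots> = q powr (real (2 * height b))" by simp
      also have "\<dots> = q ^ (2 * height b)" using q by (simp only: powr_realpow)
      finally show ?thesis ..
    qed
    then show ?thesis by (simp add: sum_kappa_inverse sum_distrib_left)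
  qed
  ultimately show ?thesis by simp
qed

lemma level_dim_0: "level_dim 0 = 1"
proof -
  have "word ` level_words 0 = {v}" by (auto simp: level_words_def)
  moreover have "independent {v}" using v_norm independent_empty by (intro independent_insertI) auto
  ultimately show ?thesis unfolding level_dim_def by (simp add: dim_eq_card_independent)
qed

definition F_end :: "nat \<Rightarrow> 'a lin_end" where
  "F_end i = Lin_End (F i)"

lemma end_app_F_end: "i \<in> {1..l} \<Longrightarrow> end_app (F_end i) = F i"
  unfolding F_end_def using linear_F by (subst Lin_End_inverse) auto

lemma serre_generators_F_end: "serre_generators q l F_end"
proof
  show "0 < q" by (rule q)
  show "F_end i * F_end j = F_end j * F_end i" if "i \<in> {1..l}" "j \<in> {1..l}" "\<bar>int i - int j\<bar> > 1" for i j
    using that F_far by (simp add: end_app_inject[symmetric] times_lin_end.rep_eq end_app_F_end)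
  show "q_serre q (F_end i) (F_end j)" if "i \<in> {1..l}" "j \<in> {1..l}" "\<bar>int i - int j\<bar> = 1" for i j
    unfolding q_serre_def using that F_serre[OF that]
    by (simp add: end_app_inject[symmetric] times_lin_end.rep_eq plus_lin_end.rep_eq minus_lin_end.rep_eq
        scaleR_lin_end.rep_eq zero_lin_end.rep_eq end_app_F_end mult.assoc)
qed

lemma end_app_prod_list: "w \<in> words \<Longrightarrow> end_app (prod_list (map F_end w)) v = word w"
  by (induction w) (auto simp: one_lin_end.rep_eq times_lin_end.rep_eq end_app_F_end)

text \<open>The exponent is l (l + 1) / 2, the number of positive roots. The ordered monomials are
  evaluated at \<open>v\<close>, and their number does not depend on the highest weight.\<close>

lemma level_dim_le: "level_dim p \<le> (p + 1) ^ (\<Sum>{..l})"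
proof -
  interpret serre_generators q l F_end by (rule serre_generators_F_end)
  have rb: "length (root_block L r j) = length L + j" for L r j
    by (induction j) auto
  have len: "length (pbw_list r) = \<Sum>{..r}" for r
    by (induction r) (simp_all add: rb del: root_block.simps)
  let ?M = "ordered_monomials (pbw_list l) p" and ?ev = "\<lambda>f :: 'a lin_end. end_app f v"
  have ev: "linear ?ev"
    by (rule linearI) (simp_all add: plus_lin_end.rep_eq scaleR_lin_end.rep_eq)
  have "word w \<in> span (?ev ` ?M)" if "w \<in> level_words p" for w
  proof -
    have w: "set w \<subseteq> {1..l}" "length w = p" "w \<in> words" using that by (auto simp: level_words_def)
    have "?ev (prod_list (map F_end w)) \<in> ?ev ` span ?M"
      using word_in_span_pbw[OF w(1)] w(2) by (intro imageI) simp
    then show ?thesis using end_app_prod_list[OF w(3)] linear_span_image[OF ev] by simp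
  qed
  then have "level_dim p \<le> card (?ev ` ?M)"
    unfolding level_dim_def using finite_ordered_monomials by (intro dim_le_card) auto
  also have "\<dots> \<le> card ?M" by (rule card_image_le[OF finite_ordered_monomials])
  also have "\<dots> \<le> (p + 1) ^ length (pbw_list l)" by (rule card_ordered_monomials)
  finally show ?thesis by (simp add: len)
qed

end

section \<open>Perturbed geometric series\<close>

lemma perturbed_geometric_summable:
  fixes g :: "nat \<Rightarrow> real"
  assumes "g \<longlonglongrightarrow> G" "0 < r" "r < 1"
  shows "summable (\<lambda>m. g m * r ^ m)"
proof -
  obtain K where K: "\<And>m. \<bar>g m\<bar> \<le> K"
    using convergent_imp_Bseq[of g] assms(1) unfolding convergent_def Bseq_def by auto
  have "norm (g m * r ^ m) \<le> K * r ^ m" for m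
  proof -
    have "\<bar>g m\<bar> * r ^ m \<le> K * r ^ m"
      using assms(2) by (intro mult_right_mono K) simp
    then show ?thesis using assms(2) by (simp add: abs_mult)
  qed
  moreover have "summable (\<lambda>m. K * r ^ m)"
    using assms by (intro summable_mult summable_geometric) auto
  ultimately show ?thesis using summable_comparison_test'[of "\<lambda>m. K * r ^ m" 0 "\<lambda>m. g m * r ^ m"] by blast
qed

lemma perturbed_geometric_not_summable:
  fixes g :: "nat \<Rightarrow> real"
  assumes "g \<longlonglongrightarrow> G" "0 < G" "1 \<le> r"
  shows "\<not> summable (\<lambda>m. g m * r ^ m)"
proof
  assume "summable (\<lambda>m. g m * r ^ m)"
  then have "(\<lambda>m. g m * r ^ m) \<longlonglongrightarrow> 0" by (rule summable_LIMSEQ_zero)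
  moreover have "\<forall>\<^sub>F m in sequentially. G / 2 < g m"
    using assms by (intro order_tendstoD) auto
  then have "\<forall>\<^sub>F m in sequentially. G / 2 \<le> g m * r ^ m"
  proof eventually_elim
    case (elim m)
    then have "g m * 1 \<le> g m * r ^ m" using assms by (intro mult_left_mono) auto
    then show ?case using elim by simp
  qed
  ultimately have "G / 2 \<le> 0" by (intro tendsto_lowerbound) auto
  then show False using assms by simp
qed

text \<open>An Abel theorem: the weights (1 - r) r^m have total mass one and escape to infinity as r
  tends to 1, so the averages of \<open>g\<close> tend to its joint limit. The limits at fixed m
  keep the initial terms bounded.\<close>

lemma perturbed_geometric_abel:
  fixes g :: "real \<Rightarrow> nat \<Rightarrow> real" and r :: "real \<Rightarrow> real"
  assumes joint: "((\<lambda>(s, m). g s m) \<longlongrightarrow> G) (F \<times>\<^sub>F sequentially)"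
    and single: "\<And>m. ((\<lambda>s. g s m) \<longlongrightarrow> h m) F"
    and summable: "\<forall>\<^sub>F s in F. summable (\<lambda>m. g s m * r s ^ m)"
    and r: "\<forall>\<^sub>F s in F. 0 < r s \<and> r s < 1" "(r \<longlongrightarrow> 1) F"
  shows "((\<lambda>s. (1 - r s) * (\<Sum>m. g s m * r s ^ m)) \<longlongrightarrow> G) F"
  unfolding tendsto_iff
proof (intro allI impI)
  fix e :: real assume e: "0 < e"
  have "\<forall>\<^sub>F (s, m) in F \<times>\<^sub>F sequentially. dist (g s m) G < e / 2"
    using tendstoD[OF joint, of "e / 2"] e by (simp add: case_prod_unfold)
  then obtain P Q where P: "eventually P F" and Q: "eventually Q sequentially"
    and PQ: "\<And>s m. P s \<Longrightarrow> Q m \<Longrightarrow> dist (g s m) G < e / 2"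
    unfolding eventually_prod_filter by auto
  obtain M where M: "\<And>m. M \<le> m \<Longrightarrow> Q m" using Q unfolding eventually_sequentially by auto
  \<comment> \<open>The initial segment is bounded near the limit and multiplied by 1 - r, which
    tends to 0.\<close>
  have "((\<lambda>s. (1 - r s) * (\<Sum>m<M. \<bar>g s m - G\<bar>)) \<longlongrightarrow> (1 - 1) * (\<Sum>m<M. \<bar>h m - G\<bar>)) F"
    by (intro tendsto_intros r single)
  then have "\<forall>\<^sub>F s in F. (1 - r s) * (\<Sum>m<M. \<bar>g s m - G\<bar>) < e / 2"
    using e by (intro order_tendstoD) auto
  then show "\<forall>\<^sub>F s in F. dist ((1 - r s) * (\<Sum>m. g s m * r s ^ m)) G < e"
    using P r(1) summable
  proof eventually_elim
    case (elim s)
    let ?r = "r s" and ?u = "\<lambda>m. (g s m - G) * r s ^ m"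
    have r01: "0 < ?r" "?r < 1" using elim by auto
    have geo: "summable (\<lambda>m. ?r ^ m)" "(\<Sum>m. ?r ^ m) = 1 / (1 - ?r)"
      using r01 by (auto intro: summable_geometric suminf_geometric)
    have su: "summable ?u"
      using summable_diff[OF elim(4) summable_mult[OF geo(1), of G]] by (simp add: algebra_simps)
    have "(1 - ?r) * (\<Sum>m. g s m * ?r ^ m) = (1 - ?r) * (\<Sum>m. ?u m + G * ?r ^ m)"
      by (simp add: algebra_simps)
    also have "\<dots> = (1 - ?r) * (\<Sum>m. ?u m) + G"
      using suminf_add[OF su summable_mult[OF geo(1), of G]] r01
      by (simp add: suminf_mult geo field_simps flip: suminf_add)
    finally have 1: "(1 - ?r) * (\<Sum>m. g s m * ?r ^ m) - G = (1 - ?r) * (\<Sum>m. ?u m)" by simp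
    \<comment> \<open>Beyond \<open>M\<close> the deviation is at most e / 2, and the factor 1 - r
      cancels the sum of the geometric series.\<close>
    have tail: "\<bar>?u (m + M)\<bar> \<le> e / 2 * ?r ^ m" for m
    proof -
      have "\<bar>g s (m + M) - G\<bar> \<le> e / 2" using PQ[OF elim(2) M, of "m + M"] by (simp add: dist_real_def)
      moreover have "?r ^ (m + M) \<le> ?r ^ m" using r01 by (simp add: power_decreasing)
      ultimately have "\<bar>g s (m + M) - G\<bar> * ?r ^ (m + M) \<le> e / 2 * ?r ^ m"
        using r01 by (intro mult_mono') auto
      then show ?thesis using r01 by (simp add: abs_mult)
    qed
    have sue: "summable (\<lambda>m. e / 2 * ?r ^ m)" by (intro summable_mult geo)
    have abs_tail: "summable (\<lambda>m. \<bar>?u (m + M)\<bar>)"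
      by (rule summable_comparison_test'[OF sue, of 0]) (use tail in simp)
    have "\<bar>\<Sum>m. ?u (m + M)\<bar> \<le> (\<Sum>m. \<bar>?u (m + M)\<bar>)" by (rule summable_rabs[OF abs_tail])
    also have "\<dots> \<le> (\<Sum>m. e / 2 * ?r ^ m)" by (rule suminf_le[OF tail abs_tail sue])
    also have "\<dots> = e / 2 / (1 - ?r)" using suminf_mult[OF geo(1), of "e / 2"] geo(2) by simp
    finally have 2: "(1 - ?r) * \<bar>\<Sum>m. ?u (m + M)\<bar> \<le> e / 2" using r01 by (simp add: field_simps)
    have "\<bar>\<Sum>m<M. ?u m\<bar> \<le> (\<Sum>m<M. \<bar>?u m\<bar>)" by (rule sum_abs)
    also have "\<dots> \<le> (\<Sum>m<M. \<bar>g s m - G\<bar>)"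
      using r01 by (intro sum_mono) (auto simp: abs_mult power_le_one intro!: mult_left_le)
    finally have "(1 - ?r) * \<bar>\<Sum>m<M. ?u m\<bar> \<le> (1 - ?r) * (\<Sum>m<M. \<bar>g s m - G\<bar>)"
      using r01 by (intro mult_left_mono) auto
    then have 3: "(1 - ?r) * \<bar>\<Sum>m<M. ?u m\<bar> < e / 2" using elim(1) by simp
    have "\<bar>(1 - ?r) * (\<Sum>m. ?u m)\<bar> = (1 - ?r) * \<bar>(\<Sum>m. ?u (m + M)) + (\<Sum>m<M. ?u m)\<bar>"
      using suminf_split_initial_segment[OF su, of M] r01 by (simp add: abs_mult)
    also have "\<dots> \<le> (1 - ?r) * (\<bar>\<Sum>m. ?u (m + M)\<bar> + \<bar>\<Sum>m<M. ?u m\<bar>)"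
      using r01 by (intro mult_left_mono abs_triangle_ineq) auto
    also have "\<dots> < e" using 2 3 by (simp add: distrib_left)
    finally show ?case by (simp add: dist_real_def 1)
  qed
qed

text \<open>\<open>A m q\<^bsup>-d m\<^esup>\<close> is the trace of \<open>K\<^sub>2\<^sub>\<rho>\<close> on the \<open>m\<close>-th summand and \<open>B m q\<^bsup>-2 m\<^esup>\<close> the eigenvalue of
  \<open>D\<^sup>2 + 1\<close> there.\<close>

locale zeta_series =
  fixes q d C M :: real and A B :: "nat \<Rightarrow> real"
  assumes q: "0 < q" "q < 1" and d: "0 < d" and C: "0 < C" and M: "0 < M"
    and B_pos: "\<And>m. 0 < B m" and A_lim: "A \<longlonglongrightarrow> C" and B_lim: "B \<longlonglongrightarrow> M"
begin

text \<open>The trace on the m-th summand times the eigenvalue of D^2 + 1 to the power -s/2, with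
  the factors q^(-d m) and q^(s m) collected into one.\<close>

definition zterm :: "real \<Rightarrow> nat \<Rightarrow> real" where
  "zterm s m = A m * B m powr (- s / 2) * (q powr (s - d)) ^ m"

lemma coefficient_lim: "(\<lambda>m. A m * B m powr (- s / 2)) \<longlonglongrightarrow> C * M powr (- s / 2)"
  using M by (intro tendsto_intros A_lim B_lim) auto

lemma powr_less_1: "d < s \<Longrightarrow> q powr (s - d) < 1"
  using powr_less_mono'[of q 0 "s - d"] q by simp

lemma zterm_summable: "d < s \<Longrightarrow> summable (zterm s)"
  unfolding zterm_def
  using q by (intro perturbed_geometric_summable[OF coefficient_lim] powr_less_1) auto

lemma zterm_not_summable: "s \<le> d \<Longrightarrow> \<not> summable (zterm s)"
  unfolding zterm_def
  using q C M powr_mono'[of "s - d" 0 q]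
  by (intro perturbed_geometric_not_summable[OF coefficient_lim]) auto

lemma zeta_residue:
  "((\<lambda>s. (s - d) * (\<Sum>m. zterm s m)) \<longlongrightarrow> C * M powr (- d / 2) / - ln q) (at_right d)"
proof -
  let ?r = "\<lambda>s. q powr (s - d)"
  have id: "((\<lambda>s. s) \<longlongrightarrow> d) (at_right d)" by (rule tendsto_ident_at)
  have abel: "((\<lambda>s. (1 - ?r s) * (\<Sum>m. zterm s m)) \<longlongrightarrow> C * M powr (- d / 2)) (at_right d)"
    unfolding zterm_def
  proof (rule perturbed_geometric_abel)
    have 1: "((\<lambda>x. fst x) \<longlongrightarrow> d) (at_right d \<times>\<^sub>F sequentially)"
      by (rule filterlim_compose[OF id filterlim_fst])
    have 2: "((\<lambda>x. A (snd x)) \<longlongrightarrow> C) (at_right d \<times>\<^sub>F sequentially)"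
      by (rule filterlim_compose[OF A_lim filterlim_snd])
    have 3: "((\<lambda>x. B (snd x)) \<longlongrightarrow> M) (at_right d \<times>\<^sub>F sequentially)"
      by (rule filterlim_compose[OF B_lim filterlim_snd])
    show "((\<lambda>(s, m). A m * B m powr (- s / 2)) \<longlongrightarrow> C * M powr (- d / 2)) (at_right d \<times>\<^sub>F sequentially)"
      unfolding case_prod_unfold using M by (intro tendsto_intros 1 2 3) auto
    show "((\<lambda>s. A m * B m powr (- s / 2)) \<longlongrightarrow> A m * B m powr (- d / 2)) (at_right d)" for m
      using B_pos[of m] by (intro tendsto_intros id) auto
    show "\<forall>\<^sub>F s in at_right d. summable (\<lambda>m. A m * B m powr (- s / 2) * ?r s ^ m)"
      using zterm_summable unfolding zterm_def by (auto simp: eventually_at_right_field intro: exI[of _ "d + 1"])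
    show "\<forall>\<^sub>F s in at_right d. 0 < ?r s \<and> ?r s < 1"
      using powr_less_1 q by (auto simp: eventually_at_right_field intro: exI[of _ "d + 1"])
    have "((\<lambda>s. q powr (s - d)) \<longlongrightarrow> q powr (d - d)) (at_right d)"
      using q by (intro tendsto_intros id) auto
    then show "(?r \<longlongrightarrow> 1) (at_right d)" using q by simp
  qed
  \<comment> \<open>The inverted difference quotient of q^(s - d) at d trades the factor 1 - r of
    the Abel limit for s - d and produces the denominator - ln q.\<close>
  have "((\<lambda>s. q powr (s - d)) has_real_derivative ln q) (at d)"
    using q by (auto intro!: derivative_eq_intros)
  then have "((\<lambda>s. (q powr (s - d) - 1) / (s - d)) \<longlongrightarrow> ln q) (at d)"
    using q by (simp add: has_field_derivative_iff)
  then have "((\<lambda>s. (q powr (s - d) - 1) / (s - d)) \<longlongrightarrow> ln q) (at_right d)"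
    by (rule tendsto_mono[rotated]) (simp add: at_le)
  then have "((\<lambda>s. - inverse ((q powr (s - d) - 1) / (s - d))) \<longlongrightarrow> - inverse (ln q)) (at_right d)"
    using q by (intro tendsto_minus tendsto_inverse) auto
  then have "((\<lambda>s. - (s - d) / (q powr (s - d) - 1)) \<longlongrightarrow> - inverse (ln q)) (at_right d)"
    by (simp only: inverse_divide minus_divide_left)
  from tendsto_mult[OF this abel]
  have "((\<lambda>s. - (s - d) / (q powr (s - d) - 1) * ((1 - ?r s) * (\<Sum>m. zterm s m)))
      \<longlongrightarrow> C * M powr (- d / 2) / - ln q) (at_right d)"
    by (simp add: field_simps)
  then show ?thesis
  proof (rule Lim_transform_eventually)
    show "\<forall>\<^sub>F s in at_right d. - (s - d) / (q powr (s - d) - 1) * ((1 - ?r s) * (\<Sum>m. zterm s m))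
      = (s - d) * (\<Sum>m. zterm s m)"
      unfolding eventually_at_right_field
    proof (intro exI[of _ "d + 1"] conjI allI impI)
      fix s assume "d < s" "s < d + 1"
      then have "q powr (s - d) - 1 \<noteq> 0" using powr_less_1 by force
      then show "- (s - d) / (q powr (s - d) - 1) * ((1 - ?r s) * (\<Sum>m. zterm s m))
        = (s - d) * (\<Sum>m. zterm s m)"
        by (simp add: field_simps) (simp add: algebra_simps)?
    qed simp
  qed
qed

end

text \<open>Termwise differentiation followed by multiplication by the variable raises the degree of
  the polynomial factor by one. The shift from p to p + 1 costs a division by
  \<open>x\<close>.\<close>

lemma summable_power_geometric:
  fixes x :: real
  assumes "\<bar>x\<bar> < 1"
  shows "summable (\<lambda>p. real (p + 1) ^ k * x ^ p)"
proof -
  have "summable (\<lambda>p. real p ^ k * y ^ p)" if "\<bar>y\<bar> < 1" for y :: real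
    using that
  proof (induction k arbitrary: y)
    case 0
    then show ?case by (simp add: summable_geometric)
  next
    case (Suc k)
    have "summable (\<lambda>p. diffs (\<lambda>p. real p ^ k) p * y ^ p)"
      by (rule termdiff_converges[of y 1]) (use Suc in auto)
    then have "summable (\<lambda>p. y * (diffs (\<lambda>p. real p ^ k) p * y ^ p))" by (rule summable_mult)
    moreover have "y * (diffs (\<lambda>p. real p ^ k) p * y ^ p) = real (Suc p) ^ Suc k * y ^ Suc p" for p
      by (simp add: diffs_def)
    ultimately have "summable (\<lambda>p. real (Suc p) ^ Suc k * y ^ Suc p)" by simp
    then show ?case by (subst (asm) summable_Suc_iff)
  qed
  from this[OF assms] have s: "summable (\<lambda>p. real (Suc p) ^ k * x ^ Suc p)"
    by (subst summable_Suc_iff)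
  show ?thesis
  proof (cases "x = 0")
    case True
    have "(\<lambda>p. real (p + 1) ^ k * x ^ p) = (\<lambda>p. if p = 0 then 1 else 0)"
      using True by auto
    then show ?thesis using sums_single[of 0 "\<lambda>_. 1 :: real"] by (simp add: sums_iff)
  next
    case False
    have "summable (\<lambda>p. (1 / x) * (real (Suc p) ^ k * x ^ Suc p))" by (rule summable_mult[OF s])
    then show ?thesis using False by simp
  qed
qed

section \<open>Sequences of modules with highest weights affine in m\<close>

context hw_module
begin

lemma linear_foldr_F: "set z \<subseteq> {1..l} \<Longrightarrow> linear (\<lambda>x. foldr F z x)"
proof (induction z)
  case (Cons i z)
  then show ?case using linear_compose[of "\<lambda>x. foldr F z x" "F i"] linear_F[of i] by (simp add: o_def)
qed (simp add: linear_id linear_ident)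

lemma word_weight_diff:
  "i \<in> {1..l} \<Longrightarrow> word_weight w i - word_weight w (i + 1) = int (n i)
    + (int (count_list w (i - 1)) + int (count_list w (i + 1)) - 2 * int (count_list w i))"
  by (simp add: word_weight_def hw_weight_def sum.atLeast_Suc_atMost)

lemma inner_F_left: "\<lbrakk>i \<in> {1..l}; x \<in> V; y \<in> V\<rbrakk> \<Longrightarrow> inner (F i x) y = inner x (E i y)"
  using E_adj[of i y x] by (simp add: inner_commute)

end

locale hw_family =
  fixes q :: real and l :: nat and V :: "nat \<Rightarrow> 'a::real_inner set"
    and K E F :: "nat \<Rightarrow> nat \<Rightarrow> 'a \<Rightarrow> 'a" and n :: "nat \<Rightarrow> nat \<Rightarrow> nat" and v :: "nat \<Rightarrow> 'a"
    and a b :: "nat \<Rightarrow> nat"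
  assumes hw_mod: "hw_module q l (V m) (K m) (E m) (F m) (n m) (v m)"
    and weights: "i \<in> {1..l} \<Longrightarrow> n m i = m * a i + b i"
begin

sublocale M: hw_module q l "V m" "K m" "E m" "F m" "n m" "v m" for m
  by (rule hw_mod)

lemma laurent_fun_qint:
  assumes "i \<in> {1..l}"
  shows "laurent_fun q (\<lambda>m. qint q (real_of_int (M.word_weight m w i - M.word_weight m w (i + 1))))"
proof -
  define c where "c = real (b i) + (real (count_list w (i - 1)) + real (count_list w (i + 1)) - 2 * real (count_list w i))"
  have h: "real_of_int (M.word_weight m w i - M.word_weight m w (i + 1)) = c + real_of_int (int (a i)) * real m" for m
    unfolding M.word_weight_diff[OF assms] weights[OF assms] by (simp add: c_def)
  have h': "- (c + real_of_int (int (a i)) * real m) = - c + real_of_int (- int (a i)) * real m" for m by simp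
  have "laurent_fun q (\<lambda>m. (1 / (q - 1 / q)) * (q powr (c + real_of_int (int (a i)) * real m)
      - q powr (- c + real_of_int (- int (a i)) * real m)))"
    by (intro laurent_fun_cmult laurent_fun_diff laurent_fun_powr M.q)
  then show ?thesis unfolding qint_def h h' by (simp add: field_simps)
qed

text \<open>The leftmost letter of \<open>u\<close> goes to the other side as \<open>E i\<close>,
  which is commuted through \<open>w\<close> until it reaches \<open>v\<close> and vanishes. The
  only coefficients that arise are quantum integers of weights affine in m.\<close>

lemma laurent_fun_words:
  assumes "u \<in> lists {1..l}" "w \<in> lists {1..l}"
  shows "laurent_fun q (\<lambda>m. inner (M.word m u) (M.word m w))"
  using assms
proof (induction u arbitrary: w)
  case Nil
  show ?case
  proof (cases w)
    case Nil
    then show ?thesis using M.v_norm by (simp add: laurent_fun_const dot_square_norm)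
  next
    case (Cons i w')
    then have i: "i \<in> {1..l}" "w' \<in> lists {1..l}" using \<open>w \<in> lists {1..l}\<close> by auto
    have "inner (M.word m []) (M.word m w) = 0" for m
      using M.E_adj[OF i(1) M.v_V M.word_V[OF i(2)], of m] M.E_v[OF i(1)] Cons by simp
    then show ?thesis by (simp add: laurent_fun_const)
  qed
next
  case (Cons i u)
  then have i: "i \<in> {1..l}" and u: "u \<in> lists {1..l}" by auto
  have IH: "laurent_fun q (\<lambda>m. inner (M.word m u) (M.word m w'))" if "w' \<in> lists {1..l}" for w'
    using Cons.IH[of w'] u that by simp
  \<comment> \<open>Generalised over the prefix \<open>z\<close> of letters that \<open>E i\<close>
    has already passed.\<close>
  have "laurent_fun q (\<lambda>m. inner (M.word m u) (foldr (F m) z (E m i (M.word m w))))" if "z \<in> lists {1..l}" for z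
    using \<open>w \<in> lists {1..l}\<close> that
  proof (induction w arbitrary: z)
    case Nil
    have "foldr (F m) z (E m i (v m)) = 0" for m
      using linear_0[OF M.linear_foldr_F[of z m]] Nil M.E_v[OF i] by (simp add: lists_eq_set)
    then show ?case by (simp add: laurent_fun_const)
  next
    case (Cons j w)
    then have j: "j \<in> {1..l}" and w: "w \<in> lists {1..l}" by auto
    let ?c = "\<lambda>m. if i = j then qint q (real_of_int (M.word_weight m w i - M.word_weight m w (i + 1))) else 0"
    have "foldr (F m) z (E m i (M.word m (j # w)))
      = foldr (F m) (z @ [j]) (E m i (M.word m w)) + ?c m *\<^sub>R M.word m (z @ w)" for m
    proof -
      have lin: "linear (\<lambda>x. foldr (F m) z x)" using Cons.prems by (intro M.linear_foldr_F) (simp add: lists_eq_set)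
      have "E m i (M.word m (j # w)) = F m j (E m i (M.word m w)) + ?c m *\<^sub>R M.word m w"
        by (simp only: M.E_word_Cons[OF i j w]) simp
      then show ?thesis using linear_add[OF lin] linear_scale[OF lin] by (simp add: M.word_def)
    qed
    moreover have "laurent_fun q (\<lambda>m. inner (M.word m u) (foldr (F m) (z @ [j]) (E m i (M.word m w)))
        + ?c m * inner (M.word m u) (M.word m (z @ w)))"
    proof (intro laurent_fun_add laurent_fun_mult)
      show "laurent_fun q ?c" using laurent_fun_qint[OF i] laurent_fun_const by (cases "i = j") auto
      show "laurent_fun q (\<lambda>m. inner (M.word m u) (foldr (F m) (z @ [j]) (E m i (M.word m w))))"
        using Cons.prems j by (intro Cons.IH w) auto
      show "laurent_fun q (\<lambda>m. inner (M.word m u) (M.word m (z @ w)))"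
        using Cons.prems w by (intro IH[of "z @ w"]) auto
    qed
    ultimately show ?case by (simp add: inner_add_right)
  qed
  from this[of "[]"] have "laurent_fun q (\<lambda>m. inner (M.word m u) (E m i (M.word m w)))" by simp
  moreover have "inner (M.word m (i # u)) (M.word m w) = inner (M.word m u) (E m i (M.word m w))" for m
    using M.inner_F_left[OF i M.word_V[OF u] M.word_V[OF \<open>w \<in> lists {1..l}\<close>]] by simp
  ultimately show ?case by simp
qed

lemma level_dim_eventually_constant: "\<exists>d. \<forall>\<^sub>F m in sequentially. M.level_dim m p = d"
proof -
  have "finite (M.level_words p)"
    unfolding M.level_words_def by (rule finite_lists_length_eq) simp
  then obtain ws where ws: "set ws = M.level_words p" using finite_list by blast
  have "\<exists>d. \<forall>\<^sub>F m in sequentially. dim ((\<lambda>x. x m) ` set (map (\<lambda>w m. M.word m w) ws)) = d"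
  proof (rule dim_eventually_constant[OF M.q])
    fix x y assume "x \<in> set (map (\<lambda>w m. M.word m w) ws)" "y \<in> set (map (\<lambda>w m. M.word m w) ws)"
    then show "laurent_fun q (\<lambda>m. inner (x m) (y m))"
      using ws by (auto intro!: laurent_fun_words simp: M.level_words_def lists_eq_set)
  qed
  moreover have "(\<lambda>x. x m) ` set (map (\<lambda>w m. M.word m w) ws) = M.word m ` M.level_words p" for m
    using ws by (auto simp: image_image)
  ultimately show ?thesis by (simp add: M.level_dim_def)
qed

lemma trace_limit:
  "\<exists>L\<ge>1. (\<lambda>m. q powr (real_of_int (M.hw_rho m)) * (\<Sum>x\<in>M.WB m. M.kappa m x)) \<longlonglongrightarrow> L"
proof -
  define t where "t p m = real (M.level_dim m p) * q ^ (2 * p)" for p m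
  have "\<exists>d. (\<lambda>m. real (M.level_dim m p)) \<longlonglongrightarrow> d" for p
  proof -
    obtain d where "\<forall>\<^sub>F m in sequentially. M.level_dim m p = d" using level_dim_eventually_constant by blast
    then have "(\<lambda>m. real (M.level_dim m p)) \<longlonglongrightarrow> real d"
      by (intro tendsto_eventually) (auto elim: eventually_mono)
    then show ?thesis ..
  qed
  then obtain d where d: "\<And>p. (\<lambda>m. real (M.level_dim m p)) \<longlonglongrightarrow> d p" by metis
  define N where "N = \<Sum>{..l}"
  have bound: "norm (t p m) \<le> real (p + 1) ^ N * (q\<^sup>2) ^ p" for p m
  proof -
    have "real (M.level_dim m p) \<le> real ((p + 1) ^ N)"
      unfolding N_def by (intro of_nat_mono M.level_dim_le)
    then show ?thesis using M.q by (simp add: t_def power_mult mult_right_mono)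
  qed
  have sm: "summable (\<lambda>p. real (p + 1) ^ N * (q\<^sup>2) ^ p)"
    using M.q by (intro summable_power_geometric) (simp add: power_less_one_iff)
  have "((\<lambda>m. suminf (\<lambda>p. t p m)) \<longlongrightarrow> suminf (\<lambda>p. d p * q ^ (2 * p))) sequentially"
  proof (rule conjunct2[OF conjunct2[OF tannerys_theorem[where a = t]]])
    show "(\<lambda>m. t p m) \<longlonglongrightarrow> d p * q ^ (2 * p)" for p
      unfolding t_def by (intro tendsto_mult_right d)
    show "\<forall>\<^sub>F (p, m) in sequentially \<times>\<^sub>F sequentially. norm (t p m) \<le> real (p + 1) ^ N * (q\<^sup>2) ^ p"
      using bound by (intro always_eventually) auto
  qed (rule sm trivial_limit_sequentially)+
  moreover have s: "(\<lambda>p. t p m) sums (q powr (real_of_int (M.hw_rho m)) * (\<Sum>x\<in>M.WB m. M.kappa m x))" for m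
    unfolding t_def by (rule M.trace_sums)
  ultimately have lim: "(\<lambda>m. q powr (real_of_int (M.hw_rho m)) * (\<Sum>x\<in>M.WB m. M.kappa m x))
      \<longlonglongrightarrow> suminf (\<lambda>p. d p * q ^ (2 * p))"
    by (simp add: sums_iff)
  have "1 \<le> q powr (real_of_int (M.hw_rho m)) * (\<Sum>x\<in>M.WB m. M.kappa m x)" for m
  proof -
    have "(\<Sum>p\<in>{0}. t p m) \<le> suminf (\<lambda>p. t p m)"
      using s[of m] M.q by (intro sum_le_suminf) (auto simp: sums_iff t_def)
    then show ?thesis using s[of m] by (simp add: sums_iff t_def M.level_dim_0)
  qed
  then show ?thesis using lim LIMSEQ_le_const[OF lim] by blast
qed

end

section \<open>Irreducible representations\<close>

lemma clinear_into_scaleR: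
  "\<lbrakk>clinear_into V W f; x \<in> V\<rbrakk> \<Longrightarrow> f (r *\<^sub>R x) = r *\<^sub>R f x"
  unfolding clinear_into_def by (metis scaleC_of_real)

text \<open>The eigenvalue of K_2rho on a joint eigenvector of the K_j with eigenvalues
  \<open>\<theta> j\<close>.\<close>

definition rho_scalar :: "nat \<Rightarrow> (nat \<Rightarrow> real) \<Rightarrow> real" where
  "rho_scalar l \<theta> = (prod_list (map (\<lambda>j. \<theta> j ^ (j * (l - j + 1))) [1..<Suc l]))\<^sup>2"

lemma uq_gens_memb [simp]:
  "Kg i \<in> uq_gens l \<longleftrightarrow> i \<in> {1..l}" "Kinvg i \<in> uq_gens l \<longleftrightarrow> i \<in> {1..l}"
  "Eg i \<in> uq_gens l \<longleftrightarrow> i \<in> {1..l}" "Fg i \<in> uq_gens l \<longleftrightarrow> i \<in> {1..l}"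
  by (auto simp: uq_gens_def)

context
  fixes q :: real and l :: nat and W :: "'h::complex_hilbert set" and a :: "uq_gen \<Rightarrow> 'h \<Rightarrow> 'h"
  assumes rep: "uq_star_rep q l W a"
begin

lemma rep_csubspace: "csubspace W"
  using rep by (simp add: uq_star_rep_def)

lemma rep_clinear: "g \<in> uq_gens l \<Longrightarrow> clinear_into W W (a g)"
  using rep by (simp add: uq_star_rep_def)

lemma rep_into: "\<lbrakk>g \<in> uq_gens l; x \<in> W\<rbrakk> \<Longrightarrow> a g x \<in> W"
  using rep_clinear by (simp add: clinear_into_def)

lemma rep_add: "\<lbrakk>g \<in> uq_gens l; x \<in> W; y \<in> W\<rbrakk> \<Longrightarrow> a g (x + y) = a g x + a g y"
  using rep_clinear by (simp add: clinear_into_def)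

lemma rep_scaleR: "\<lbrakk>g \<in> uq_gens l; x \<in> W\<rbrakk> \<Longrightarrow> a g (r *\<^sub>R x) = r *\<^sub>R a g x"
  using rep_clinear clinear_into_scaleR by blast

lemma rep_scaleC: "\<lbrakk>g \<in> uq_gens l; x \<in> W\<rbrakk> \<Longrightarrow> a g (c *\<^sub>C x) = c *\<^sub>C a g x"
  using rep_clinear by (simp add: clinear_into_def)

lemma rep_K_adj: "\<lbrakk>i \<in> {1..l}; x \<in> W; y \<in> W\<rbrakk> \<Longrightarrow> cinner (a (Kg i) x) y = cinner x (a (Kg i) y)"
  using rep unfolding uq_star_rep_def by blast

lemma rep_E_adj: "\<lbrakk>i \<in> {1..l}; x \<in> W; y \<in> W\<rbrakk> \<Longrightarrow> cinner (a (Eg i) x) y = cinner x (a (Fg i) y)"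
  using rep unfolding uq_star_rep_def by blast

lemma rep_F_adj: "\<lbrakk>i \<in> {1..l}; x \<in> W; y \<in> W\<rbrakk> \<Longrightarrow> cinner (a (Fg i) x) y = cinner x (a (Eg i) y)"
  using rep_E_adj[of i y x] by (metis cinner_commute)

lemma rep_Kinv: "\<lbrakk>i \<in> {1..l}; x \<in> W\<rbrakk> \<Longrightarrow> a (Kinvg i) (a (Kg i) x) = x"
  using rep unfolding uq_star_rep_def by blast

lemma rep_Kinv_eigen:
  assumes "i \<in> {1..l}" "x \<in> W" "a (Kg i) x = t *\<^sub>R x" "t \<noteq> 0"
  shows "a (Kinvg i) x = (1 / t) *\<^sub>R x"
proof -
  have "t *\<^sub>R a (Kinvg i) x = x"
    using rep_Kinv[OF assms(1,2)] assms rep_scaleR[of "Kinvg i" x t] by simp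
  then have "(1 / t) *\<^sub>R (t *\<^sub>R a (Kinvg i) x) = (1 / t) *\<^sub>R x" by simp
  then show ?thesis using assms(4) by simp
qed

lemma rep_K_E:
  assumes "i \<in> {1..l}" "j \<in> {1..l}" "x \<in> W" "0 < q"
  shows "a (Kg i) (a (Eg j) x) = q powr (cartan i j / 2) *\<^sub>R a (Eg j) (a (Kg i) x)"
proof -
  have "a (Kg i) (a (Eg j) (a (Kinvg i) (a (Kg i) x)))
    = (if i = j then q else if \<bar>int i - int j\<bar> = 1 then q powr (- 1 / 2) else 1) *\<^sub>R a (Eg j) (a (Kg i) x)"
  proof -
    have "\<forall>i\<in>{1..l}. \<forall>j\<in>{1..l}. \<forall>x\<in>W. a (Kg i) (a (Eg j) (a (Kinvg i) x))
      = (if i = j then q else if \<bar>int i - int j\<bar> = 1 then q powr (- 1 / 2) else 1) *\<^sub>R a (Eg j) x"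
      using rep unfolding uq_star_rep_def by blast
    moreover have "a (Kg i) x \<in> W" using assms by (intro rep_into) auto
    ultimately show ?thesis using assms(1,2) by blast
  qed
  then show ?thesis using assms by (simp add: rep_Kinv cartan_def)
qed

text \<open>The relations of the \<open>Fg j\<close> with the \<open>Kg i\<close>, and of the
  \<open>Fg j\<close> among themselves, are not among the defining ones. They follow from those of
  the \<open>Eg j\<close> by taking adjoints, and this lemma makes inner products with
  \<open>W\<close> decide equality.\<close>

lemma rep_eqI:
  assumes "x \<in> W" "y \<in> W" "\<And>z. z \<in> W \<Longrightarrow> cinner z x = cinner z y"
  shows "x = y"
proof -
  have "x - y \<in> W" using assms rep_csubspace by (auto intro: subspace_diff csubspace_subspace)
  then have "cinner (x - y) (x - y) = 0" using assms(3) by (simp add: cinner_diff_right)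
  then show ?thesis by (simp add: cinner_self)
qed

lemma rep_K_F:
  assumes i: "i \<in> {1..l}" and j: "j \<in> {1..l}" and x: "x \<in> W" and q: "0 < q"
  shows "a (Kg i) (a (Fg j) x) = q powr (- cartan i j / 2) *\<^sub>R a (Fg j) (a (Kg i) x)"
proof -
  let ?s = "q powr (cartan i j / 2)"
  have "a (Fg j) (a (Kg i) x) = ?s *\<^sub>R a (Kg i) (a (Fg j) x)"
  proof (rule rep_eqI)
    fix z assume z: "z \<in> W"
    have "cinner z (a (Fg j) (a (Kg i) x)) = cinner (a (Kg i) (a (Eg j) z)) x"
      using i j x z by (simp add: rep_E_adj[symmetric] rep_K_adj rep_into)
    also have "\<dots> = ?s * cinner (a (Eg j) (a (Kg i) z)) x"
      using rep_K_E[OF i j z q] by (simp add: cinner_scaleR_left)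
    also have "cinner (a (Eg j) (a (Kg i) z)) x = cinner z (a (Kg i) (a (Fg j) x))"
      using i j x z by (simp add: rep_E_adj rep_K_adj rep_into)
    finally show "cinner z (a (Fg j) (a (Kg i) x)) = cinner z (?s *\<^sub>R a (Kg i) (a (Fg j) x))"
      by (simp add: cinner_scaleR_right)
  next
    show "a (Fg j) (a (Kg i) x) \<in> W" using i j x by (simp add: rep_into)
    show "?s *\<^sub>R a (Kg i) (a (Fg j) x) \<in> W"
      using i j x rep_csubspace by (simp add: rep_into subspace_scale csubspace_subspace)
  qed
  then show ?thesis using q by (simp flip: powr_add)
qed

lemma rep_E_F:
  assumes "i \<in> {1..l}" "j \<in> {1..l}" "i \<noteq> j" "x \<in> W"
  shows "a (Eg i) (a (Fg j) x) = a (Fg j) (a (Eg i) x)"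
proof -
  have "a (Eg i) (a (Fg j) x) - a (Fg j) (a (Eg i) x) = 0"
    using rep assms unfolding uq_star_rep_def by metis
  then show ?thesis by simp
qed

lemma rep_E_F_same:
  assumes i: "i \<in> {1..l}" and x: "x \<in> W" and q: "0 < q" and K: "a (Kg i) x = q powr (h / 2) *\<^sub>R x"
  shows "a (Eg i) (a (Fg i) x) - a (Fg i) (a (Eg i) x) = qint q h *\<^sub>R x"
proof -
  let ?t = "q powr (h / 2)"
  have t: "?t \<noteq> 0" using q by simp
  have "a (Kg i) (a (Kg i) x) = q powr h *\<^sub>R x"
    using i x by (simp add: K rep_scaleR flip: powr_add)
  moreover have "a (Kinvg i) (a (Kinvg i) x) = q powr (- h) *\<^sub>R x"
    using i x rep_Kinv_eigen[OF i x K t]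
    by (simp add: rep_scaleR powr_minus_divide flip: powr_add)
  moreover have "a (Eg i) (a (Fg i) x) - a (Fg i) (a (Eg i) x)
    = (1 / (q - 1 / q)) *\<^sub>R (a (Kg i) (a (Kg i) x) - a (Kinvg i) (a (Kinvg i) x))"
    using rep i x unfolding uq_star_rep_def by presburger
  ultimately show ?thesis by (simp add: qint_def scaleR_left_diff_distrib[symmetric])
qed

lemma rep_F_far:
  assumes i: "i \<in> {1..l}" and j: "j \<in> {1..l}" and ij: "\<bar>int i - int j\<bar> > 1" and x: "x \<in> W"
  shows "a (Fg i) (a (Fg j) x) = a (Fg j) (a (Fg i) x)"
proof (rule rep_eqI)
  fix z assume z: "z \<in> W"
  have "a (Eg j) (a (Eg i) z) = a (Eg i) (a (Eg j) z)"
    using rep i j ij z unfolding uq_star_rep_def by metis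
  then show "cinner z (a (Fg i) (a (Fg j) x)) = cinner z (a (Fg j) (a (Fg i) x))"
    using i j x z by (simp add: rep_E_adj[symmetric] rep_into)
qed (use i j x in \<open>simp_all add: rep_into\<close>)

lemma rep_F_serre:
  assumes i: "i \<in> {1..l}" and j: "j \<in> {1..l}" and ij: "\<bar>int i - int j\<bar> = 1" and x: "x \<in> W"
  shows "a (Fg i) (a (Fg i) (a (Fg j) x)) - (q + 1 / q) *\<^sub>R a (Fg i) (a (Fg j) (a (Fg i) x))
    + a (Fg j) (a (Fg i) (a (Fg i) x)) = 0" (is "?L = 0")
proof (rule rep_eqI)
  have sub: "subspace W" using rep_csubspace by (rule csubspace_subspace)
  show "?L \<in> W" "0 \<in> W" using i j x sub
    by (auto intro!: subspace_add subspace_diff subspace_scale rep_into simp: subspace_0)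
  fix z assume z: "z \<in> W"
  have e: "a (Eg i) (a (Eg i) (a (Eg j) z)) - (q + 1 / q) *\<^sub>R a (Eg i) (a (Eg j) (a (Eg i) z))
      + a (Eg j) (a (Eg i) (a (Eg i) z)) = 0"
    using rep i j ij z unfolding uq_star_rep_def by blast
  have "cinner z ?L = cinner (a (Eg j) (a (Eg i) (a (Eg i) z))) x
      - (q + 1 / q) * cinner (a (Eg i) (a (Eg j) (a (Eg i) z))) x + cinner (a (Eg i) (a (Eg i) (a (Eg j) z))) x"
    using i j x z by (simp add: cinner_add_right cinner_diff_right cinner_scaleR_right rep_E_adj rep_into)
  also have "\<dots> = cinner (a (Eg i) (a (Eg i) (a (Eg j) z)) - (q + 1 / q) *\<^sub>R a (Eg i) (a (Eg j) (a (Eg i) z))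
      + a (Eg j) (a (Eg i) (a (Eg i) z))) x"
    by (simp add: cinner_add_left cinner_diff_left cinner_scaleR_left)
  also have "\<dots> = 0" unfolding e by simp
  finally show "cinner z ?L = cinner z 0" by simp
qed

lemma rep_K_power_cinner:
  assumes "j \<in> {1..l}" "x \<in> W" "y \<in> W" "a (Kg j) x = t *\<^sub>R x"
  shows "(a (Kg j) ^^ k) y \<in> W \<and> cinner x ((a (Kg j) ^^ k) y) = t ^ k * cinner x y"
proof (induction k)
  case (Suc k)
  then show ?case using rep_K_adj[OF assms(1,2), of "(a (Kg j) ^^ k) y"] assms
    by (auto simp: rep_into cinner_scaleR_left mult.assoc)
qed (simp add: assms)

text \<open>The eigenvector stands on the left and \<open>y\<close> is arbitrary. In this form the
  identity is a closed condition on points of the graph, so it survives the closure in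
  \<open>K2rho_op\<close>.\<close>

lemma K2rho_act_cinner:
  assumes "x \<in> W" "y \<in> W" "\<And>j. j \<in> {1..l} \<Longrightarrow> a (Kg j) x = \<theta> j *\<^sub>R x"
  shows "cinner x (K2rho_act l a y) = rho_scalar l \<theta> * cinner x y"
proof -
  define G where "G js = foldr (\<lambda>j f. (a (Kg j) ^^ (j * (l - j + 1))) \<circ> f) js id" for js
  define c where "c js = prod_list (map (\<lambda>j. \<theta> j ^ (j * (l - j + 1))) js)" for js
  have G: "G js y \<in> W \<and> cinner x (G js y) = c js * cinner x y" if "set js \<subseteq> {1..l}" "y \<in> W" for js y
    using that
  proof (induction js)
    case (Cons j js)
    then show ?case using rep_K_power_cinner[of j x "G js y" "\<theta> j"] assms by (simp add: G_def c_def mult.assoc)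
  qed (simp add: G_def c_def)
  have s: "set [1..<Suc l] \<subseteq> {1..l}" by auto
  have "cinner x (G [1..<Suc l] (G [1..<Suc l] y)) = (c [1..<Suc l])\<^sup>2 * cinner x y"
    using G[OF s] assms(2) by (simp add: power2_eq_square del: upt_Suc)
  then show ?thesis by (simp add: K2rho_act_def rho_scalar_def G_def c_def numeral_2_eq_2 del: upt_Suc)
qed

end

text \<open>The square in K_2rho cancels the halves in the exponents of the eigenvalues of the
  K_j.\<close>

lemma (in hw_module) rho_scalar_powr:
  "rho_scalar l (\<lambda>j. q powr (real_of_int (\<mu> j) / 2)) = q powr (real_of_int (rho_pair \<mu>))"
proof -
  have "prod_list (map (\<lambda>j. (q powr (real_of_int (\<mu> j) / 2)) ^ (j * (l - j + 1))) [1..<Suc l])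
    = (\<Prod>j=1..l. (q powr (real_of_int (\<mu> j) / 2)) ^ (j * (l - j + 1)))"
    using prod.distinct_set_conv_list[of "[1..<Suc l]" "\<lambda>j. (q powr (real_of_int (\<mu> j) / 2)) ^ (j * (l - j + 1))"]
    by (simp add: atLeastLessThanSuc_atLeastAtMost del: upt_Suc)
  also have "\<dots> = (\<Prod>j=1..l. q powr (real_of_int (rho_coeff j * \<mu> j) / 2))"
  proof (rule prod.cong)
    fix j assume j: "j \<in> {1..l}"
    then have "real (j * (l - j + 1)) = real_of_int (rho_coeff j)"
      by (simp add: rho_coeff_def of_nat_diff) (simp add: algebra_simps)
    then show "(q powr (real_of_int (\<mu> j) / 2)) ^ (j * (l - j + 1)) = q powr (real_of_int (rho_coeff j * \<mu> j) / 2)"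
      using q by (simp add: powr_powr mult.commute flip: powr_realpow del: of_nat_mult)
  qed simp
  also have "\<dots> = q powr (\<Sum>j=1..l. real_of_int (rho_coeff j * \<mu> j) / 2)"
    using q by (simp add: powr_sum)
  also have "\<dots> = q powr (real_of_int (rho_pair \<mu>) / 2)"
    by (simp add: rho_pair_def sum_divide_distrib)
  finally show ?thesis unfolding rho_scalar_def by (simp add: power2_eq_square flip: powr_add)
qed

section \<open>Real forms of irreducible representations\<close>

locale irrep_module = hw_module q l V K E F n v
  for q l and V :: "'h::complex_hilbert set" and K E F n v +
  fixes a :: "uq_gen \<Rightarrow> 'h \<Rightarrow> 'h"
  assumes irrep: "uq_irrep q l n V a"
    and K_eq: "\<lbrakk>i \<in> {1..l}; x \<in> V\<rbrakk> \<Longrightarrow> K i x = a (Kg i) x"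
    and E_eq: "\<lbrakk>i \<in> {1..l}; x \<in> V\<rbrakk> \<Longrightarrow> E i x = a (Eg i) x"
    and F_eq: "\<lbrakk>i \<in> {1..l}; x \<in> V\<rbrakk> \<Longrightarrow> F i x = a (Fg i) x"
begin

lemma star_rep: "uq_star_rep q l V a"
  using irrep by (simp add: uq_irrep_def)

text \<open>By this lemma the real span \<open>U\<close> of the words is a real form of \<open>V\<close>, and an orthonormal basis of \<open>U\<close> is one
  of \<open>V\<close> over the complex numbers.\<close>

lemma cinner_U_real:
  assumes "x \<in> U" "y \<in> U"
  shows "cinner x y = of_real (inner x y)"
proof -
  have im: "Im (cinner x y) = 0" if "\<And>z. z \<in> S \<Longrightarrow> Im (cinner x z) = 0" "y \<in> span S" for S x y
    using that(2) by (induction rule: span_induct_alt)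
      (auto simp: cinner_add_right cinner_scaleR_right that(1))
  \<comment> \<open>The letters of \<open>u\<close> move to the right as raising operators, under
    which \<open>U\<close> is stable, until only \<open>v\<close> remains on the left. There every
    non-empty word is orthogonal to \<open>v\<close>.\<close>
  have words: "Im (cinner (word u) y) = 0" if "u \<in> words" "y \<in> U" for u y
    using that
  proof (induction u arbitrary: y)
    case Nil
    have "Im (cinner v z) = 0" if z: "z \<in> word ` words" for z
    proof -
      obtain w where w: "w \<in> words" "z = word w" using z by blast
      show ?thesis
      proof (cases w)
        case Nil
        then show ?thesis using w by (simp add: cinner_self)
      next
        case (Cons i w')
        then have i: "i \<in> {1..l}" "w' \<in> words" using w by auto
        have "cinner v (F i (word w')) = cinner (E i v) (word w')"
          using rep_E_adj[OF star_rep i(1) v_V word_V[OF i(2)]] E_eq[OF i(1) v_V] F_eq[OF i(1) word_V[OF i(2)]]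
          by simp
        then show ?thesis using E_v[OF i(1)] w Cons by simp
      qed
    qed
    then have "Im (cinner v y) = 0" using Nil.prems(1) unfolding U_def by (rule im)
    then show ?case by simp
  next
    case (Cons i u)
    then have i: "i \<in> {1..l}" "u \<in> words" by auto
    have yU: "y \<in> U" by (rule Cons.prems)
    then have y: "y \<in> V" using U_V by auto
    have "cinner (F i (word u)) y = cinner (word u) (E i y)"
      using rep_F_adj[OF star_rep i(1) word_V[OF i(2)] y] F_eq[OF i(1) word_V[OF i(2)]] E_eq[OF i(1) y] by simp
    then show ?case using Cons.IH[OF E_U[OF i(1) yU]] by simp
  qed
  have "Im (cinner y x) = 0"
  proof (rule im)
    show "x \<in> span (word ` words)" using assms(1) by (simp add: U_def)
    fix z assume "z \<in> word ` words"
    then have "Im (cinner z y) = 0" using words assms(2) by auto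
    then show "Im (cinner y z) = 0" by (subst cinner_commute) simp
  qed
  then have "Im (cinner x y) = 0" by (subst cinner_commute) simp
  then show ?thesis by (simp add: complex_eq_iff inner_eq_Re_cinner)
qed

lemma orthonormal_WB: "orthonormal WB"
  unfolding orthonormal_def using WB_orthonormal WB_U cinner_U_real by (metis of_real_0 of_real_1 subsetD)

lemma U_csubspace_hull: "U \<subseteq> csubspace hull WB"
proof -
  have "span WB \<subseteq> csubspace hull WB"
    by (rule span_minimal) (auto simp: hull_inc csubspace_subspace csubspace_hull_csubspace)
  then show ?thesis by (simp add: span_WB)
qed

lemma csubspace_V: "csubspace V"
  using rep_csubspace[OF star_rep] .

lemma a_K_WB: "\<lbrakk>b \<in> WB; i \<in> {1..l}\<rbrakk> \<Longrightarrow> a (Kg i) b = q powr (real_of_int (ldiff (wt b) i) / 2) *\<^sub>R b"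
  using K_WB K_eq WB_U U_V by (metis subsetD)

text \<open>The complex span contains the real form \<open>U\<close>, is stable under all generators
  and is non-zero, so irreducibility makes it all of \<open>V\<close>.\<close>

lemma csubspace_hull_WB: "csubspace hull WB = V"
proof -
  let ?W = "csubspace hull WB"
  have W: "csubspace ?W" by (rule csubspace_hull_csubspace)
  have WV: "?W \<subseteq> V" using WB_U U_V by (intro csubspace_hull_minimal csubspace_V) auto
  have inv: "a g x \<in> ?W" if g: "g \<in> uq_gens l" and x: "x \<in> ?W" for g x
  proof -
    let ?S = "{x \<in> V. a g x \<in> ?W}"
    note lin = rep_add[OF star_rep g] rep_scaleR[OF star_rep g] rep_scaleC[OF star_rep g]
    have a0: "a g 0 = 0"
      using rep_scaleR[OF star_rep g, of 0 0] csubspace_subspace[OF csubspace_V] by (simp add: subspace_0)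
    have "csubspace ?S" unfolding csubspace_def[of ?S]
      using csubspace_V W a0
      by (auto intro!: subspaceI simp: lin subspace_0 subspace_add subspace_scale csubspace_subspace csubspace_scaleC)
    moreover have "WB \<subseteq> ?S"
    proof
      fix b assume b: "b \<in> WB"
      have bU: "b \<in> U" "b \<in> V" using b WB_U U_V by auto
      obtain i where i: "i \<in> {1..l}" "g = Kg i \<or> g = Kinvg i \<or> g = Eg i \<or> g = Fg i"
        using g by (auto simp: uq_gens_def)
      have "a (Kg i) b \<in> U" using a_K_WB[OF b i(1)] bU subspace_U by (simp add: subspace_scale)
      moreover have "a (Kinvg i) b \<in> U"
        using rep_Kinv_eigen[OF star_rep i(1) bU(2) a_K_WB[OF b i(1)]] bU subspace_U q
        by (simp add: subspace_scale)
      moreover have "a (Eg i) b \<in> U" "a (Fg i) b \<in> U"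
        using E_U[OF i(1) bU(1)] F_U[OF i(1) bU(1)] E_eq[OF i(1) bU(2)] F_eq[OF i(1) bU(2)] by auto
      ultimately have "a g b \<in> U" using i(2) by auto
      then show "b \<in> ?S" using U_csubspace_hull bU by auto
    qed
    ultimately show ?thesis using csubspace_hull_minimal[of WB ?S] x by auto
  qed
  have "v \<in> ?W" using word_U[of "[]"] U_csubspace_hull by auto
  moreover have "v \<noteq> 0" using v_norm by force
  ultimately have "?W \<noteq> {0}" by blast
  moreover have "\<forall>U. csubspace U \<and> U \<subseteq> V \<and> (\<forall>g\<in>uq_gens l. \<forall>x\<in>U. a g x \<in> U) \<longrightarrow> U = {0} \<or> U = V"
    using irrep unfolding uq_irrep_def by blast
  ultimately show ?thesis using W WV inv by blast
qed

end

text \<open>The given operators are linear on \<open>V\<close> only; they are precomposed with a linear projection onto \<open>V\<close>.\<close>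

lemma irrep_module_exists:
  assumes "uq_irrep q l n V a" "0 < q" "q < 1"
  shows "\<exists>K E F v. irrep_module q l V K E F n v a"
proof -
  have rep: "uq_star_rep q l V a" using assms(1) by (simp add: uq_irrep_def)
  have sub: "subspace V" using rep_csubspace[OF rep] by (rule csubspace_subspace)
  obtain v0 where v0: "v0 \<in> V" "v0 \<noteq> 0"
    "\<And>j. j \<in> {1..l} \<Longrightarrow> a (Eg j) v0 = 0 \<and> a (Kg j) v0 = (q powr (real (n j) / 2)) *\<^sub>R v0"
    using assms(1) unfolding uq_irrep_def by blast
  define v where "v = (1 / norm v0) *\<^sub>R v0"
  have vV: "v \<in> V" using v0(1) sub by (simp add: v_def subspace_scale)
  obtain P where P: "P ` UNIV \<subseteq> V" "linear P" "\<And>x. x \<in> V \<Longrightarrow> P x = x"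
    using linear_exists_left_inverse_on[OF linear_id sub] by auto
  have PV: "P x \<in> V" for x using P(1) by auto
  define A where "A g x = a g (P x)" for g x
  have A: "A g x = a g x" if "x \<in> V" for g x using P(3)[OF that] by (simp add: A_def)
  have AV: "A g x \<in> V" if "g \<in> uq_gens l" for g x using rep_into[OF rep that PV] by (simp add: A_def)
  have lin: "linear (A g)" if "g \<in> uq_gens l" for g
    unfolding A_def using linear_add[OF P(2)] linear_scale[OF P(2)] PV rep_add[OF rep that] rep_scaleR[OF rep that]
    by (intro linearI) auto
  note into = rep_into[OF rep]
  have "hw_module q l V (\<lambda>i. A (Kg i)) (\<lambda>i. A (Eg i)) (\<lambda>i. A (Fg i)) n v"
  proof (rule hw_module.intro)
    show "linear (A (Kg i))" "linear (A (Eg i))" "linear (A (Fg i))" if "i \<in> {1..l}" for i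
      using that by (auto intro: lin)
    show "A (Eg i) v = 0" "A (Kg i) v = q powr (real (n i) / 2) *\<^sub>R v" if "i \<in> {1..l}" for i
      using v0 that vV rep_scaleR[OF rep, of _ v0] by (auto simp: A v_def)
    show "A (Fg i) (A (Fg j) x) = A (Fg j) (A (Fg i) x)"
      if "i \<in> {1..l}" "j \<in> {1..l}" "\<bar>int i - int j\<bar> > 1" for i j x
      using rep_F_far[OF rep that PV[of x]] that into PV P(3) by (simp add: A_def)
    show "A (Fg i) (A (Fg i) (A (Fg j) x)) - (q + 1 / q) *\<^sub>R A (Fg i) (A (Fg j) (A (Fg i) x))
          + A (Fg j) (A (Fg i) (A (Fg i) x)) = 0"
      if "i \<in> {1..l}" "j \<in> {1..l}" "\<bar>int i - int j\<bar> = 1" for i j x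
      using rep_F_serre[OF rep that PV[of x]] that into PV P(3) by (simp add: A_def)
    show "A (Kg i) (A (Eg j) x) = q powr (cartan i j / 2) *\<^sub>R A (Eg j) (A (Kg i) x)"
      if "i \<in> {1..l}" "j \<in> {1..l}" "x \<in> V" for i j x
      using rep_K_E[OF rep that assms(2)] that into by (simp add: A)
    show "A (Kg i) (A (Fg j) x) = q powr (- cartan i j / 2) *\<^sub>R A (Fg j) (A (Kg i) x)"
      if "i \<in> {1..l}" "j \<in> {1..l}" "x \<in> V" for i j x
      using rep_K_F[OF rep that assms(2)] that into by (simp add: A)
    show "A (Eg i) (A (Fg j) x) = A (Fg j) (A (Eg i) x)"
      if "i \<in> {1..l}" "j \<in> {1..l}" "i \<noteq> j" "x \<in> V" for i j x
      using rep_E_F[OF rep that] that into by (simp add: A)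
    show "A (Kg i) x \<in> V" "A (Eg i) x \<in> V" "A (Fg i) x \<in> V" if "i \<in> {1..l}" "x \<in> V" for i x
      using AV that by auto
    show "A (Eg i) (A (Fg i) x) - A (Fg i) (A (Eg i) x) = qint q h *\<^sub>R x"
      if "i \<in> {1..l}" "x \<in> V" "A (Kg i) x = q powr (h / 2) *\<^sub>R x" for i x h
      using rep_E_F_same[OF rep that(1,2) assms(2), of h] that into by (simp add: A)
    show "inner (A (Eg i) x) y = inner x (A (Fg i) y)" "inner (A (Kg i) x) y = inner x (A (Kg i) y)"
      if "i \<in> {1..l}" "x \<in> V" "y \<in> V" for i x y
      using rep_E_adj[OF rep that] rep_K_adj[OF rep that] that by (auto simp: inner_eq_Re_cinner A)
    show "\<exists>C. finite C \<and> V \<subseteq> span C" using assms(1) by (simp add: uq_irrep_def)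
    show "norm v = 1" using v0(2) by (simp add: v_def)
  qed (rule assms sub vV)+
  moreover have "irrep_module_axioms q l V (\<lambda>i. A (Kg i)) (\<lambda>i. A (Eg i)) (\<lambda>i. A (Fg i)) n a"
    by (rule irrep_module_axioms.intro) (simp_all only: assms(1) A)
  ultimately have "irrep_module q l V (\<lambda>i. A (Kg i)) (\<lambda>i. A (Eg i)) (\<lambda>i. A (Fg i)) n v a"
    by (rule irrep_module.intro)
  then show ?thesis by blast
qed

text \<open>The interface to the analytic part: eigenbases, positive eigenvalues, the cardinality
  bound and the growth of the trace. The offset \<open>B\<close> of the highest weights shifts the
  pairing with 2 rho by a constant and so only rescales the limit.\<close>

lemma irrep_family_trace:
  fixes V :: "nat \<Rightarrow> 'h::complex_hilbert set"
  assumes q: "0 < q" "q < 1"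
    and irrep: "\<And>m. uq_irrep q l (n m) (V m) a"
    and n: "\<And>m i. i \<in> {1..l} \<Longrightarrow> n m i = m * A i + B i"
  obtains W \<kappa> C where
    "\<And>m. finite (W m)" "\<And>m. orthonormal (W m)" "\<And>m. csubspace hull (W m) = V m"
    "\<And>m b. 0 < \<kappa> m b"
    "\<And>m b. b \<in> W m \<Longrightarrow> \<exists>\<theta>. (\<forall>j\<in>{1..l}. a (Kg j) b = \<theta> j *\<^sub>R b) \<and> \<kappa> m b = rho_scalar l \<theta>"
    "\<And>m. real (card (W m)) \<le> (\<Sum>b\<in>W m. \<kappa> m b)"
    "0 < C"
    "(\<lambda>m. q powr (real m * (\<Sum>j=1..l. real j * (real l + 1 - real j) * real (A j))) * (\<Sum>b\<in>W m. \<kappa> m b)) \<longlonglongrightarrow> C"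
proof -
  have "\<forall>m. \<exists>K E F v. irrep_module q l (V m) K E F (n m) v a"
    using irrep_module_exists[OF irrep q] by blast
  then obtain K E F v where ex: "\<And>m. irrep_module q l (V m) (K m) (E m) (F m) (n m) (v m) a" by metis
  interpret I: irrep_module q l "V m" "K m" "E m" "F m" "n m" "v m" a for m by (rule ex)
  interpret hw_family q l V K E F n v A B
    by unfold_locales (use n in auto)
  obtain L where L: "1 \<le> L"
    "(\<lambda>m. q powr (real_of_int (I.hw_rho m)) * (\<Sum>x\<in>I.WB m. I.kappa m x)) \<longlonglongrightarrow> L"
    using trace_limit by blast
  define r where "r = (\<Sum>j=1..l. real j * (real l + 1 - real j) * real (B j))"
  define d where "d = (\<Sum>j=1..l. real j * (real l + 1 - real j) * real (A j))"
  have h: "real_of_int (I.hw_rho m) = real m * d + r" for m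
  proof -
    have "real_of_int (I.hw_rho m) = (\<Sum>j=1..l. real j * (real l + 1 - real j) * real (n m j))"
      by (simp add: I.hw_rho_def I.rho_pair_def I.rho_coeff_def)
    also have "\<dots> = (\<Sum>j=1..l. real m * (real j * (real l + 1 - real j) * real (A j)) + real j * (real l + 1 - real j) * real (B j))"
      by (rule sum.cong) (auto simp: n algebra_simps)
    finally show ?thesis by (simp add: sum.distrib sum_distrib_left d_def r_def)
  qed
  have "(\<lambda>m. q powr (- r) * (q powr (real_of_int (I.hw_rho m)) * (\<Sum>x\<in>I.WB m. I.kappa m x))) \<longlonglongrightarrow> q powr (- r) * L"
    by (intro tendsto_mult_left L)
  moreover have "q powr (- r) * (q powr (real_of_int (I.hw_rho m)) * (\<Sum>x\<in>I.WB m. I.kappa m x))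
    = q powr (real m * d) * (\<Sum>x\<in>I.WB m. I.kappa m x)" for m
    unfolding h by (simp flip: powr_add mult.assoc)
  ultimately have lim: "(\<lambda>m. q powr (real m * d) * (\<Sum>x\<in>I.WB m. I.kappa m x)) \<longlonglongrightarrow> q powr (- r) * L"
    by simp
  show ?thesis
  proof (rule that[of I.WB I.kappa "q powr (- r) * L"])
    show "\<exists>\<theta>. (\<forall>j\<in>{1..l}. a (Kg j) b = \<theta> j *\<^sub>R b) \<and> I.kappa m b = rho_scalar l \<theta>"
      if "b \<in> I.WB m" for m b
      using I.a_K_WB[OF that] unfolding I.kappa_def I.rho_scalar_powr[symmetric]
      by (intro exI[of _ "\<lambda>j. q powr (real_of_int (I.wt m b ! (j - 1) - I.wt m b ! j) / 2)"] conjI ballI refl)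
    show "0 < q powr (- r) * L" using q L(1) by (intro mult_pos_pos) auto
  qed (rule I.finite_WB I.orthonormal_WB I.csubspace_hull_WB I.kappa_pos I.card_WB_le lim[unfolded d_def])+
qed

section \<open>Zeta operators of diagonal operators\<close>

text \<open>\<open>T\<close> is only a symmetric linear relation with the given eigenvectors.
  \<open>K_coeff\<close> confines \<open>K\<close> to the diagonal operator, while
  \<open>K_finite\<close> and \<open>K_closed\<close> make it large enough. Finite levels turn the
  eigenprojections into finite sums.\<close>

locale diagonal_pair =
  fixes B :: "'h::complex_hilbert set" and \<kappa> \<mu> :: "'h \<Rightarrow> real" and T K :: "'h operator"
  assumes B: "onb B"
    and \<kappa>_pos: "b \<in> B \<Longrightarrow> 0 < \<kappa> b" and \<mu>_pos: "b \<in> B \<Longrightarrow> 0 < \<mu> b"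
    and finite_level: "finite {b \<in> B. \<mu> b = t}"
    and T_eigen: "b \<in> B \<Longrightarrow> (b, \<mu> b *\<^sub>R b) \<in> T"
    and T_sym: "\<lbrakk>(x, y) \<in> T; (x', y') \<in> T\<rbrakk> \<Longrightarrow> cinner x' y = cinner y' x"
    and T_zero: "(0, 0) \<in> T"
    and T_add: "\<lbrakk>(x, y) \<in> T; (x', y') \<in> T\<rbrakk> \<Longrightarrow> (x + x', y + y') \<in> T"
    and T_scaleC: "(x, y) \<in> T \<Longrightarrow> (r *\<^sub>C x, r *\<^sub>C y) \<in> T"
    and K_closed: "closed K"
    and K_coeff: "\<lbrakk>(y, z) \<in> K; b \<in> B\<rbrakk> \<Longrightarrow> cinner b z = \<kappa> b * cinner b y"
    and K_finite: "\<lbrakk>finite F; F \<subseteq> B\<rbrakk> \<Longrightarrow>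
      ((\<Sum>b\<in>F. c b *\<^sub>C b), (\<Sum>b\<in>F. (complex_of_real (\<kappa> b) * c b) *\<^sub>C b)) \<in> K"
begin

abbreviation level :: "real \<Rightarrow> 'h set" where "level t \<equiv> {b \<in> B. \<mu> b = t}"

lemmas norm_B = onb_norm[OF B]

lemma eigenspace_coeff:
  assumes "x \<in> eigenspace T t" "b \<in> B" "\<mu> b \<noteq> t"
  shows "cinner b x = 0"
proof -
  have "cinner b (t *\<^sub>R x) = cinner (\<mu> b *\<^sub>R b) x"
    using assms T_sym[OF _ T_eigen[OF assms(2)]] by (simp add: eigenspace_def)
  then have "(complex_of_real t - complex_of_real (\<mu> b)) * cinner b x = 0"
    by (simp add: cinner_scaleR_right cinner_scaleR_left algebra_simps)
  then show ?thesis using assms(3) by (simp flip: of_real_diff)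
qed

lemma proj_on_level_coeff:
  "b \<in> B \<Longrightarrow> cinner b (proj_on (level t) x) = (if \<mu> b = t then cinner b x else 0)"
  using cinner_proj_on[OF onb_orthonormal[OF B] _ finite_level, of t b x] by simp

lemma eigenspace_scaleC: "x \<in> eigenspace T t \<Longrightarrow> r *\<^sub>C x \<in> eigenspace T t"
  using T_scaleC[of x "t *\<^sub>R x" r] by (simp add: eigenspace_def scaleC_scaleR_commute)

lemma eigenspace_add: "\<lbrakk>x \<in> eigenspace T t; y \<in> eigenspace T t\<rbrakk> \<Longrightarrow> x + y \<in> eigenspace T t"
  using T_add[of x "t *\<^sub>R x" y "t *\<^sub>R y"] by (simp add: eigenspace_def scaleR_right_distrib)

lemma eigenspace_diff: "\<lbrakk>x \<in> eigenspace T t; y \<in> eigenspace T t\<rbrakk> \<Longrightarrow> x - y \<in> eigenspace T t"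
  using eigenspace_add[of x t "(- 1) *\<^sub>C y"] eigenspace_scaleC[of y t "- 1"]
    scaleC_of_real[of "-1" y] by simp

lemma proj_on_level_eigenspace: "proj_on (level t) x \<in> eigenspace T t"
proof -
  have "(\<Sum>b\<in>F. c b *\<^sub>C b) \<in> eigenspace T t" if "F \<subseteq> level t" for F and c :: "'h \<Rightarrow> complex"
    using that
  proof (induction F rule: infinite_finite_induct)
    case (insert b F)
    then have "b \<in> eigenspace T t" using T_eigen by (auto simp: eigenspace_def)
    then show ?case using insert by (auto intro!: eigenspace_add eigenspace_scaleC)
  qed (use T_zero in \<open>auto simp: eigenspace_def\<close>)
  then show ?thesis by (simp add: proj_on_def)
qed

lemma orth_proj_eigenspace: "orth_proj (eigenspace T t) x = proj_on (level t) x"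
  unfolding orth_proj_def
proof (rule the_equality)
  let ?p = "proj_on (level t) x"
  have orth: "cinner z (x - ?p) = 0" if "z \<in> eigenspace T t" for z
  proof -
    have "((\<lambda>b. cinner (x - ?p) (cinner b z *\<^sub>C b)) has_sum cinner (x - ?p) z) B"
      by (intro has_sum_bounded_linear[OF bounded_linear_cinner_right] onb_expansion B)
    moreover have "cinner (x - ?p) (cinner b z *\<^sub>C b) = 0" if "b \<in> B" for b
    proof (cases "\<mu> b = t")
      case True
      then have "cinner b (x - ?p) = 0" using proj_on_level_coeff[OF that] by (simp add: cinner_diff_right)
      then have "cinner (x - ?p) b = 0" by (subst cinner_commute) simp
      then show ?thesis by (simp add: cinner_scaleC_right)
    next
      case False
      then show ?thesis using eigenspace_coeff[OF \<open>z \<in> eigenspace T t\<close> that] by simp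
    qed
    ultimately have "((\<lambda>b. 0 :: complex) has_sum cinner (x - ?p) z) B" by (simp cong: has_sum_cong)
    then have "cinner (x - ?p) z = 0" by (rule has_sum_unique) (rule has_sum_0, simp)
    then show ?thesis by (subst cinner_commute) simp
  qed
  show "?p \<in> eigenspace T t \<and> (\<forall>z\<in>eigenspace T t. cinner z (x - ?p) = 0)"
    using orth proj_on_level_eigenspace by blast
  fix p assume p: "p \<in> eigenspace T t \<and> (\<forall>z\<in>eigenspace T t. cinner z (x - p) = 0)"
  then have "p - ?p \<in> eigenspace T t" using proj_on_level_eigenspace eigenspace_diff by blast
  then have "cinner (p - ?p) (x - ?p) - cinner (p - ?p) (x - p) = 0" using orth p by simp
  then have "cinner (p - ?p) (p - ?p) = 0" by (simp add: cinner_diff_right)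
  then show "p = ?p" by (simp add: cinner_self)
qed

lemma fun_calc_eq: "(x, y) \<in> fun_calc f T \<longleftrightarrow> ((\<lambda>t. f t *\<^sub>R proj_on (level t) x) has_sum y) UNIV"
  by (simp add: fun_calc_def orth_proj_eigenspace)

text \<open>Pairing with \<open>b\<close> leaves only the term at \<open>\<mu> b\<close> of the sum
  over all reals.\<close>

lemma fun_calc_coeff:
  assumes "(x, y) \<in> fun_calc f T" "b \<in> B"
  shows "cinner b y = f (\<mu> b) * cinner b x"
proof -
  have "((\<lambda>t. cinner b (f t *\<^sub>R proj_on (level t) x)) has_sum cinner b y) UNIV"
    using assms(1) unfolding fun_calc_eq by (rule has_sum_bounded_linear[OF bounded_linear_cinner_right])
  moreover have "((\<lambda>t. cinner b (f t *\<^sub>R proj_on (level t) x)) has_sum f (\<mu> b) * cinner b x) UNIV"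
  proof -
    have "((\<lambda>t. cinner b (f t *\<^sub>R proj_on (level t) x)) has_sum f (\<mu> b) * cinner b x) {\<mu> b}"
      using proj_on_level_coeff[OF assms(2)] by (intro has_sum_finiteI) (auto simp: cinner_scaleR_right)
    then show ?thesis
      using proj_on_level_coeff[OF assms(2)]
      by (subst has_sum_cong_neutral[where T = "{\<mu> b}"]) (auto simp: cinner_scaleR_right)
  qed
  ultimately show ?thesis by (rule has_sum_unique)
qed

text \<open>The basis is the disjoint union of its levels, so the sum over \<open>B\<close> can be
  grouped by eigenvalue.\<close>

lemma fun_calc_expansion:
  assumes "((\<lambda>b. (f (\<mu> b) * cinner b x) *\<^sub>C b) has_sum y) B"
  shows "(x, y) \<in> fun_calc f T"
proof -
  have "bij_betw snd (Sigma UNIV level) B"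
    by (rule bij_betw_byWitness[where f' = "\<lambda>b. (\<mu> b, b)"]) auto
  then have "((\<lambda>p. (f (\<mu> (snd p)) * cinner (snd p) x) *\<^sub>C snd p) has_sum y) (Sigma UNIV level)"
    using assms has_sum_reindex_bij_betw[of snd _ B "\<lambda>b. (f (\<mu> b) * cinner b x) *\<^sub>C b"] by blast
  moreover have "((\<lambda>b. (f (\<mu> (snd (t, b))) * cinner (snd (t, b)) x) *\<^sub>C snd (t, b)) has_sum f t *\<^sub>R proj_on (level t) x) (level t)" for t
    using finite_level
    by (intro has_sum_finiteI) (auto simp: proj_on_def scaleR_sum_right scaleC_scaleC[symmetric] scaleC_of_real)
  ultimately show ?thesis unfolding fun_calc_eq by (rule has_sum_SigmaD)
qed

lemma K_expansion:
  assumes "((\<lambda>b. c b *\<^sub>C b) has_sum y) B" "((\<lambda>b. (complex_of_real (\<kappa> b) * c b) *\<^sub>C b) has_sum z) B"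
  shows "(y, z) \<in> K"
proof (rule Lim_in_closed_set[OF K_closed])
  show "\<forall>\<^sub>F F in finite_subsets_at_top B. (sum (\<lambda>b. c b *\<^sub>C b) F, sum (\<lambda>b. (complex_of_real (\<kappa> b) * c b) *\<^sub>C b) F) \<in> K"
    by (rule eventually_finite_subsets_at_top_weakI) (rule K_finite)
  show "((\<lambda>F. (sum (\<lambda>b. c b *\<^sub>C b) F, sum (\<lambda>b. (complex_of_real (\<kappa> b) * c b) *\<^sub>C b) F)) \<longlongrightarrow> (y, z)) (finite_subsets_at_top B)"
    using assms unfolding has_sum_def by (rule tendsto_Pair)
qed simp

definition zcoeff :: "real \<Rightarrow> 'h \<Rightarrow> real" where
  "zcoeff s b = \<kappa> b * \<mu> b powr (- s / 2)"

lemma zcoeff_pos: "b \<in> B \<Longrightarrow> 0 < zcoeff s b"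
  using \<kappa>_pos[of b] \<mu>_pos[of b] by (simp add: zcoeff_def)

abbreviation Z :: "real \<Rightarrow> 'h operator" where
  "Z s \<equiv> op_mult K (op_powr T (- s / 2))"

lemma Z_coeff:
  assumes "(x, z) \<in> Z s" "b \<in> B"
  shows "cinner b z = zcoeff s b * cinner b x"
proof -
  obtain y where "(x, y) \<in> fun_calc (\<lambda>\<mu>. \<mu> powr (- s / 2)) T" "(y, z) \<in> K"
    using assms(1) by (auto simp: op_mult_def op_powr_def)
  then show ?thesis using fun_calc_coeff[OF _ assms(2)] K_coeff[OF _ assms(2)] by (simp add: zcoeff_def)
qed

text \<open>The first hypothesis puts \<open>x\<close> into the domain of the power of
  \<open>T\<close>, since \<open>op_mult\<close> lives on the natural domain of the product.\<close>

lemma Z_expansion: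
  assumes "(\<lambda>b. (\<mu> b powr (- s / 2) * cinner b x) *\<^sub>C b) summable_on B"
    and "((\<lambda>b. (zcoeff s b * cinner b x) *\<^sub>C b) has_sum z) B"
  shows "(x, z) \<in> Z s"
proof -
  obtain y where y: "((\<lambda>b. (\<mu> b powr (- s / 2) * cinner b x) *\<^sub>C b) has_sum y) B"
    using assms(1) by (auto simp: summable_on_def)
  then have "(x, y) \<in> op_powr T (- s / 2)" unfolding op_powr_def by (intro fun_calc_expansion)
  moreover have "(y, z) \<in> K"
    using K_expansion[OF y] assms(2) by (simp add: zcoeff_def mult.assoc)
  ultimately show ?thesis by (auto simp: op_mult_def)
qed

lemma has_sum_single_basis:
  assumes "b \<in> B"
  shows "((\<lambda>b'. (r b' * cinner b' b) *\<^sub>C b') has_sum r b *\<^sub>C b) B"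
proof -
  have o: "cinner b' b = (if b' = b then 1 else 0)" if "b' \<in> B" for b'
    using B assms that by (simp add: onb_def)
  have "((\<lambda>b'. (r b' * cinner b' b) *\<^sub>C b') has_sum r b *\<^sub>C b) {b}"
    using o[OF assms] by (intro has_sum_finiteI) auto
  then show ?thesis using assms o
    by (subst has_sum_cong_neutral[where T = "{b}"]) auto
qed

lemma Z_basis:
  assumes "b \<in> B"
  shows "(b, zcoeff s b *\<^sub>R b) \<in> Z s"
proof (rule Z_expansion)
  show "(\<lambda>b'. (\<mu> b' powr (- s / 2) * cinner b' b) *\<^sub>C b') summable_on B"
    using has_sum_single_basis[OF assms, of "\<lambda>b. complex_of_real (\<mu> b powr (- s / 2))"] by (auto simp: summable_on_def)
  show "((\<lambda>b'. (zcoeff s b' * cinner b' b) *\<^sub>C b') has_sum zcoeff s b *\<^sub>R b) B"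
    using has_sum_single_basis[OF assms, of "\<lambda>b. complex_of_real (zcoeff s b)"] by (simp add: scaleC_of_real)
qed

text \<open>Both branches of \<open>op_trace\<close> give infinity: a bounded everywhere defined
  operator has the divergent sum over the eigenbasis as its trace, and otherwise the value is
  infinite by definition.\<close>

lemma op_trace_infinite:
  assumes "\<not> zcoeff s summable_on B"
  shows "op_trace (Z s) = \<infinity>"
proof (cases "\<exists>R. Z s = graph_on UNIV R \<and> bounded_clinear R")
  case True
  then obtain R where R: "Z s = graph_on UNIV R" "bounded_clinear R" by blast
  have "R b = zcoeff s b *\<^sub>R b" if "b \<in> B" for b
    using Z_basis[OF that, of s] unfolding R(1) graph_on_def by auto
  then have "op_trace (Z s) = infsum (\<lambda>b. ennreal (zcoeff s b)) B"
    unfolding R(1) using zcoeff_pos by (intro op_trace_diagonal[OF R(2) B]) (auto intro: less_imp_le)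
  also have "\<dots> = \<infinity>" using assms zcoeff_pos by (subst infsum_ennreal_eq) (auto intro: less_imp_le)
  finally show ?thesis .
next
  case False
  then show ?thesis unfolding op_trace_def by (rule if_not_P)
qed

lemma norm_coeff_le: "b \<in> B \<Longrightarrow> norm ((of_real r * cinner b x) *\<^sub>C b) \<le> \<bar>r\<bar> * norm x"
  using cinner_Cauchy_Schwarz[of b x] norm_B[of b] by (auto simp: norm_scaleC norm_mult intro!: mult_left_mono)

lemma summable_coeff:
  fixes r :: "'h \<Rightarrow> real"
  assumes "r summable_on B" "\<And>b. b \<in> B \<Longrightarrow> 0 \<le> r b"
  shows "(\<lambda>b. norm ((of_real (r b) * cinner b x) *\<^sub>C b)) summable_on B"
proof (rule Infinite_Sum.abs_summable_on_comparison_test')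
  show "(\<lambda>b. r b * norm x) summable_on B" using assms(1) by (rule summable_on_cmult_left)
  show "norm ((of_real (r b) * cinner b x) *\<^sub>C b) \<le> r b * norm x" if "b \<in> B" for b
    using norm_coeff_le[OF that, of "r b" x] assms(2)[OF that] by simp
qed

text \<open>Coefficients are bounded by the norm, so summability of \<open>zcoeff\<close> defines
  \<open>R\<close> everywhere by an absolutely convergent series, and \<open>R\<close>, being
  positive, is its own absolute value. The second hypothesis puts every vector into the domain of
  the power of \<open>T\<close>.\<close>

lemma zeta_trace_class:
  assumes sum: "zcoeff s summable_on B" and sum': "(\<lambda>b. \<mu> b powr (- s / 2)) summable_on B"
  shows "trace_class (Z s)" "op_trace (Z s) = ennreal (infsum (zcoeff s) B)"
proof -
  define R where "R x = infsum (\<lambda>b. (zcoeff s b * cinner b x) *\<^sub>C b) B" for x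
  have pos: "0 \<le> zcoeff s b" if "b \<in> B" for b using zcoeff_pos[OF that, of s] by simp
  note abs = summable_coeff[OF sum pos]
  have R: "((\<lambda>b. (zcoeff s b * cinner b x) *\<^sub>C b) has_sum R x) B" for x
    unfolding R_def by (rule has_sum_infsum[OF abs_summable_summable[OF abs]])
  have ZR: "(x, R x) \<in> Z s" for x
    by (rule Z_expansion[OF abs_summable_summable[OF summable_coeff[OF sum']] R]) simp
  have coeff: "cinner b (R x) = zcoeff s b * cinner b x" if "b \<in> B" for b x
    using Z_coeff[OF ZR that] .
  have graph: "Z s = graph_on UNIV R"
  proof -
    have "z = R x" if "(x, z) \<in> Z s" for x z
      by (rule onb_eqI[OF B]) (simp add: Z_coeff[OF that] coeff)
    then show ?thesis using ZR by (auto simp: graph_on_def)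
  qed
  have add: "R (x + y) = R x + R y" for x y
    by (rule onb_eqI[OF B]) (simp add: coeff cinner_add_right distrib_left)
  have scaleC: "R (r *\<^sub>C x) = r *\<^sub>C R x" for r x
    by (rule onb_eqI[OF B]) (simp add: coeff cinner_scaleC_right)
  have bounded: "norm (R x) \<le> infsum (zcoeff s) B * norm x" for x
  proof -
    have "norm (R x) \<le> infsum (\<lambda>b. norm ((zcoeff s b * cinner b x) *\<^sub>C b)) B"
      unfolding R_def by (rule norm_infsum_bound[OF abs])
    also have "\<dots> \<le> infsum (\<lambda>b. zcoeff s b * norm x) B"
    proof (rule infsum_mono[OF abs summable_on_cmult_left[OF sum]])
      show "norm ((zcoeff s b * cinner b x) *\<^sub>C b) \<le> zcoeff s b * norm x" if "b \<in> B" for b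
        using norm_coeff_le[OF that, of "zcoeff s b" x] pos[OF that] by simp
    qed
    also have "\<dots> = infsum (zcoeff s) B * norm x" by (rule infsum_cmult_left')
    finally show ?thesis .
  qed
  have bl: "bounded_linear R"
    using add bounded scaleC
    by (intro bounded_linear_intro[where K = "infsum (zcoeff s) B"]) (auto simp: mult.commute simp flip: scaleC_of_real)
  have bcl: "bounded_clinear R" using bl scaleC by (simp add: bounded_clinear_def)
  have form: "((\<lambda>b. zcoeff s b * (cinner b y * cinner x b)) has_sum cinner x (R y)) B" for x y
  proof -
    have "((\<lambda>b. cinner x ((zcoeff s b * cinner b y) *\<^sub>C b)) has_sum cinner x (R y)) B"
      by (rule has_sum_bounded_linear[OF bounded_linear_cinner_right R])
    then show ?thesis by (simp add: cinner_scaleC_right mult.assoc)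
  qed
  have sym: "cinner (R x) y = cinner x (R y)" for x y
  proof -
    have "((\<lambda>b. cnj (zcoeff s b * (cinner b x * cinner y b))) has_sum cnj (cinner y (R x))) B"
      by (rule has_sum_bounded_linear[OF bounded_linear_cnj form])
    moreover have "cnj (zcoeff s b * (cinner b x * cinner y b)) = zcoeff s b * (cinner b y * cinner x b)" for b
      by (simp add: cinner_commute[of x b] cinner_commute[of b y] mult.commute)
    ultimately have "((\<lambda>b. zcoeff s b * (cinner b y * cinner x b)) has_sum cinner (R x) y) B"
      by (simp only: cinner_commute[of "R x" y])
    then show ?thesis by (rule has_sum_unique[OF _ form])
  qed
  have nonneg: "0 \<le> Re (cinner x (R x))" for x
  proof -
    have "((\<lambda>b. Re (zcoeff s b * (cinner b x * cinner x b))) has_sum Re (cinner x (R x))) B"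
      by (rule has_sum_bounded_linear[OF bounded_linear_Re form])
    then show ?thesis
    proof (rule has_sum_nonneg)
      fix b assume "b \<in> B"
      have "cinner b x * cinner x b = of_real ((cmod (cinner b x))\<^sup>2)"
        by (simp add: cinner_commute[of x b] complex_norm_square del: of_real_power)
      then show "0 \<le> Re (zcoeff s b * (cinner b x * cinner x b))"
        using pos[OF \<open>b \<in> B\<close>] by (simp del: of_real_power flip: of_real_mult)
    qed
  qed
  have Rb: "R b = zcoeff s b *\<^sub>R b" if "b \<in> B" for b
  proof -
    have "(b, zcoeff s b *\<^sub>R b) \<in> graph_on UNIV R" using Z_basis[OF that, of s] graph by simp
    then show ?thesis by (auto simp: graph_on_def)
  qed
  have diag: "Re (cinner b (R b)) = zcoeff s b" if "b \<in> B" for b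
    using B that by (simp add: Rb[OF that] cinner_scaleR_right onb_def)
  have "is_abs_op R R" unfolding is_abs_op_def using bcl sym nonneg by simp
  moreover have "(\<lambda>b. Re (cinner b (R b))) summable_on B"
    using sum diag by (simp cong: summable_on_cong)
  ultimately show "trace_class (Z s)" unfolding trace_class_def using graph bcl B by blast
  have "op_trace (Z s) = infsum (\<lambda>b. ennreal (zcoeff s b)) B"
    unfolding graph by (rule op_trace_diagonal[OF bcl B Rb pos])
  then show "op_trace (Z s) = ennreal (infsum (zcoeff s) B)"
    using sum pos by (simp add: infsum_ennreal_eq)
qed

end

section \<open>The Dolbeault--Dirac operator\<close>

lemma op_adjoint_iff: "(y, z) \<in> op_adjoint T \<longleftrightarrow> (\<forall>x w. (x, w) \<in> T \<longrightarrow> cinner y w = cinner z x)"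
  by (auto simp: op_adjoint_def)

text \<open>An index i = (k, j) names the j-th family of summands in degree k, and
  \<open>W i m\<close> is an eigenbasis of its m-th member as delivered by
  \<open>irrep_family_trace\<close>.\<close>

locale dirac_basis = dolbeault_dirac q l N \<Omega> a c S dbar dbar_adj \<alpha> \<beta> D ev
  for q l N and \<Omega> :: "nat \<Rightarrow> 'h::complex_hilbert set" and a c S dbar dbar_adj \<alpha> \<beta> D ev +
  fixes W :: "nat \<times> nat \<Rightarrow> nat \<Rightarrow> 'h set" and \<kappa>0 :: "nat \<times> nat \<Rightarrow> nat \<Rightarrow> 'h \<Rightarrow> real"
    and C :: "nat \<times> nat \<Rightarrow> real" and fam :: "(nat \<times> nat) set"
  defines "fam \<equiv> Sigma {..l} (families l)"
  assumes q: "0 < q" "q < 1" and l: "2 \<le> l"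
    and W_finite: "i \<in> fam \<Longrightarrow> finite (W i m)"
    and W_orthonormal: "i \<in> fam \<Longrightarrow> orthonormal (W i m)"
    and W_hull: "i \<in> fam \<Longrightarrow> csubspace hull (W i m) = S (fst i) (snd i) m"
    and \<kappa>0_pos: "i \<in> fam \<Longrightarrow> 0 < \<kappa>0 i m b"
    and \<kappa>0_rho: "\<lbrakk>i \<in> fam; b \<in> W i m\<rbrakk> \<Longrightarrow>
      \<exists>\<theta>. (\<forall>j\<in>{1..l}. a (Kg j) b = \<theta> j *\<^sub>R b) \<and> \<kappa>0 i m b = rho_scalar l \<theta>"
    and card_W: "i \<in> fam \<Longrightarrow> real (card (W i m)) \<le> (\<Sum>b\<in>W i m. \<kappa>0 i m b)"
    and C_pos: "i \<in> fam \<Longrightarrow> 0 < C i"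
    and C_lim: "i \<in> fam \<Longrightarrow> (\<lambda>m. q powr (real m * (2 * real l)) * (\<Sum>b\<in>W i m. \<kappa>0 i m b)) \<longlonglongrightarrow> C i"
begin

definition ev2 :: "nat \<times> nat \<Rightarrow> nat \<Rightarrow> real" where
  "ev2 i m = (ev (fst i) (snd i) m)\<^sup>2 + 1"

lemma finite_fam: "finite fam"
  by (auto simp: fam_def families_def)

lemma fam_zero: "(0, 0) \<in> fam"
  by (auto simp: fam_def families_def)

lemma famD: "i \<in> fam \<Longrightarrow> fst i \<le> l \<and> snd i \<in> families l (fst i)"
  by (auto simp: fam_def)

lemma W_S: "i \<in> fam \<Longrightarrow> W i m \<subseteq> S (fst i) (snd i) m"
  using W_hull hull_subset by metis

lemma S_forms:
  assumes "i \<in> fam" shows "S (fst i) (snd i) m \<subseteq> \<Omega> (fst i)"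
proof -
  have i: "fst i \<le> l" "snd i \<in> families l (fst i)" using famD[OF assms] by blast+
  have "S (fst i) (snd i) m \<subseteq> (\<Union>j\<in>families l (fst i). \<Union>m. S (fst i) j m)" using i(2) by blast
  also have "\<dots> \<subseteq> \<Omega> (fst i)" unfolding forms_decomposition[OF i(1)] by (rule span_superset)
  finally show ?thesis .
qed

lemma forms_total:
  assumes "k \<le> l" shows "\<Omega> k \<subseteq> total_forms l \<Omega>"
proof -
  have "\<Omega> k \<subseteq> (\<Union>k\<in>{0..l}. \<Omega> k)" using assms by auto
  also have "\<dots> \<subseteq> total_forms l \<Omega>" unfolding total_forms_def by (rule span_superset)
  finally show ?thesis .
qed

lemma W_total: "\<lbrakk>i \<in> fam; b \<in> W i m\<rbrakk> \<Longrightarrow> b \<in> total_forms l \<Omega>"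
  using W_S S_forms forms_total famD by blast

definition B :: "'h set" where "B = (\<Union>i\<in>fam. \<Union>m. W i m)"

text \<open>Within one degree this is the orthogonality of summands, across degrees that of the
  spaces of forms.\<close>

lemma W_orth:
  assumes "i \<in> fam" "i' \<in> fam" "(i, m) \<noteq> (i', m')" "b \<in> W i m" "b' \<in> W i' m'"
  shows "cinner b b' = 0"
proof -
  have b: "b \<in> S (fst i) (snd i) m" "b' \<in> S (fst i') (snd i') m'"
    using W_S[OF assms(1)] W_S[OF assms(2)] assms(4,5) by blast+
  show ?thesis
  proof (cases "fst i = fst i'")
    case True
    have "(snd i, m) \<noteq> (snd i', m')" using assms(3) True by (auto simp: prod_eq_iff)
    then have "corthogonal (S (fst i) (snd i) m) (S (fst i) (snd i') m')"
      using famD[OF assms(1)] famD[OF assms(2)] True by (intro summand_orthogonal) auto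
    then show ?thesis using b True by (simp add: corthogonal_def)
  next
    case False
    then have "corthogonal (\<Omega> (fst i)) (\<Omega> (fst i'))"
      using famD[OF assms(1)] famD[OF assms(2)] by (intro forms_orthogonal) auto
    then show ?thesis using b S_forms assms(1,2) unfolding corthogonal_def by blast
  qed
qed

lemma W_unique:
  assumes "i \<in> fam" "i' \<in> fam" "b \<in> W i m" "b \<in> W i' m'"
  shows "(i, m) = (i', m')"
proof (rule ccontr)
  assume "(i, m) \<noteq> (i', m')"
  then have "cinner b b = 0" using assms by (intro W_orth[of i i' m m'])
  then show False using W_orthonormal[OF assms(1), of m] assms(3) by (simp add: orthonormal_def)
qed

definition loc :: "'h \<Rightarrow> (nat \<times> nat) \<times> nat" where
  "loc b = (THE p. fst p \<in> fam \<and> b \<in> W (fst p) (snd p))"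

lemma loc_eq: "\<lbrakk>i \<in> fam; b \<in> W i m\<rbrakk> \<Longrightarrow> loc b = (i, m)"
  unfolding loc_def
proof (rule the_equality)
  fix p assume "i \<in> fam" "b \<in> W i m" "fst p \<in> fam \<and> b \<in> W (fst p) (snd p)"
  then show "p = (i, m)" using W_unique[of "fst p" i b "snd p" m] by simp
qed simp

definition \<kappa> :: "'h \<Rightarrow> real" where "\<kappa> b = \<kappa>0 (fst (loc b)) (snd (loc b)) b"
definition \<mu> :: "'h \<Rightarrow> real" where "\<mu> b = ev2 (fst (loc b)) (snd (loc b))"

lemma \<kappa>_W: "\<lbrakk>i \<in> fam; b \<in> W i m\<rbrakk> \<Longrightarrow> \<kappa> b = \<kappa>0 i m b"
  and \<mu>_W: "\<lbrakk>i \<in> fam; b \<in> W i m\<rbrakk> \<Longrightarrow> \<mu> b = ev2 i m"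
  by (simp_all add: \<kappa>_def \<mu>_def loc_eq)

lemma B_W: "b \<in> B \<Longrightarrow> \<exists>i m. i \<in> fam \<and> b \<in> W i m"
  by (auto simp: B_def)

lemma orthonormal_B: "orthonormal B"
  unfolding orthonormal_def
proof (intro ballI)
  fix b b' assume "b \<in> B" "b' \<in> B"
  then obtain i m i' m' where *: "i \<in> fam" "b \<in> W i m" "i' \<in> fam" "b' \<in> W i' m'" using B_W by metis
  show "cinner b b' = (if b = b' then 1 else 0)"
  proof (cases "(i, m) = (i', m')")
    case True
    then show ?thesis using * W_orthonormal[OF *(1), of m] by (auto simp: orthonormal_def)
  next
    case False
    then show ?thesis using W_orth[OF *(1,3) False *(2,4)] W_unique[OF *(1,3), of b m m'] * by auto
  qed
qed

lemma total_forms_hull: "total_forms l \<Omega> \<subseteq> csubspace hull B"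
proof -
  have sub: "subspace (csubspace hull B)" by (rule csubspace_subspace[OF csubspace_hull_csubspace])
  have S: "S k j m \<subseteq> csubspace hull B" if "k \<le> l" "j \<in> families l k" for k j m
  proof -
    have i: "(k, j) \<in> fam" using that by (simp add: fam_def)
    have "W (k, j) m \<subseteq> B" using i by (auto simp: B_def)
    then have "csubspace hull (W (k, j) m) \<subseteq> csubspace hull B" by (rule hull_mono)
    then show ?thesis using W_hull[OF i] by simp
  qed
  have "\<Omega> k \<subseteq> csubspace hull B" if "k \<le> l" for k
    unfolding forms_decomposition[OF that] using S[OF that] by (intro span_minimal sub) blast
  then have "(\<Union>k\<in>{0..l}. \<Omega> k) \<subseteq> csubspace hull B" by (intro UN_least) simp
  then show ?thesis unfolding total_forms_def by (intro span_minimal sub)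
qed

lemma onb_B: "onb B"
proof -
  have "closure (total_forms l \<Omega>) \<subseteq> closure (csubspace hull B)" by (rule closure_mono[OF total_forms_hull])
  then have "closure (csubspace hull B) = UNIV" unfolding forms_dense by (rule top.extremum_uniqueI)
  then show ?thesis using orthonormal_B by (simp add: onb_def orthonormal_def)
qed

section \<open>The operators D^2 + 1 and K_2rho in the joint eigenbasis\<close>

abbreviation T :: "'h operator" where "T \<equiv> op_plus_one (op_mult D D)"
abbreviation K :: "'h operator" where "K \<equiv> K2rho_op l \<Omega> a"

lemma D_adjoint: "op_adjoint D = D"
  using D_self_adjoint by (simp add: self_adjoint_def)

lemma D_sym: "\<lbrakk>(x, w) \<in> D; (y, z) \<in> D\<rbrakk> \<Longrightarrow> cinner y w = cinner z x"
  using op_adjoint_iff[of y z D] D_adjoint by simp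

lemma T_iff: "(x, y) \<in> T \<longleftrightarrow> (\<exists>z. (x, z) \<in> D \<and> (z, y - x) \<in> D)"
proof -
  have "(x, y) \<in> T \<longleftrightarrow> (x, y - x) \<in> op_mult D D"
    by (auto simp: op_plus_one_def) (metis diff_add_cancel)
  then show ?thesis by (auto simp: op_mult_def)
qed

lemma T_symmetric:
  assumes "(x, y) \<in> T" "(x', y') \<in> T"
  shows "cinner x' y = cinner y' x"
proof -
  obtain z z' where z: "(x, z) \<in> D" "(z, y - x) \<in> D" "(x', z') \<in> D" "(z', y' - x') \<in> D"
    using assms by (auto simp: T_iff)
  have "cinner x' (y - x) = cinner z' z" by (rule D_sym[OF z(2,3)])
  also have "\<dots> = cinner (y' - x') x" by (rule D_sym[OF z(1,4)])
  finally show ?thesis by (simp add: cinner_diff_left cinner_diff_right)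
qed

text \<open>Linearity of the graph comes from self-adjointness: \<open>D\<close> equals its adjoint,
  and an adjoint is cut out by linear conditions.\<close>

lemma D_add: "\<lbrakk>(x, y) \<in> D; (x', y') \<in> D\<rbrakk> \<Longrightarrow> (x + x', y + y') \<in> D"
proof -
  assume *: "(x, y) \<in> D" "(x', y') \<in> D"
  have "(x + x', y + y') \<in> op_adjoint D"
    unfolding op_adjoint_iff
  proof (intro allI impI)
    fix u w assume "(u, w) \<in> D"
    then show "cinner (x + x') w = cinner (y + y') u"
      using D_sym[OF _ *(1)] D_sym[OF _ *(2)] by (simp only: cinner_add_left)
  qed
  then show ?thesis unfolding D_adjoint .
qed

lemma D_scaleC: "(x, y) \<in> D \<Longrightarrow> (r *\<^sub>C x, r *\<^sub>C y) \<in> D"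
proof -
  assume *: "(x, y) \<in> D"
  have "(r *\<^sub>C x, r *\<^sub>C y) \<in> op_adjoint D"
    unfolding op_adjoint_iff
  proof (intro allI impI)
    fix u w assume "(u, w) \<in> D"
    then show "cinner (r *\<^sub>C x) w = cinner (r *\<^sub>C y) u" using D_sym[OF _ *] by (simp only: cinner_scaleC_left)
  qed
  then show ?thesis unfolding D_adjoint .
qed

lemma T_add:
  assumes "(x, y) \<in> T" "(x', y') \<in> T" shows "(x + x', y + y') \<in> T"
proof -
  obtain z z' where z: "(x, z) \<in> D" "(z, y - x) \<in> D" "(x', z') \<in> D" "(z', y' - x') \<in> D"
    using assms by (auto simp: T_iff)
  have "(z + z', (y - x) + (y' - x')) \<in> D" by (rule D_add[OF z(2,4)])
  then have "(z + z', (y + y') - (x + x')) \<in> D" by (simp add: algebra_simps)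
  then show ?thesis using D_add[OF z(1,3)] T_iff by blast
qed

lemma T_scaleC:
  assumes "(x, y) \<in> T" shows "(r *\<^sub>C x, r *\<^sub>C y) \<in> T"
proof -
  obtain z where z: "(x, z) \<in> D" "(z, y - x) \<in> D" using assms by (auto simp: T_iff)
  have "r *\<^sub>C (y - x) = r *\<^sub>C y - r *\<^sub>C x"
    using scaleC_add_right[of r "y - x" x] by (simp add: algebra_simps)
  then have "(r *\<^sub>C z, r *\<^sub>C y - r *\<^sub>C x) \<in> D" using D_scaleC[OF z(2), of r] by simp
  then show ?thesis using D_scaleC[OF z(1)] T_iff by blast
qed

lemma T_zero: "(0, 0) \<in> T"
proof -
  have "(0, 0) \<in> op_adjoint D" by (simp add: op_adjoint_iff)
  then show ?thesis using D_adjoint by (auto simp: T_iff)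
qed

lemma T_eigen: "b \<in> B \<Longrightarrow> (b, \<mu> b *\<^sub>R b) \<in> T"
proof -
  assume "b \<in> B"
  then obtain i m where i: "i \<in> fam" "b \<in> W i m" using B_W by blast
  have "(b, (ev (fst i) (snd i) m)\<^sup>2 *\<^sub>R b) \<in> op_mult D D"
    using famD[OF i(1)] W_S[OF i(1)] i(2) by (intro D_sq_summand) auto
  then show ?thesis
    by (auto simp: op_plus_one_def \<mu>_W[OF i] ev2_def scaleR_left_distrib)
qed

text \<open>The identity holds on forms by \<open>K2rho_act_cinner\<close> and passes to the closure
  of the graph.\<close>

lemma K_coeff:
  assumes "(y, z) \<in> K" "b \<in> B"
  shows "cinner b z = \<kappa> b * cinner b y"
proof -
  obtain i m where i: "i \<in> fam" "b \<in> W i m" using assms(2) B_W by blast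
  obtain \<theta> where \<theta>: "\<And>j. j \<in> {1..l} \<Longrightarrow> a (Kg j) b = \<theta> j *\<^sub>R b" "\<kappa> b = rho_scalar l \<theta>"
    using \<kappa>0_rho[OF i] \<kappa>_W[OF i] by metis
  let ?E = "{p. cinner b (snd p) = \<kappa> b * cinner b (fst p)}"
  have "closed ?E"
    by (intro closed_Collect_eq continuous_intros linear_continuous_on
        bounded_linear_compose[OF bounded_linear_cinner_right] bounded_linear_fst bounded_linear_snd)
  moreover have "graph_on (total_forms l \<Omega>) (K2rho_act l a) \<subseteq> ?E"
    using K2rho_act_cinner[OF action W_total[OF i] _ \<theta>(1)] by (auto simp: graph_on_def \<theta>(2))
  ultimately have "K \<subseteq> ?E" unfolding K2rho_op_def by (intro closure_minimal)
  then show ?thesis using assms(1) by auto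
qed

lemma K_finite:
  assumes "finite F" "F \<subseteq> B"
  shows "((\<Sum>b\<in>F. r b *\<^sub>C b), (\<Sum>b\<in>F. (complex_of_real (\<kappa> b) * r b) *\<^sub>C b)) \<in> K"
proof -
  let ?y = "\<Sum>b\<in>F. r b *\<^sub>C b" and ?z = "\<Sum>b\<in>F. (complex_of_real (\<kappa> b) * r b) *\<^sub>C b"
  have cs: "csubspace (total_forms l \<Omega>)" using rep_csubspace[OF action] .
  have "?y \<in> total_forms l \<Omega>"
    using assms(2) B_W W_total cs
    by (intro subspace_sum csubspace_subspace csubspace_scaleC) blast+
  then have g: "(?y, K2rho_act l a ?y) \<in> K"
    unfolding K2rho_op_def using closure_subset by (fastforce simp: graph_on_def)
  \<comment> \<open>The value is read off from its coefficients through \<open>K_coeff\<close>, so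
    linearity of \<open>K2rho_act\<close> need not be established.\<close>
  have "K2rho_act l a ?y = ?z"
  proof (rule onb_eqI[OF onb_B])
    fix b assume b: "b \<in> B"
    have o: "cinner b b' = (if b = b' then 1 else 0)" if "b' \<in> F" for b'
      using orthonormal_B b that assms(2) by (auto simp: orthonormal_def)
    have s: "cinner b (\<Sum>b'\<in>F. r' b' *\<^sub>C b') = (if b \<in> F then r' b else 0)" for r' :: "'h \<Rightarrow> complex"
    proof -
      have "cinner b (\<Sum>b'\<in>F. r' b' *\<^sub>C b') = (\<Sum>b'\<in>F. if b = b' then r' b' else 0)"
        unfolding cinner_sum_right cinner_scaleC_right using o by (intro sum.cong) auto
      then show ?thesis using assms(1) by simp
    qed
    show "cinner b (K2rho_act l a ?y) = cinner b ?z"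
      using K_coeff[OF g b] by (simp add: s)
  qed
  then show ?thesis using g by simp
qed

text \<open>The summand 1 of D^2 + 1 contributes q^(2m), which tends to 0, so the limit is the
  square of the one for |D|.\<close>

lemma ev2_lim: "i \<in> fam \<Longrightarrow> \<exists>M>0. (\<lambda>m. ev2 i m * q ^ (2 * m)) \<longlonglongrightarrow> M"
proof -
  assume i: "i \<in> fam"
  obtain L where L: "L \<noteq> 0" "(\<lambda>m. ev (fst i) (snd i) m * q ^ m) \<longlonglongrightarrow> L"
    using ev_asymptotics famD[OF i] by blast
  have "(\<lambda>m. (q\<^sup>2) ^ m) \<longlonglongrightarrow> 0" using q by (intro LIMSEQ_realpow_zero) (auto simp: power_less_one_iff)
  then have "(\<lambda>m. (ev (fst i) (snd i) m * q ^ m)\<^sup>2 + (q\<^sup>2) ^ m) \<longlonglongrightarrow> L\<^sup>2 + 0"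
    by (intro tendsto_add tendsto_power L)
  moreover have "(ev (fst i) (snd i) m * q ^ m)\<^sup>2 + (q\<^sup>2) ^ m = ev2 i m * q ^ (2 * m)" for m
    by (simp add: ev2_def power_mult_distrib distrib_right flip: power_mult) (simp add: mult.commute)
  ultimately have "(\<lambda>m. ev2 i m * q ^ (2 * m)) \<longlonglongrightarrow> L\<^sup>2" by simp
  then show ?thesis using L(1) by (intro exI[of _ "L\<^sup>2"]) simp
qed

lemma ev2_ge: "1 \<le> ev2 i m" by (simp add: ev2_def)

text \<open>Along each of the finitely many families the eigenvalues outgrow every bound, so a given
  value occurs for finitely many m.\<close>

lemma finite_level: "finite {b \<in> B. \<mu> b = t}"
proof (rule finite_subset)
  show "{b \<in> B. \<mu> b = t} \<subseteq> (\<Union>i\<in>fam. \<Union>m\<in>{m. ev2 i m = t}. W i m)"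
  proof
    fix b assume "b \<in> {b \<in> B. \<mu> b = t}"
    then obtain i m where "i \<in> fam" "b \<in> W i m" "\<mu> b = t" using B_W by blast
    moreover from this have "ev2 i m = t" using \<mu>_W[of i b m] by simp
    ultimately show "b \<in> (\<Union>i\<in>fam. \<Union>m\<in>{m. ev2 i m = t}. W i m)" by blast
  qed
  have "finite {m. ev2 i m = t}" if i: "i \<in> fam" for i
  proof -
    obtain M where M: "0 < M" "(\<lambda>m. ev2 i m * q ^ (2 * m)) \<longlonglongrightarrow> M" using ev2_lim[OF i] by blast
    have "(\<lambda>m. t * (q\<^sup>2) ^ m) \<longlonglongrightarrow> t * 0"
      using q by (intro tendsto_mult_left LIMSEQ_realpow_zero) (auto simp: power_less_one_iff)
    then have "(\<lambda>m. ev2 i m * q ^ (2 * m) - t * (q\<^sup>2) ^ m) \<longlonglongrightarrow> M - t * 0"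
      by (intro tendsto_diff M)
    then have "\<forall>\<^sub>F m in sequentially. 0 < ev2 i m * q ^ (2 * m) - t * (q\<^sup>2) ^ m"
      using M(1) by (intro order_tendstoD) auto
    then have "\<forall>\<^sub>F m in sequentially. ev2 i m \<noteq> t"
      by eventually_elim (auto simp: power_mult)
    then show ?thesis unfolding cofinite_eq_sequentially[symmetric] eventually_cofinite by simp
  qed
  then show "finite (\<Union>i\<in>fam. \<Union>m\<in>{m. ev2 i m = t}. W i m)"
    using finite_fam W_finite by auto
qed

sublocale diagonal_pair B \<kappa> \<mu> T K
proof
  show "onb B" by (rule onb_B)
  show "0 < \<kappa> b" if "b \<in> B" for b using B_W[OF that] \<kappa>_W \<kappa>0_pos by force
  show "0 < \<mu> b" if "b \<in> B" for b unfolding \<mu>_def using ev2_ge by (rule less_le_trans[OF zero_less_one])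
  show "closed K" by (simp add: K2rho_op_def)
qed (use T_zero T_add T_scaleC T_symmetric T_eigen finite_level K_coeff K_finite in auto)

section \<open>Summation over the families and the zeta function\<close>

lemma bij_W: "bij_betw snd (Sigma (fam \<times> UNIV) (\<lambda>p. W (fst p) (snd p))) B"
  by (rule bij_betw_byWitness[where f' = "\<lambda>b. (loc b, b)"]) (auto simp: loc_eq B_def, force+)

lemma has_sum_B:
  fixes f :: "'h \<Rightarrow> real"
  assumes nonneg: "\<And>b. b \<in> B \<Longrightarrow> 0 \<le> f b"
    and summable: "\<And>i. i \<in> fam \<Longrightarrow> summable (\<lambda>m. \<Sum>b\<in>W i m. f b)"
  shows "(f has_sum (\<Sum>i\<in>fam. \<Sum>m. \<Sum>b\<in>W i m. f b)) B"
proof -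
  let ?g = "\<lambda>p. \<Sum>b\<in>W (fst p) (snd p). f b"
  have W_B: "b \<in> B" if "i \<in> fam" "b \<in> W i m" for i m b using that by (auto simp: B_def)
  have g_nonneg: "0 \<le> (\<Sum>b\<in>W i m. f b)" if "i \<in> fam" for i m
    using W_B[OF that] by (intro sum_nonneg nonneg)
  have 1: "((\<lambda>m. ?g (i, m)) has_sum (\<Sum>m. \<Sum>b\<in>W i m. f b)) UNIV" if "i \<in> fam" for i
    using summable[OF that] g_nonneg[OF that] by (intro sums_nonneg_imp_has_sum) (auto simp: summable_sums)
  have s1: "?g summable_on fam \<times> UNIV"
    by (rule summable_on_SigmaI[where g = "\<lambda>i. \<Sum>m. \<Sum>b\<in>W i m. f b"])
      (use 1 finite_fam g_nonneg in auto)
  have 2: "(?g has_sum (\<Sum>i\<in>fam. \<Sum>m. \<Sum>b\<in>W i m. f b)) (fam \<times> UNIV)"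
    by (rule has_sum_SigmaI[where g = "\<lambda>i. \<Sum>m. \<Sum>b\<in>W i m. f b"])
      (use 1 finite_fam s1 in auto)
  have 3: "((\<lambda>b. f (snd (p, b))) has_sum ?g p) (W (fst p) (snd p))" if "p \<in> fam \<times> UNIV" for p
    using that W_finite by (intro has_sum_finiteI) auto
  have s2: "(\<lambda>x. f (snd x)) summable_on Sigma (fam \<times> UNIV) (\<lambda>p. W (fst p) (snd p))"
    by (rule summable_on_SigmaI[where g = ?g]) (use 3 2 nonneg W_B in \<open>auto simp: summable_on_def\<close>)
  have "((\<lambda>x. f (snd x)) has_sum (\<Sum>i\<in>fam. \<Sum>m. \<Sum>b\<in>W i m. f b)) (Sigma (fam \<times> UNIV) (\<lambda>p. W (fst p) (snd p)))"
    by (rule has_sum_SigmaI[where g = ?g, OF 3 2 s2])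
  then show ?thesis using has_sum_reindex_bij_betw[OF bij_W] by blast
qed

lemma summable_W:
  fixes f :: "'h \<Rightarrow> real"
  assumes "f summable_on B" "i \<in> fam"
  shows "summable (\<lambda>m. \<Sum>b\<in>W i m. f b)"
proof -
  have "f summable_on (\<Union>m. W i m)"
    using assms by (intro summable_on_subset_banach[OF assms(1)]) (auto simp: B_def)
  moreover have "bij_betw snd (Sigma UNIV (W i)) (\<Union>m. W i m)"
    using loc_eq[OF assms(2)] by (intro bij_betw_byWitness[where f' = "\<lambda>b. (snd (loc b), b)"]) force+
  ultimately obtain t where "((\<lambda>x. f (snd x)) has_sum t) (Sigma UNIV (W i))"
    using has_sum_reindex_bij_betw by (metis summable_on_def)
  then have "((\<lambda>m. \<Sum>b\<in>W i m. f b) has_sum t) UNIV"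
    by (rule has_sum_SigmaD) (use W_finite[OF assms(2)] in auto)
  then show ?thesis using has_sum_imp_sums sums_summable by blast
qed

definition Mlim :: "nat \<times> nat \<Rightarrow> real" where "Mlim i = lim (\<lambda>m. ev2 i m * q ^ (2 * m))"

abbreviation Aseq :: "nat \<times> nat \<Rightarrow> nat \<Rightarrow> real" where
  "Aseq i m \<equiv> q powr (real m * (2 * real l)) * (\<Sum>b\<in>W i m. \<kappa>0 i m b)"
abbreviation Bseq' :: "nat \<times> nat \<Rightarrow> nat \<Rightarrow> real" where
  "Bseq' i m \<equiv> ev2 i m * q ^ (2 * m)"

lemma zeta_series: "i \<in> fam \<Longrightarrow> zeta_series q (2 * real l) (C i) (Mlim i) (Aseq i) (Bseq' i)"
proof
  assume i: "i \<in> fam"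
  obtain M where M: "0 < M" "Bseq' i \<longlonglongrightarrow> M" using ev2_lim[OF i] by blast
  have "Mlim i = M" unfolding Mlim_def by (rule limI[OF M(2)])
  then show "0 < Mlim i" "Bseq' i \<longlonglongrightarrow> Mlim i" using M by auto
  show "0 < Bseq' i m" for m using ev2_ge[of i m] q by simp
qed (use q l C_pos C_lim in auto)

abbreviation zt :: "nat \<times> nat \<Rightarrow> real \<Rightarrow> nat \<Rightarrow> real" where
  "zt i \<equiv> zeta_series.zterm q (2 * real l) (Aseq i) (Bseq' i)"

text \<open>The factors q^(2lm), q^(-sm) and q^((s - 2l)m), from the normalised trace, the
  normalised eigenvalue and \<open>zterm\<close>, cancel.\<close>

lemma zt_eq: "i \<in> fam \<Longrightarrow> zt i s m = (\<Sum>b\<in>W i m. \<kappa>0 i m b) * ev2 i m powr (- s / 2)"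
proof -
  assume i: "i \<in> fam"
  have e: "0 < ev2 i m" using ev2_ge[of i m] by simp
  have "(q ^ (2 * m)) powr (- s / 2) = q powr (- s * real m)"
    using q by (simp add: powr_powr flip: powr_realpow) (simp add: field_simps)
  moreover have "(q powr (s - 2 * real l)) ^ m = q powr ((s - 2 * real l) * real m)"
    using q by (simp add: powr_powr flip: powr_realpow)
  moreover have "q powr (real m * (2 * real l)) * q powr (- s * real m) * q powr ((s - 2 * real l) * real m) = 1"
    using q by (simp flip: powr_add) (simp add: algebra_simps)
  ultimately show ?thesis
    unfolding zeta_series.zterm_def[OF zeta_series[OF i]] using e q
    by (simp add: powr_mult mult.assoc mult.left_commute)
qed

lemma zcoeff_W:
  assumes "i \<in> fam" shows "(\<Sum>b\<in>W i m. zcoeff s b) = zt i s m"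
proof -
  have "(\<Sum>b\<in>W i m. zcoeff s b) = (\<Sum>b\<in>W i m. \<kappa>0 i m b * ev2 i m powr (- s / 2))"
    by (rule sum.cong) (auto simp: zcoeff_def \<kappa>_W[OF assms] \<mu>_W[OF assms])
  then show ?thesis by (simp add: zt_eq[OF assms] sum_distrib_right)
qed

lemma zcoeff_has_sum:
  assumes "2 * real l < s"
  shows "(zcoeff s has_sum (\<Sum>i\<in>fam. \<Sum>m. zt i s m)) B"
proof -
  have "(zcoeff s has_sum (\<Sum>i\<in>fam. \<Sum>m. \<Sum>b\<in>W i m. zcoeff s b)) B"
  proof (rule has_sum_B)
    show "0 \<le> zcoeff s b" if "b \<in> B" for b using zcoeff_pos[OF that] by (rule less_imp_le)
    show "summable (\<lambda>m. \<Sum>b\<in>W i m. zcoeff s b)" if i: "i \<in> fam" for i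
      using zeta_series.zterm_summable[OF zeta_series[OF i] assms] by (simp add: zcoeff_W[OF i])
  qed
  then show ?thesis by (simp add: zcoeff_W)
qed

text \<open>\<open>card_W\<close> bounds the number of basis vectors of a summand by its trace, so
  the zeta terms dominate.\<close>

lemma \<mu>_powr_summable:
  assumes "2 * real l < s"
  shows "(\<lambda>b. \<mu> b powr (- s / 2)) summable_on B"
proof -
  have "summable (\<lambda>m. \<Sum>b\<in>W i m. \<mu> b powr (- s / 2))" if i: "i \<in> fam" for i
  proof (rule summable_comparison_test'[where N = 0])
    show "summable (zt i s)" by (rule zeta_series.zterm_summable[OF zeta_series[OF i] assms])
    fix m
    have "(\<Sum>b\<in>W i m. \<mu> b powr (- s / 2)) = (\<Sum>b\<in>W i m. ev2 i m powr (- s / 2))"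
      by (rule sum.cong) (auto simp: \<mu>_W[OF i])
    also have "\<dots> = real (card (W i m)) * ev2 i m powr (- s / 2)" by simp
    also have "\<dots> \<le> zt i s m"
      unfolding zt_eq[OF i] by (intro mult_right_mono card_W i) simp
    finally show "norm (\<Sum>b\<in>W i m. \<mu> b powr (- s / 2)) \<le> zt i s m"
      by (simp add: sum_nonneg)
  qed
  then show ?thesis using has_sum_B[of "\<lambda>b. \<mu> b powr (- s / 2)"] by (auto simp: summable_on_def)
qed

lemma zeta_op_trace_class: "2 * real l < s \<Longrightarrow> trace_class (zeta_op K D s)"
  unfolding zeta_op_def using zcoeff_has_sum \<mu>_powr_summable
  by (intro zeta_trace_class) (auto simp: summable_on_def)

lemma zeta_op_trace:
  assumes "2 * real l < s"
  shows "op_trace (zeta_op K D s) = ennreal (\<Sum>i\<in>fam. \<Sum>m. zt i s m)"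
proof -
  have "zcoeff s summable_on B" using zcoeff_has_sum[OF assms] by (auto simp: summable_on_def)
  then have "op_trace (zeta_op K D s) = ennreal (infsum (zcoeff s) B)"
    unfolding zeta_op_def using \<mu>_powr_summable[OF assms] by (rule zeta_trace_class)
  then show ?thesis using infsumI[OF zcoeff_has_sum[OF assms]] by simp
qed

text \<open>All terms are positive, so divergence along the single family of 0-forms
  suffices.\<close>

lemma zeta_op_trace_infinite:
  assumes "s \<le> 2 * real l"
  shows "op_trace (zeta_op K D s) = \<infinity>"
  unfolding zeta_op_def
proof (rule op_trace_infinite)
  show "\<not> zcoeff s summable_on B"
  proof
    assume "zcoeff s summable_on B"
    then have "summable (\<lambda>m. \<Sum>b\<in>W (0, 0) m. zcoeff s b)" by (rule summable_W[OF _ fam_zero])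
    then have "summable (zt (0, 0) s)" by (simp only: zcoeff_W[OF fam_zero])
    then show False
      using zeta_series.zterm_not_summable[OF zeta_series[OF fam_zero] assms] by simp
  qed
qed

lemma spectral_dimension_eq: "spectral_dimension K D = 2 * real l"
proof -
  have "{s. 0 < s \<and> op_trace (zeta_op K D s) < \<infinity>} = {2 * real l<..}"
    using zeta_op_trace zeta_op_trace_infinite l by (force simp: not_less[symmetric])
  then show ?thesis by (simp add: spectral_dimension_def)
qed

lemma zt_nonneg: "i \<in> fam \<Longrightarrow> 0 \<le> zt i s m"
  by (simp add: zt_eq sum_nonneg less_imp_le[OF \<kappa>0_pos])

text \<open>Every family contributes a positive residue, so nothing cancels in the finite sum over
  families.\<close>

lemma zeta_op_residue:
  "\<exists>L. L \<noteq> 0 \<and> ((\<lambda>s. (s - 2 * real l) * enn2real (op_trace (zeta_op K D s))) \<longlongrightarrow> L) (at_right (2 * real l))"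
proof -
  define L where "L = (\<Sum>i\<in>fam. C i * Mlim i powr (- (2 * real l) / 2) / - ln q)"
  have "((\<lambda>s. \<Sum>i\<in>fam. (s - 2 * real l) * (\<Sum>m. zt i s m)) \<longlongrightarrow> L) (at_right (2 * real l))"
    unfolding L_def by (intro tendsto_sum zeta_series.zeta_residue zeta_series)
  moreover have "\<forall>\<^sub>F s in at_right (2 * real l). (\<Sum>i\<in>fam. (s - 2 * real l) * (\<Sum>m. zt i s m))
      = (s - 2 * real l) * enn2real (op_trace (zeta_op K D s))"
    unfolding eventually_at_right_field
  proof (intro exI[of _ "2 * real l + 1"] conjI allI impI)
    fix s assume s: "2 * real l < s"
    have "0 \<le> (\<Sum>i\<in>fam. \<Sum>m. zt i s m)"
      by (intro sum_nonneg suminf_nonneg zeta_series.zterm_summable[OF zeta_series s] zt_nonneg)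
    then show "(\<Sum>i\<in>fam. (s - 2 * real l) * (\<Sum>m. zt i s m))
      = (s - 2 * real l) * enn2real (op_trace (zeta_op K D s))"
      unfolding zeta_op_trace[OF s] by (simp add: sum_distrib_left)
  qed simp
  ultimately have "((\<lambda>s. (s - 2 * real l) * enn2real (op_trace (zeta_op K D s))) \<longlongrightarrow> L) (at_right (2 * real l))"
    by (rule Lim_transform_eventually)
  moreover have "0 < L"
    unfolding L_def
  proof (rule sum_pos[OF finite_fam])
    show "fam \<noteq> {}" using fam_zero by auto
    fix i assume i: "i \<in> fam"
    have "0 < Mlim i" using zeta_series[OF i] by (simp add: zeta_series_def)
    then show "0 < C i * Mlim i powr (- (2 * real l) / 2) / - ln q"
      using C_pos[OF i] q by (intro divide_pos_pos mult_pos_pos) (auto simp: ln_less_zero)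
  qed
  ultimately show ?thesis by (intro exI[of _ L]) auto
qed

end

theorem theorem1:
  fixes q :: real and l :: nat and N :: int
    and \<Omega> :: "nat \<Rightarrow> 'h::complex_hilbert set"
    and a :: "uq_gen \<Rightarrow> 'h \<Rightarrow> 'h"
    and c :: "nat \<Rightarrow> int \<Rightarrow> nat \<Rightarrow> nat"
    and S :: "nat \<Rightarrow> nat \<Rightarrow> nat \<Rightarrow> 'h set"
    and dbar dbar_adj :: "'h \<Rightarrow> 'h"
    and \<alpha> \<beta> :: "nat \<Rightarrow> complex"
    and D :: "'h operator"
    and ev :: "nat \<Rightarrow> nat \<Rightarrow> nat \<Rightarrow> real"
  assumes "0 < q" and "q < 1" and "2 \<le> l"
    and "dolbeault_dirac q l N \<Omega> a c S dbar dbar_adj \<alpha> \<beta> D ev"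
  shows "(\<forall>s > 2 * real l. trace_class (zeta_op (K2rho_op l \<Omega> a) D s)) \<and>
         spectral_dimension (K2rho_op l \<Omega> a) D = 2 * real l \<and>
         (\<exists>L. L \<noteq> 0 \<and>
            ((\<lambda>s. (s - 2 * real l) * enn2real (op_trace (zeta_op (K2rho_op l \<Omega> a) D s)))
               \<longlongrightarrow> L) (at_right (2 * real l)))"
proof -
  interpret dolbeault_dirac q l N \<Omega> a c S dbar dbar_adj \<alpha> \<beta> D ev by (rule assms(4))
  define fam where "fam = Sigma {..l} (families l)"
  \<comment> \<open>The direction in which the highest weights move with m: only the first and the
    last entry grow.\<close>
  define A :: "nat \<Rightarrow> nat" where "A i = (if i = 1 \<or> i = l then 1 else 0)" for i
  \<comment> \<open>The source of the dimension 2l: positions 1 and l have coefficient l each, and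
    they are distinct because l is at least 2.\<close>
  have A_sum: "(\<Sum>j=1..l. real j * (real l + 1 - real j) * real (A j)) = 2 * real l"
  proof -
    have "(\<Sum>j=1..l. real j * (real l + 1 - real j) * real (A j)) = (\<Sum>j\<in>{1, l}. real l)"
      using assms(3) by (intro sum.mono_neutral_cong_right) (auto simp: A_def)
    then show ?thesis using assms(3) by simp
  qed
  let ?P = "\<lambda>i W \<kappa> C. (\<forall>m. finite (W m)) \<and> (\<forall>m. orthonormal (W m)) \<and> (\<forall>m. csubspace hull (W m) = S (fst i) (snd i) m)
    \<and> (\<forall>m b. 0 < \<kappa> m b)
    \<and> (\<forall>m b. b \<in> W m \<longrightarrow> (\<exists>\<theta>. (\<forall>j\<in>{1..l}. a (Kg j) b = \<theta> j *\<^sub>R b) \<and> \<kappa> m b = rho_scalar l \<theta>))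
    \<and> (\<forall>m. real (card (W m)) \<le> (\<Sum>b\<in>W m. \<kappa> m b)) \<and> 0 < C
    \<and> (\<lambda>m. q powr (real m * (2 * real l)) * (\<Sum>b\<in>W m. \<kappa> m b)) \<longlonglongrightarrow> C"
  have "\<forall>i\<in>fam. \<exists>W \<kappa> C. ?P i W \<kappa> C"
  proof
    fix i assume i: "i \<in> fam"
    \<comment> \<open>The constants c_p and the unit vectors are absorbed into the weight at m =
      0.\<close>
    have weight: "summand_weight l (\<lambda>p. c p N (fst i)) (fst i) (snd i) m j
      = m * A j + summand_weight l (\<lambda>p. c p N (fst i)) (fst i) (snd i) 0 j" for m j
      using assms(3) by (auto simp: summand_weight_def edge_weight_def A_def)
    have irrep: "uq_irrep q l (summand_weight l (\<lambda>p. c p N (fst i)) (fst i) (snd i) m) (S (fst i) (snd i) m) a" for m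
      using i by (intro summand_irrep) (auto simp: fam_def)
    show "\<exists>W \<kappa> C. ?P i W \<kappa> C"
      by (rule irrep_family_trace[OF assms(1,2) irrep weight, unfolded A_sum]) blast
  qed
  then obtain W \<kappa> C where WC: "\<forall>i\<in>fam. ?P i (W i) (\<kappa> i) (C i)"
    unfolding bchoice_iff by blast
  interpret dirac_basis q l N \<Omega> a c S dbar dbar_adj \<alpha> \<beta> D ev W \<kappa> C fam
    by unfold_locales (use assms WC in \<open>auto simp: fam_def\<close>)
  show ?thesis using zeta_op_trace_class spectral_dimension_eq zeta_op_residue by blast
qed

end
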